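(* Let $T$ be a finitely branching tree with root $r$, with $(T,r)$ in $\mathscr{C}$. Then $\iota(T,r)$ is equipotent to the set of all infinite branches of $T$, and so are $\sigma(T,r)$, $\varepsilon(T,r)$ and $\operatorname{Ends}(T)$.
   Context: A tree is finitely branching if each node has only finitely many children. An infinite branch of $T$ is a map $f\colon\mathbb{N}\to T$ with $f(0)=r$ and $f(i+1)$ a child of $f(i)$ for all $i$. Graphs are identified with their geometric realisations: the connected graph $T$ carries the path metric $d_T$ (on vertices: length of the shortest path), each edge being isometric to $[0,1]$, which makes $T$ a proper geodesic metric space; it is given the bounded coarse structure of $d_T$ (below). (The vertex set is coarsely equivalent to $T$.) Two sets are equipotent if there is a bijection between them. A coarse structure on a set $X$ is an ideal $\mathcal{C}_X$ of the poset $(\mathcal{P}(X\times X),\subseteq)$ containing the diagonal and closed under composition $E\circ F=\{(x,y)\mid \exists z\in X,\ (x,z)\in E,\ (z,y)\in F\}$ and inversion; its elements are called controlled sets. A metric $d_X$ induces the bounded coarse structure $\{E\subseteq X\times X\mid\sup d_X(E)<+\infty\}$. $B\subseteq X$ is bounded if $B\times B\in\mathcal{C}_X$. A map between coarse spaces is proper if preimages of bounded sets are bounded, bornologous if $(f\times f)(E)$ is controlled for each controlled $E$, and coarse if proper and bornologous. $\mathbf{Coarse}_*$ is the category of pointed coarse spaces and basepoint-preserving coarse maps. $\operatorname{Ends}(X)$, for a topological space $X$: the set of proper rays (continuous maps $\mathbb{R}_{\ge0}\to X$ under which preimages of compact sets are compact) modulo the equivalence relation: $r_0,r_1$ are equivalent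 iff for every compact $K\subseteq X$ there is $N\in\mathbb{N}$ such that $r_0(\mathbb{R}_{\ge N})$ and $r_1(\mathbb{R}_{\ge N})$ lie in the same path-connected component of $X\setminus K$. A coarse sequence in $(X,\xi)$ is a coarse map $s\colon(\mathbb{N},0)\to(X,\xi)$, where $\mathbb{N}$ has the bounded coarse structure of $|i-j|$; $S(X,\xi)$ is the set of coarse sequences. $\sigma(X,\xi):=S(X,\xi)/{\equiv^{\sigma}_{X,\xi}}$, where $s\equiv^{\sigma}_{X,\xi}t$ if there is a finite sequence $s=s_0,\dots,s_n=t$ in $S(X,\xi)$ such that for each $i<n$ one of $s_i,s_{i+1}$ is a subsequence of the other. $\varepsilon(X,\xi):=S(X,\xi)/{\equiv^{\varepsilon}_{X,\xi}}$, where $s\equiv^{\varepsilon}_{X,\xi}t$ if there is $E\in\mathcal{C}_X$ such that for every bounded $B\subseteq X$ with $\xi\in B$ there is $N\in\mathbb{N}$ such that $\{s(i)\}_{i\ge N}$ and $\{t(i)\}_{i\ge N}$ are contained in the same $E$-connected component of $X\setminus B$. ($A\subseteq X$ is $E$-connected if any $x,y\in A$ are joined by a finite sequence $x=x_0,\dots,x_n=y$ in $A$ with $(x_i,x_{i+1})\in E$ for all $i<n$.) Nonstandard setting: $\mathscr{C}$ is a fixed small full subcategory of $\mathbf{Coarse}_*$, assumed to contain (an asymorphic, i.e. isomorphic, copy of) the pointed coarse space considered; $\mathbb{U}$ (the standard universe) is a transitive set containing $\mathscr{C}$ and all classical objects needed, with respect to which the needed set-theoretic formulae are absolute; ${}^{*}\colon\mathbb{U}\hookrightarrow{}^{*}\mathbb{U}$,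 $x\mapsto{}^{*}x$, is a fixed sufficiently saturated elementary extension (families of internal sets indexed by a set in $\mathbb{U}$ and having the finite intersection property have nonempty intersection). Points $x$ of a standard space are identified with ${}^{*}x$. $\iota(X,\xi):=\operatorname{INF}(X,\xi)/{\equiv^{\iota}_{X,\xi}}$, where for $x,y\in{}^{*}X$, $x\sim_X y$ iff $(x,y)\in{}^{*}E$ for some (standard) $E\in\mathcal{C}_X$; $\operatorname{INF}(X,\xi):=\{x\in{}^{*}X\mid x\not\sim_X\xi\}$; and $x\equiv^{\iota}_{X,\xi}y$ if there is an internal hyperfinite sequence $\{x_i\}_{i\le n}$ ($n\in{}^{*}\mathbb{N}$) in $\operatorname{INF}(X,\xi)$ with $x_0=x$, $x_n=y$ and $x_i\sim_X x_{i+1}$ for all $i<n$. *)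

theory Defs
  imports "HOL-Analysis.Analysis" "HOL-Library.Equipollence"
begin

section \<open>Coarse spaces\<close>

definition coarse_structure :: "'a set \<Rightarrow> ('a \<times> 'a) set set \<Rightarrow> bool" where
  "coarse_structure X \<C> \<longleftrightarrow>
     (\<forall>E\<in>\<C>. E \<subseteq> X \<times> X) \<and>
     (\<forall>E\<in>\<C>. \<forall>F. F \<subseteq> E \<longrightarrow> F \<in> \<C>) \<and>
     (\<forall>E\<in>\<C>. \<forall>F\<in>\<C>. E \<union> F \<in> \<C>) \<and>
     Id_on X \<in> \<C> \<and>
     (\<forall>E\<in>\<C>. \<forall>F\<in>\<C>. E O F \<in> \<C>) \<and>
     (\<forall>E\<in>\<C>. E\<inverse> \<in> \<C>)"

definition pointed_coarse_space :: "'a set \<Rightarrow> ('a \<times> 'a) set set \<Rightarrow> 'a \<Rightarrow> bool" where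
  "pointed_coarse_space X \<C> \<xi> \<longleftrightarrow> coarse_structure X \<C> \<and> \<xi> \<in> X"

definition bounded_coarse :: "'a set \<Rightarrow> ('a \<Rightarrow> 'a \<Rightarrow> real) \<Rightarrow> ('a \<times> 'a) set set" where
  "bounded_coarse X d = {E. E \<subseteq> X \<times> X \<and> (\<exists>R. \<forall>(x, y)\<in>E. d x y \<le> R)}"

definition coarsely_bounded :: "'a set \<Rightarrow> ('a \<times> 'a) set set \<Rightarrow> 'a set \<Rightarrow> bool" where
  "coarsely_bounded X \<C> B \<longleftrightarrow> B \<subseteq> X \<and> B \<times> B \<in> \<C>"

definition coarse_map ::
  "'a set \<Rightarrow> ('a \<times> 'a) set set \<Rightarrow> 'b set \<Rightarrow> ('b \<times> 'b) set set \<Rightarrow> ('a \<Rightarrow> 'b) \<Rightarrow> bool" where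
  "coarse_map X \<C> Y \<D> f \<longleftrightarrow>
     f ` X \<subseteq> Y \<and>
     (\<forall>B. coarsely_bounded Y \<D> B \<longrightarrow> coarsely_bounded X \<C> (f -` B \<inter> X)) \<and>
     (\<forall>E\<in>\<C>. map_prod f f ` E \<in> \<D>)"

text \<open>Isomorphism of pointed coarse spaces (in the category of pointed coarse spaces and
  basepoint-preserving coarse maps, where maps are not identified up to closeness).\<close>

definition pointed_asymorphism ::
  "'a set \<Rightarrow> ('a \<times> 'a) set set \<Rightarrow> 'a \<Rightarrow> 'b set \<Rightarrow> ('b \<times> 'b) set set \<Rightarrow> 'b \<Rightarrow> ('a \<Rightarrow> 'b) \<Rightarrow> bool" where
  "pointed_asymorphism X \<C> \<xi> Y \<D> \<eta> f \<longleftrightarrow>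
     bij_betw f X Y \<and> f \<xi> = \<eta> \<and>
     coarse_map X \<C> Y \<D> f \<and> coarse_map Y \<D> X \<C> (inv_into X f)"


section \<open>The invariants \<open>\<sigma>\<close> and \<open>\<epsilon>\<close>\<close>

definition coarse_seqs :: "'a set \<Rightarrow> ('a \<times> 'a) set set \<Rightarrow> 'a \<Rightarrow> (nat \<Rightarrow> 'a) set" where
  "coarse_seqs X \<C> \<xi> =
     {s. coarse_map UNIV (bounded_coarse UNIV (\<lambda>i j. \<bar>real i - real j\<bar>)) X \<C> s \<and> s 0 = \<xi>}"

definition subsequence :: "(nat \<Rightarrow> 'a) \<Rightarrow> (nat \<Rightarrow> 'a) \<Rightarrow> bool" where
  "subsequence s t \<longleftrightarrow> (\<exists>k. strict_mono k \<and> s = t \<circ> k)"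

definition sigma_rel :: "'a set \<Rightarrow> ('a \<times> 'a) set set \<Rightarrow> 'a \<Rightarrow> ((nat \<Rightarrow> 'a) \<times> (nat \<Rightarrow> 'a)) set" where
  "sigma_rel X \<C> \<xi> =
     {(s, t). s \<in> coarse_seqs X \<C> \<xi> \<and> t \<in> coarse_seqs X \<C> \<xi> \<and>
        (s, t) \<in> {(u, v). u \<in> coarse_seqs X \<C> \<xi> \<and> v \<in> coarse_seqs X \<C> \<xi> \<and>
                          (subsequence u v \<or> subsequence v u)}\<^sup>*}"

definition coarse_sigma :: "'a set \<Rightarrow> ('a \<times> 'a) set set \<Rightarrow> 'a \<Rightarrow> (nat \<Rightarrow> 'a) set set" where
  "coarse_sigma X \<C> \<xi> = coarse_seqs X \<C> \<xi> // sigma_rel X \<C> \<xi>"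

definition E_connected :: "('a \<times> 'a) set \<Rightarrow> 'a set \<Rightarrow> bool" where
  "E_connected E A \<longleftrightarrow> (\<forall>x\<in>A. \<forall>y\<in>A. (x, y) \<in> (E \<inter> A \<times> A)\<^sup>*)"

definition E_component :: "('a \<times> 'a) set \<Rightarrow> 'a set \<Rightarrow> 'a set \<Rightarrow> bool" where
  "E_component E Y A \<longleftrightarrow>
     A \<noteq> {} \<and> A \<subseteq> Y \<and> E_connected E A \<and>
     (\<forall>A'. A \<subseteq> A' \<and> A' \<subseteq> Y \<and> E_connected E A' \<longrightarrow> A' = A)"

definition epsilon_rel :: "'a set \<Rightarrow> ('a \<times> 'a) set set \<Rightarrow> 'a \<Rightarrow> ((nat \<Rightarrow> 'a) \<times> (nat \<Rightarrow> 'a)) set" where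
  "epsilon_rel X \<C> \<xi> =
     {(s, t). s \<in> coarse_seqs X \<C> \<xi> \<and> t \<in> coarse_seqs X \<C> \<xi> \<and>
        (\<exists>E\<in>\<C>. \<forall>B. coarsely_bounded X \<C> B \<and> \<xi> \<in> B \<longrightarrow>
           (\<exists>N A. E_component E (X - B) A \<and> s ` {N..} \<subseteq> A \<and> t ` {N..} \<subseteq> A))}"

definition coarse_epsilon :: "'a set \<Rightarrow> ('a \<times> 'a) set set \<Rightarrow> 'a \<Rightarrow> (nat \<Rightarrow> 'a) set set" where
  "coarse_epsilon X \<C> \<xi> = coarse_seqs X \<C> \<xi> // epsilon_rel X \<C> \<xi>"


section \<open>Ends of a topological space\<close>

definition proper_rays :: "'a topology \<Rightarrow> (real \<Rightarrow> 'a) set" where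
  "proper_rays X =
     {\<rho>. \<rho> \<in> extensional {0..} \<and> continuous_map (top_of_set {0..}) X \<rho> \<and>
         (\<forall>K. compactin X K \<longrightarrow> compact {t\<in>{0..}. \<rho> t \<in> K})}"

definition ends_rel :: "'a topology \<Rightarrow> ((real \<Rightarrow> 'a) \<times> (real \<Rightarrow> 'a)) set" where
  "ends_rel X =
     {(\<rho>, \<tau>). \<rho> \<in> proper_rays X \<and> \<tau> \<in> proper_rays X \<and>
        (\<forall>K. compactin X K \<longrightarrow>
           (\<exists>N::nat. \<exists>A \<in> path_components_of (subtopology X (topspace X - K)).
              \<rho> ` {real N..} \<subseteq> A \<and> \<tau> ` {real N..} \<subseteq> A))}"

definition Ends :: "'a topology \<Rightarrow> (real \<Rightarrow> 'a) set set" where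
  "Ends X = proper_rays X // ends_rel X"


section \<open>Rooted trees and their geometric realisations\<close>

text \<open>Simple graphs: vertex set \<open>V\<close>, symmetric irreflexive adjacency relation \<open>G\<close>.\<close>

definition simple_graph :: "'a set \<Rightarrow> ('a \<times> 'a) set \<Rightarrow> bool" where
  "simple_graph V G \<longleftrightarrow> G \<subseteq> V \<times> V \<and> sym G \<and> irrefl G"

definition connected_graph :: "'a set \<Rightarrow> ('a \<times> 'a) set \<Rightarrow> bool" where
  "connected_graph V G \<longleftrightarrow> simple_graph V G \<and> V \<noteq> {} \<and> (\<forall>u\<in>V. \<forall>v\<in>V. (u, v) \<in> G\<^sup>*)"

definition is_cycle :: "('a \<times> 'a) set \<Rightarrow> 'a list \<Rightarrow> bool" where
  "is_cycle G vs \<longleftrightarrow>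
     3 \<le> length vs \<and> distinct vs \<and>
     (\<forall>i. Suc i < length vs \<longrightarrow> (vs ! i, vs ! Suc i) \<in> G) \<and> (last vs, hd vs) \<in> G"

definition rooted_tree :: "'a set \<Rightarrow> ('a \<times> 'a) set \<Rightarrow> 'a \<Rightarrow> bool" where
  "rooted_tree V G r \<longleftrightarrow> connected_graph V G \<and> (\<nexists>vs. is_cycle G vs) \<and> r \<in> V"

definition graph_dist :: "('a \<times> 'a) set \<Rightarrow> 'a \<Rightarrow> 'a \<Rightarrow> nat" where
  "graph_dist G u v = (LEAST n. (u, v) \<in> G ^^ n)"

definition child :: "('a \<times> 'a) set \<Rightarrow> 'a \<Rightarrow> 'a \<Rightarrow> 'a \<Rightarrow> bool" where
  "child G r u v \<longleftrightarrow> (u, v) \<in> G \<and> graph_dist G r v = Suc (graph_dist G r u)"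

definition finitely_branching :: "'a set \<Rightarrow> ('a \<times> 'a) set \<Rightarrow> 'a \<Rightarrow> bool" where
  "finitely_branching V G r \<longleftrightarrow> (\<forall>u\<in>V. finite {v. child G r u v})"

definition infinite_branches :: "'a set \<Rightarrow> ('a \<times> 'a) set \<Rightarrow> 'a \<Rightarrow> (nat \<Rightarrow> 'a) set" where
  "infinite_branches V G r =
     {f. (\<forall>i. f i \<in> V) \<and> f 0 = r \<and> (\<forall>i. child G r (f i) (f (Suc i)))}"

text \<open>Points of the realisation are given by barycentric coordinates: \<open>edge_pt u v t\<close> is the point
  at distance \<open>t\<close> from \<open>u\<close> on the edge \<open>uv\<close>.\<close>

definition vertex_pt :: "'a \<Rightarrow> 'a \<Rightarrow> real" where
  "vertex_pt v = (\<lambda>w. if w = v then 1 else 0)"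

definition edge_pt :: "'a \<Rightarrow> 'a \<Rightarrow> real \<Rightarrow> 'a \<Rightarrow> real" where
  "edge_pt u v t = (\<lambda>w. (1 - t) * vertex_pt u w + t * vertex_pt v w)"

definition realisation :: "'a set \<Rightarrow> ('a \<times> 'a) set \<Rightarrow> ('a \<Rightarrow> real) set" where
  "realisation V G =
     vertex_pt ` V \<union> {edge_pt u v t | u v t. (u, v) \<in> G \<and> 0 \<le> t \<and> t \<le> 1}"

text \<open>\<open>pl_path V G p q l\<close>: there is a path of length \<open>l\<close> from \<open>p\<close> to \<open>q\<close> in the realisation that is
  a finite concatenation of segments, each contained in one edge and measured by the
  parametrisation of that edge by \<open>[0, 1]\<close>.\<close>

inductive pl_path ::
  "'a set \<Rightarrow> ('a \<times> 'a) set \<Rightarrow> ('a \<Rightarrow> real) \<Rightarrow> ('a \<Rightarrow> real) \<Rightarrow> real \<Rightarrow> bool" for V G where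
  pl_path_refl: "p \<in> realisation V G \<Longrightarrow> pl_path V G p p 0"
| pl_path_step: "\<lbrakk>pl_path V G p (edge_pt u v s) l; (u, v) \<in> G; 0 \<le> s; s \<le> 1; 0 \<le> t; t \<le> 1\<rbrakk>
    \<Longrightarrow> pl_path V G p (edge_pt u v t) (l + \<bar>s - t\<bar>)"

text \<open>The path metric; the value 0 for points not joined by a path is a junk value that does not
  occur between points of the realisation of a connected graph.\<close>

definition path_metric :: "'a set \<Rightarrow> ('a \<times> 'a) set \<Rightarrow> ('a \<Rightarrow> real) \<Rightarrow> ('a \<Rightarrow> real) \<Rightarrow> real" where
  "path_metric V G p q = (if \<exists>l. pl_path V G p q l then Inf {l. pl_path V G p q l} else 0)"

text \<open>The next lemmas record that \<open>path_metric\<close> is a metric for which each edge is isometric to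
  \<open>[0, 1]\<close>, and which is the length of a shortest path on vertices.\<close>

lemma edge_pt_0: "edge_pt u v 0 = vertex_pt u"
  and edge_pt_1: "edge_pt u v 1 = vertex_pt v"
  by (auto simp: edge_pt_def)

lemma pl_path_endpoints: "pl_path V G p q l \<Longrightarrow> p \<in> realisation V G \<and> q \<in> realisation V G \<and> 0 \<le> l"
  by (induction rule: pl_path.induct) (auto simp: realisation_def)

lemma pl_path_trans:
  assumes "pl_path V G q s k" "pl_path V G p q l"
  shows "pl_path V G p s (l + k)"
  using assms
proof (induction arbitrary: l rule: pl_path.induct)
  case (pl_path_step p u v s l' t)
  from pl_path.pl_path_step[OF pl_path_step.IH[OF pl_path_step.prems] pl_path_step.hyps(2-6)]
  show ?case by (simp add: add.assoc)
qed simp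

lemma pl_path_edge:
  assumes "(u, v) \<in> G" "0 \<le> s" "s \<le> 1" "0 \<le> t" "t \<le> 1"
  shows "pl_path V G (edge_pt u v s) (edge_pt u v t) \<bar>s - t\<bar>"
proof -
  have "edge_pt u v s \<in> realisation V G" using assms by (auto simp: realisation_def)
  from pl_path_step[OF pl_path_refl[OF this] assms] show ?thesis by simp
qed

lemma pl_path_sym: "pl_path V G p q l \<Longrightarrow> pl_path V G q p l"
proof (induction rule: pl_path.induct)
  case (pl_path_step p u v s l t)
  have "pl_path V G (edge_pt u v t) (edge_pt u v s) \<bar>t - s\<bar>"
    using pl_path_step.hyps by (intro pl_path_edge) auto
  from pl_path_trans[OF pl_path_step.IH this] show ?case
    by (simp add: add.commute abs_minus_commute)
qed (rule pl_path_refl)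

lemma pl_path_lipschitz:
  fixes h :: "('a \<Rightarrow> real) \<Rightarrow> real"
  assumes "\<And>u v s t. (u, v) \<in> G \<Longrightarrow> \<bar>h (edge_pt u v s) - h (edge_pt u v t)\<bar> \<le> \<bar>s - t\<bar>"
    and "pl_path V G p q l"
  shows "\<bar>h p - h q\<bar> \<le> l"
  using assms(2)
proof (induction rule: pl_path.induct)
  case (pl_path_step p u v s l t)
  show ?case using assms(1)[OF pl_path_step.hyps(2), of s t] pl_path_step.IH by linarith
qed simp

lemma path_metric_le: "pl_path V G p q l \<Longrightarrow> path_metric V G p q \<le> l"
  unfolding path_metric_def
  by (auto intro!: cInf_lower bdd_belowI[of _ 0] dest: pl_path_endpoints)

lemma le_path_metric:
  assumes "pl_path V G p q l0" "\<And>l. pl_path V G p q l \<Longrightarrow> b \<le> l"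
  shows "b \<le> path_metric V G p q"
  using assms unfolding path_metric_def by (auto intro!: cInf_greatest)

lemma edge_pt_lipschitz: "\<bar>edge_pt u v s w - edge_pt u v t w\<bar> \<le> \<bar>s - t\<bar>"
  by (auto simp: edge_pt_def vertex_pt_def algebra_simps)

lemma pl_path_coord: "pl_path V G p q l \<Longrightarrow> \<bar>p w - q w\<bar> \<le> l"
  by (rule pl_path_lipschitz[of G "\<lambda>p. p w"]) (rule edge_pt_lipschitz)

lemma path_metric_edge:
  assumes "simple_graph V G" "(u, v) \<in> G" "0 \<le> s" "s \<le> 1" "0 \<le> t" "t \<le> 1"
  shows "path_metric V G (edge_pt u v s) (edge_pt u v t) = \<bar>s - t\<bar>"
proof (rule antisym)
  note p = pl_path_edge[OF assms(2-6), of V]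
  show "path_metric V G (edge_pt u v s) (edge_pt u v t) \<le> \<bar>s - t\<bar>" by (rule path_metric_le[OF p])
  have "u \<noteq> v" using assms by (auto simp: simple_graph_def irrefl_def)
  then have "\<bar>edge_pt u v s v - edge_pt u v t v\<bar> = \<bar>s - t\<bar>"
    by (auto simp: edge_pt_def vertex_pt_def)
  then show "\<bar>s - t\<bar> \<le> path_metric V G (edge_pt u v s) (edge_pt u v t)"
    using pl_path_coord[of V G _ _ _ v] by (metis le_path_metric[OF p])
qed

lemma pl_path_relpow:
  assumes "G \<subseteq> V \<times> V" "u \<in> V" "(u, v) \<in> G ^^ n"
  shows "pl_path V G (vertex_pt u) (vertex_pt v) (real n)"
  using assms(3)
proof (induction n arbitrary: v)
  case 0
  then show ?case using assms(2) by (auto intro!: pl_path_refl simp: realisation_def)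
next
  case (Suc n)
  then obtain w where w: "(u, w) \<in> G ^^ n" "(w, v) \<in> G" by auto
  have "pl_path V G (vertex_pt w) (vertex_pt v) 1"
    using pl_path_edge[OF w(2), of 0 1 V] by (simp add: edge_pt_0 edge_pt_1)
  from pl_path_trans[OF this Suc.IH[OF w(1)]] show ?case by (simp add: add.commute)
qed

lemma realisation_connected:
  assumes "connected_graph V G" "p \<in> realisation V G" "q \<in> realisation V G"
  shows "\<exists>l. pl_path V G p q l"
proof -
  have 1: "\<exists>u\<in>V. \<exists>l. pl_path V G p (vertex_pt u) l" if "p \<in> realisation V G" for p
  proof -
    from that consider u where "u \<in> V" "p = vertex_pt u"
      | u v t where "(u, v) \<in> G" "p = edge_pt u v t" "0 \<le> t" "t \<le> 1"
      by (auto simp: realisation_def)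
    then show ?thesis
    proof cases
      case 1
      then show ?thesis using pl_path_refl[OF that] by blast
    next
      case 2
      from pl_path_edge[OF 2(1) 2(3,4), of 0 V] 2 assms(1) show ?thesis
        by (auto simp: edge_pt_0 connected_graph_def simple_graph_def)
    qed
  qed
  from 1[OF assms(2)] obtain u k where u: "u \<in> V" "pl_path V G p (vertex_pt u) k" by blast
  from 1[OF assms(3)] obtain v l where v: "v \<in> V" "pl_path V G q (vertex_pt v) l" by blast
  from assms(1) u v obtain n where "(u, v) \<in> G ^^ n"
    unfolding connected_graph_def by (meson rtrancl_imp_relpow)
  then have "pl_path V G (vertex_pt u) (vertex_pt v) (real n)"
    using assms(1) u by (intro pl_path_relpow) (auto simp: connected_graph_def simple_graph_def)
  then show ?thesis using pl_path_trans[OF _ u(2)] pl_path_trans[OF pl_path_sym[OF v(2)]] by blast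
qed

lemma Metric_space_path_metric:
  assumes "connected_graph V G"
  shows "Metric_space (realisation V G) (path_metric V G)"
proof
  fix p q s
  have P: "pl_path V G p q = pl_path V G q p" for p q by (auto intro: pl_path_sym)
  show "path_metric V G p q = path_metric V G q p"
    by (simp add: path_metric_def P[of p q])
  show "0 \<le> path_metric V G p q"
    by (auto simp: path_metric_def intro!: cInf_greatest dest: pl_path_endpoints)
  assume pq: "p \<in> realisation V G" "q \<in> realisation V G"
  obtain a where a: "pl_path V G p q a" using realisation_connected[OF assms pq] by blast
  show "path_metric V G p q = 0 \<longleftrightarrow> p = q"
  proof
    assume 0: "path_metric V G p q = 0"
    show "p = q"
    proof
      fix w
      have "\<bar>p w - q w\<bar> \<le> path_metric V G p q"
        by (rule le_path_metric[OF a]) (rule pl_path_coord)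
      then show "p w = q w" using 0 by simp
    qed
  next
    assume "p = q"
    then show "path_metric V G p q = 0"
      using path_metric_le[OF pl_path_refl[OF pq(1)]] \<open>0 \<le> path_metric V G p q\<close> by simp
  qed
  assume s: "s \<in> realisation V G"
  obtain b where b: "pl_path V G q s b" using realisation_connected[OF assms pq(2) s] by blast
  have "path_metric V G p s - k \<le> path_metric V G q s" if k: "pl_path V G p q k" for k
  proof (rule le_path_metric[OF b])
    fix l assume "pl_path V G q s l"
    from path_metric_le[OF pl_path_trans[OF this k]]
    show "path_metric V G p s - k \<le> l" by simp
  qed
  then have "path_metric V G p s - path_metric V G q s \<le> path_metric V G p q"
    by (intro le_path_metric[OF a]) (simp add: algebra_simps)
  then show "path_metric V G p s \<le> path_metric V G p q + path_metric V G q s" by simp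
qed

lemma graph_dist_relpow: "(u, v) \<in> G\<^sup>* \<Longrightarrow> (u, v) \<in> G ^^ graph_dist G u v"
  unfolding graph_dist_def by (meson LeastI rtrancl_imp_relpow)

lemma graph_dist_le: "(u, v) \<in> G ^^ n \<Longrightarrow> graph_dist G u v \<le> n"
  unfolding graph_dist_def by (rule Least_le)

lemma path_metric_vertices:
  assumes G: "connected_graph V G" and uv: "u \<in> V" "v \<in> V"
  shows "path_metric V G (vertex_pt u) (vertex_pt v) = real (graph_dist G u v)"
proof (rule antisym)
  have sub: "G \<subseteq> V \<times> V" and sym: "sym G" and irr: "irrefl G"
    and con: "\<And>x y. x \<in> V \<Longrightarrow> y \<in> V \<Longrightarrow> (x, y) \<in> G\<^sup>*"
    using G by (auto simp: connected_graph_def simple_graph_def)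
  note p = pl_path_relpow[OF sub uv(1) graph_dist_relpow[OF con[OF uv]]]
  show "path_metric V G (vertex_pt u) (vertex_pt v) \<le> real (graph_dist G u v)"
    by (rule path_metric_le[OF p])
  define h where "h = (\<lambda>p. \<Sum>w | p w \<noteq> 0. p w * real (graph_dist G u w))"
  have h_edge: "h (edge_pt a b t) = (1 - t) * real (graph_dist G u a) + t * real (graph_dist G u b)"
    if "a \<noteq> b" for a b t
  proof -
    have "h (edge_pt a b t) = (\<Sum>w\<in>{a, b}. edge_pt a b t w * real (graph_dist G u w))"
      unfolding h_def by (rule sum.mono_neutral_left) (auto simp: edge_pt_def vertex_pt_def)
    then show ?thesis using that by (simp add: edge_pt_def vertex_pt_def)
  qed
  have h_vertex: "h (vertex_pt a) = real (graph_dist G u a)" for a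
  proof -
    have "{w. vertex_pt a w \<noteq> 0} = {a}" by (auto simp: vertex_pt_def)
    then show ?thesis by (simp add: h_def vertex_pt_def)
  qed
  have step: "graph_dist G u b \<le> Suc (graph_dist G u a)" if "(a, b) \<in> G" for a b
  proof -
    have "a \<in> V" using that sub by auto
    then have "(u, b) \<in> G ^^ Suc (graph_dist G u a)"
      using graph_dist_relpow[OF con[OF uv(1)]] that by auto
    then show ?thesis by (rule graph_dist_le)
  qed
  have lip: "\<bar>h (edge_pt a b s) - h (edge_pt a b t)\<bar> \<le> \<bar>s - t\<bar>" if ab: "(a, b) \<in> G" for a b s t
  proof -
    let ?D = "real (graph_dist G u b) - real (graph_dist G u a)"
    have "(b, a) \<in> G" using sym ab by (auto dest: symD)
    then have "\<bar>?D\<bar> \<le> 1" using step[OF ab] step[of b a] by simp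
    moreover have "a \<noteq> b" using irr ab by (auto simp: irrefl_def)
    then have "h (edge_pt a b s) - h (edge_pt a b t) = (s - t) * ?D"
      by (simp add: h_edge algebra_simps)
    ultimately show ?thesis by (simp add: abs_mult mult_left_le)
  qed
  have h0: "graph_dist G u u = 0"
    using graph_dist_le[of u u 0 G] by simp
  show "real (graph_dist G u v) \<le> path_metric V G (vertex_pt u) (vertex_pt v)"
  proof (rule le_path_metric[OF p])
    fix l assume "pl_path V G (vertex_pt u) (vertex_pt v) l"
    from pl_path_lipschitz[of G h, OF lip this] show "real (graph_dist G u v) \<le> l"
      by (simp add: h0 h_vertex)
  qed
qed

abbreviation graph_coarse :: "'a set \<Rightarrow> ('a \<times> 'a) set \<Rightarrow> (('a \<Rightarrow> real) \<times> ('a \<Rightarrow> real)) set set" where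
  "graph_coarse V G \<equiv> bounded_coarse (realisation V G) (path_metric V G)"

abbreviation graph_topology :: "'a set \<Rightarrow> ('a \<times> 'a) set \<Rightarrow> ('a \<Rightarrow> real) topology" where
  "graph_topology V G \<equiv> Metric_space.mtopology (realisation V G) (path_metric V G)"


section \<open>The standard universe and its nonstandard extension\<close>

text \<open>A set-theoretic universe is a type with a binary relation \<open>m\<close>, where \<open>m x y\<close> means
  \<open>x \<in> y\<close>. The standard universe is required to be extensional and well-founded, that is (by
  Mostowski's collapsing lemma) isomorphic to a transitive set with the true membership relation.\<close>

definition elts :: "('u \<Rightarrow> 'u \<Rightarrow> bool) \<Rightarrow> 'u \<Rightarrow> 'u set" where
  "elts m a = {x. m x a}"

definition is_pair :: "('u \<Rightarrow> 'u \<Rightarrow> bool) \<Rightarrow> 'u \<Rightarrow> 'u \<Rightarrow> 'u \<Rightarrow> bool" where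
  "is_pair m z a b \<longleftrightarrow> (\<exists>p q. elts m p = {a} \<and> elts m q = {a, b} \<and> elts m z = {p, q})"

definition is_zero :: "('u \<Rightarrow> 'u \<Rightarrow> bool) \<Rightarrow> 'u \<Rightarrow> bool" where
  "is_zero m z \<longleftrightarrow> elts m z = {}"

definition is_succ :: "('u \<Rightarrow> 'u \<Rightarrow> bool) \<Rightarrow> 'u \<Rightarrow> 'u \<Rightarrow> bool" where
  "is_succ m i j \<longleftrightarrow> elts m j = insert i (elts m i)"

inductive von_neumann_nat :: "('u \<Rightarrow> 'u \<Rightarrow> bool) \<Rightarrow> 'u \<Rightarrow> bool" for m where
  "is_zero m z \<Longrightarrow> von_neumann_nat m z"
| "von_neumann_nat m i \<Longrightarrow> is_succ m i j \<Longrightarrow> von_neumann_nat m j"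

definition omega :: "('u \<Rightarrow> 'u \<Rightarrow> bool) \<Rightarrow> 'u" where
  "omega m = (THE w. elts m w = {i. von_neumann_nat m i})"

text \<open>The closure conditions say that the universe contains the needed classical objects and is
  correct about them: it is closed under unordered pairs, unions and products, has \<open>\<omega>\<close> as an
  element, and every subset of an element is an element. They hold in \<open>V\<^sub>\<lambda>\<close> for every limit
  \<open>\<lambda> > \<omega>\<close>, and in the set of all sets of hereditary cardinality at most \<open>\<kappa>\<close> for every
  infinite cardinal \<open>\<kappa>\<close>. Closure under power sets is deliberately not demanded: a type closed
  under power sets and containing an infinite set cannot be shown to exist in HOL.\<close>

definition standard_universe :: "('u \<Rightarrow> 'u \<Rightarrow> bool) \<Rightarrow> bool" where
  "standard_universe m \<longleftrightarrow>
     wfp m \<and>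
     (\<forall>a b. elts m a = elts m b \<longrightarrow> a = b) \<and>
     (\<exists>w. elts m w = {i. von_neumann_nat m i}) \<and>
     (\<forall>a b. \<exists>c. elts m c = {a, b}) \<and>
     (\<forall>a. \<exists>b. elts m b = (\<Union>x\<in>elts m a. elts m x)) \<and>
     (\<forall>a b. \<exists>c. elts m c = {z. \<exists>x\<in>elts m a. \<exists>y\<in>elts m b. is_pair m z x y}) \<and>
     (\<forall>a S. S \<subseteq> elts m a \<longrightarrow> (\<exists>b. elts m b = S))"

text \<open>First-order formulae of the language of set theory, with variables named by natural numbers.\<close>

datatype fm = FMem nat nat | FEq nat nat | FNeg fm | FAnd fm fm | FEx nat fm

primrec sat :: "('u \<Rightarrow> 'u \<Rightarrow> bool) \<Rightarrow> (nat \<Rightarrow> 'u) \<Rightarrow> fm \<Rightarrow> bool" where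
  "sat m e (FMem i j) = m (e i) (e j)"
| "sat m e (FEq i j) = (e i = e j)"
| "sat m e (FNeg \<phi>) = (\<not> sat m e \<phi>)"
| "sat m e (FAnd \<phi> \<psi>) = (sat m e \<phi> \<and> sat m e \<psi>)"
| "sat m e (FEx i \<phi>) = (\<exists>x. sat m (e(i := x)) \<phi>)"

definition elementary_embedding ::
  "('u \<Rightarrow> 'u \<Rightarrow> bool) \<Rightarrow> ('v \<Rightarrow> 'v \<Rightarrow> bool) \<Rightarrow> ('u \<Rightarrow> 'v) \<Rightarrow> bool" where
  "elementary_embedding m n star \<longleftrightarrow> (\<forall>\<phi> e. sat n (star \<circ> e) \<phi> \<longleftrightarrow> sat m e \<phi>)"

text \<open>Internal sets are the elements of the extended universe, identified with their extensions.
  The index set of the family is (the extension of) an element of the standard universe; the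
  family itself need not be internal.\<close>

definition saturated ::
  "('u \<Rightarrow> 'u \<Rightarrow> bool) \<Rightarrow> ('v \<Rightarrow> 'v \<Rightarrow> bool) \<Rightarrow> bool" where
  "saturated m n \<longleftrightarrow>
     (\<forall>I. \<forall>A :: 'u \<Rightarrow> 'v.
        (\<forall>F. finite F \<and> F \<subseteq> elts m I \<longrightarrow> (\<Inter>i\<in>F. elts n (A i)) \<noteq> {}) \<longrightarrow>
        (\<Inter>i\<in>elts m I. elts n (A i)) \<noteq> {})"

definition coded_rel :: "('u \<Rightarrow> 'u \<Rightarrow> bool) \<Rightarrow> 'u \<Rightarrow> ('u \<times> 'u) set" where
  "coded_rel m e = {(a, b). \<exists>z. m z e \<and> is_pair m z a b}"

text \<open>The element \<open>ob\<close> of the universe is the triple \<open>((X, c), \<xi>)\<close>, where \<open>c\<close> is a coarse structure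
  on \<open>X\<close> and \<open>\<xi>\<close> is a point of \<open>X\<close>.\<close>

definition codes_pointed_coarse_space ::
  "('u \<Rightarrow> 'u \<Rightarrow> bool) \<Rightarrow> 'u \<Rightarrow> 'u \<Rightarrow> 'u \<Rightarrow> 'u \<Rightarrow> bool" where
  "codes_pointed_coarse_space m ob X c \<xi> \<longleftrightarrow>
     (\<exists>p. is_pair m p X c \<and> is_pair m ob p \<xi>) \<and>
     (\<forall>e\<in>elts m c. \<forall>z\<in>elts m e. \<exists>a b. is_pair m z a b) \<and>
     pointed_coarse_space (elts m X) (coded_rel m ` elts m c) \<xi>"

text \<open>A small full subcategory of the category of pointed coarse spaces is determined by its set of
  objects.\<close>

definition small_full_subcategory :: "('u \<Rightarrow> 'u \<Rightarrow> bool) \<Rightarrow> 'u \<Rightarrow> bool" where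
  "small_full_subcategory m \<K> \<longleftrightarrow>
     (\<forall>ob\<in>elts m \<K>. \<exists>X c \<xi>. codes_pointed_coarse_space m ob X c \<xi>)"


section \<open>The invariant \<open>\<iota>\<close>\<close>

text \<open>Here \<open>m\<close> and \<open>n\<close> are the membership relations of the standard universe and of its extension,
  and \<open>X\<close>, \<open>c\<close>, \<open>\<xi>\<close> are elements of the standard universe as in
  \<open>codes_pointed_coarse_space\<close>.\<close>

definition fin_close ::
  "('u \<Rightarrow> 'u \<Rightarrow> bool) \<Rightarrow> ('v \<Rightarrow> 'v \<Rightarrow> bool) \<Rightarrow> ('u \<Rightarrow> 'v) \<Rightarrow> 'u \<Rightarrow> 'v \<Rightarrow> 'v \<Rightarrow> bool" where
  "fin_close m n star c x y \<longleftrightarrow> (\<exists>e\<in>elts m c. (x, y) \<in> coded_rel n (star e))"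

definition INF_pts ::
  "('u \<Rightarrow> 'u \<Rightarrow> bool) \<Rightarrow> ('v \<Rightarrow> 'v \<Rightarrow> bool) \<Rightarrow> ('u \<Rightarrow> 'v) \<Rightarrow> 'u \<Rightarrow> 'u \<Rightarrow> 'u \<Rightarrow> 'v set" where
  "INF_pts m n star X c \<xi> = {x \<in> elts n (star X). \<not> fin_close m n star c x (star \<xi>)}"

text \<open>\<open>internal_seq n k f\<close>: the element \<open>f\<close> of the extended universe is a function with domain
  \<open>{i. i \<le> k}\<close>, for an element \<open>k\<close> of the extension of \<open>\<omega>\<close>.\<close>

definition internal_seq :: "('v \<Rightarrow> 'v \<Rightarrow> bool) \<Rightarrow> 'v \<Rightarrow> 'v \<Rightarrow> bool" where
  "internal_seq n k f \<longleftrightarrow>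
     (\<forall>z\<in>elts n f. \<exists>i a. is_pair n z i a) \<and>
     single_valued (coded_rel n f) \<and>
     Domain (coded_rel n f) = insert k (elts n k)"

definition iota_rel ::
  "('u \<Rightarrow> 'u \<Rightarrow> bool) \<Rightarrow> ('v \<Rightarrow> 'v \<Rightarrow> bool) \<Rightarrow> ('u \<Rightarrow> 'v) \<Rightarrow> 'u \<Rightarrow> 'u \<Rightarrow> 'u \<Rightarrow> ('v \<times> 'v) set" where
  "iota_rel m n star X c \<xi> =
     {(x, y). x \<in> INF_pts m n star X c \<xi> \<and> y \<in> INF_pts m n star X c \<xi> \<and>
        (\<exists>k f. k \<in> elts n (star (omega m)) \<and> internal_seq n k f \<and>
           Range (coded_rel n f) \<subseteq> INF_pts m n star X c \<xi> \<and>
           (\<exists>z. is_zero n z \<and> (z, x) \<in> coded_rel n f) \<and>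
           (k, y) \<in> coded_rel n f \<and>
           (\<forall>i j a b. i \<in> elts n k \<and> is_succ n i j \<and>
              (i, a) \<in> coded_rel n f \<and> (j, b) \<in> coded_rel n f \<longrightarrow> fin_close m n star c a b))}"

definition coarse_iota ::
  "('u \<Rightarrow> 'u \<Rightarrow> bool) \<Rightarrow> ('v \<Rightarrow> 'v \<Rightarrow> bool) \<Rightarrow> ('u \<Rightarrow> 'v) \<Rightarrow> 'u \<Rightarrow> 'u \<Rightarrow> 'u \<Rightarrow> 'v set set" where
  "coarse_iota m n star X c \<xi> = INF_pts m n star X c \<xi> // iota_rel m n star X c \<xi>"

end

theory Submission
  imports Defs
begin

text \<open>For a vertex \<open>v\<close> let \<open>T v\<close> be the closed subtree of points above \<open>v\<close>. A path from \<open>T v\<close> to its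
  complement passes through \<open>v\<close>, so points of \<open>T v\<close> at distance more than \<open>lev v + R\<close> from the root
  are at distance more than \<open>R\<close> from the complement of \<open>T v\<close>. Hence for each level \<open>k\<close> a coarse
  sequence or a proper ray eventually stays in \<open>T v\<close> for exactly one of the finitely many \<open>v\<close> of
  level \<open>k\<close>, and a point at infinity lies in \<open>*(T v)\<close> for exactly one of them; these vertices form
  an infinite branch. In each of the four cases the branch determines the class because any two points
  are joined by a path that stays in every \<open>T v\<close> containing both of them. For \<open>\<iota>\<close>
  this statement is transferred to the extension; saturation is used only to find a point at
  infinity over a given branch.\<close>

section \<open>Spaces branching over a tree\<close>

text \<open>The four sets live on different carriers: \<open>\<iota>\<close> on a copy of the
  realisation inside the universe, known only up to asymorphism, the other three on the realisation
  itself. Hence everything is derived from metric axioms about the sets \<open>T v\<close> that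
  mention neither graphs nor coordinates and that a bijection can carry over to the copy. Separation
  rests on one fact: a function on vertices that changes by at most 1 along each edge extends to a
  1-Lipschitz function on the realisation. For \<open>\<sigma>\<close> the obstacle is that two
  sequences with the same branch may drift apart, so interleaving them need not give a coarse
  sequence; the gaps are filled by chains. For \<open>\<iota>\<close> it is that staying in every
  \<open>T v\<close> refers to an external family of sets; the family is coded by one relation, so
  that the statement becomes a first-order formula. Finite branching acts through finite levels:
  nonstandard extension commutes with finite unions, and balls lie in finitely many compact
  edges.\<close>

lemma quotient_eqpoll:
  assumes ex: "\<And>x. x \<in> A \<Longrightarrow> \<exists>f\<in>B. W x f"
    and uniq: "\<And>x f g. x \<in> A \<Longrightarrow> f \<in> B \<Longrightarrow> g \<in> B \<Longrightarrow> W x f \<Longrightarrow> W x g \<Longrightarrow> f = g"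
    and surj: "\<And>f. f \<in> B \<Longrightarrow> \<exists>x\<in>A. W x f"
    and sub: "R \<subseteq> A \<times> A"
    and R1: "\<And>x y f. x \<in> A \<Longrightarrow> y \<in> A \<Longrightarrow> f \<in> B \<Longrightarrow> W x f \<Longrightarrow> W y f \<Longrightarrow> (x, y) \<in> R"
    and R2: "\<And>x y f. (x, y) \<in> R \<Longrightarrow> f \<in> B \<Longrightarrow> W x f \<Longrightarrow> W y f"
  shows "A // R \<approx> B"
proof -
  \<comment> \<open>\<open>R1\<close> and \<open>R2\<close> together make each class of
    \<open>R\<close> a full fibre of \<open>W\<close>; in particular \<open>R\<close> is an
    equivalence on \<open>A\<close>.\<close>
  have cls: "R `` {x} = {y \<in> A. W y f}" if "x \<in> A" "f \<in> B" "W x f" for x f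
    using that sub R1 R2 by auto
  have "bij_betw (\<lambda>f. {y \<in> A. W y f}) B (A // R)"
    unfolding bij_betw_def
  proof
    show "inj_on (\<lambda>f. {y \<in> A. W y f}) B"
    proof (rule inj_onI)
      fix f g assume "f \<in> B" "g \<in> B" "{y \<in> A. W y f} = {y \<in> A. W y g}"
      then show "f = g" using surj[of f] uniq by blast
    qed
    show "(\<lambda>f. {y \<in> A. W y f}) ` B = A // R"
    proof
      show "(\<lambda>f. {y \<in> A. W y f}) ` B \<subseteq> A // R"
        using surj cls by (force simp: quotient_def)
      show "A // R \<subseteq> (\<lambda>f. {y \<in> A. W y f}) ` B"
        using ex cls by (force simp: quotient_def)
    qed
  qed
  then have "B \<approx> A // R" unfolding eqpoll_def by blast
  then show ?thesis by (rule eqpoll_sym)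
qed

lemma bounded_coarse_nat_iff:
  "E \<in> bounded_coarse UNIV (\<lambda>i j. \<bar>real i - real j\<bar>) \<longleftrightarrow> (\<exists>R. \<forall>(i, j)\<in>E. \<bar>real i - real j\<bar> \<le> R)"
  by (simp add: bounded_coarse_def)

text \<open>The component is everything reachable from one point of \<open>A\<close> by
  \<open>E\<close>-steps inside \<open>Y\<close>. Symmetry of \<open>E\<close> lets any two of its
  points be joined through that base point.\<close>

lemma E_component_exists:
  assumes "A \<noteq> {}" "A \<subseteq> Y" "E_connected E A" "sym E"
  shows "\<exists>A'. E_component E Y A' \<and> A \<subseteq> A'"
proof -
  obtain a where a: "a \<in> A" using assms by blast
  let ?Q = "(E \<inter> Y \<times> Y)"
  let ?A = "?Q\<^sup>* `` {a}"
  have memY: "z \<in> Y" if "(a, z) \<in> ?Q\<^sup>*" for z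
    using that by (induction) (use a assms in auto)
  have in_A: "(a, z) \<in> (E \<inter> ?A \<times> ?A)\<^sup>*" if "(a, z) \<in> ?Q\<^sup>*" for z
    using that
  proof (induction rule: rtrancl_induct)
    case (step y z)
    then have "(y, z) \<in> E \<inter> ?A \<times> ?A" by (auto intro: rtrancl_into_rtrancl)
    with step show ?case by (meson rtrancl_into_rtrancl)
  qed simp
  have symA: "sym ((E \<inter> ?A \<times> ?A)\<^sup>*)" using \<open>sym E\<close> by (intro sym_rtrancl) (auto simp: sym_def)
  have conn: "E_connected E ?A"
    unfolding E_connected_def
  proof (intro ballI)
    fix x y assume "x \<in> ?A" "y \<in> ?A"
    then have "(a, x) \<in> (E \<inter> ?A \<times> ?A)\<^sup>*" "(a, y) \<in> (E \<inter> ?A \<times> ?A)\<^sup>*" using in_A by auto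
    then show "(x, y) \<in> (E \<inter> ?A \<times> ?A)\<^sup>*" using symA by (meson rtrancl_trans symD)
  qed
  have max: "B \<subseteq> ?A" if "a \<in> B" "B \<subseteq> Y" "E_connected E B" for B
  proof
    fix x assume "x \<in> B"
    then have "(a, x) \<in> (E \<inter> B \<times> B)\<^sup>*" using that by (auto simp: E_connected_def)
    then show "x \<in> ?A" using rtrancl_mono[of "E \<inter> B \<times> B" ?Q] that by auto
  qed
  have "E_component E Y ?A"
    unfolding E_component_def using memY conn max by auto
  then show ?thesis using max[OF a assms(2,3)] by blast
qed

lemma subsequence_trans: "subsequence s t \<Longrightarrow> subsequence t u \<Longrightarrow> subsequence s u"
  unfolding subsequence_def by (metis comp_assoc strict_mono_o)

text \<open>\<open>pt v\<close> stands for the point of a vertex and \<open>T v\<close> for the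
  closed subtree above it. \<open>T_separation\<close> expresses that leaving \<open>T v\<close>
  from \<open>a\<close> means passing through \<open>pt v\<close>, which costs at least the height
  of \<open>a\<close> minus \<open>lev v\<close>. \<open>T_chain\<close> asks for unit steps that
  remain in every \<open>T v\<close> containing both ends; all connectivity needed for the coarse
  invariants comes from it.\<close>

locale branching_space = Metric_space X d
  for X :: "'x set" and d :: "'x \<Rightarrow> 'x \<Rightarrow> real" +
  fixes V :: "'a set" and chld :: "'a \<Rightarrow> 'a \<Rightarrow> bool" and lev :: "'a \<Rightarrow> nat" and r :: 'a
    and pt :: "'a \<Rightarrow> 'x" and T :: "'a \<Rightarrow> 'x set"
  assumes finite_level: "finite {v \<in> V. lev v = k}"
    and root: "r \<in> V" and lev_root: "v \<in> V \<Longrightarrow> lev v = 0 \<longleftrightarrow> v = r"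
    and chld_in_V: "chld u v \<Longrightarrow> u \<in> V \<and> v \<in> V"
    and lev_child: "chld u v \<Longrightarrow> lev v = Suc (lev u)"
    and parent: "v \<in> V \<Longrightarrow> lev v = Suc k \<Longrightarrow> \<exists>u\<in>V. chld u v"
    and T_child: "chld u v \<Longrightarrow> T v \<subseteq> T u"
    and pt_in_T: "v \<in> V \<Longrightarrow> pt v \<in> T v"
    and pt_child: "chld u v \<Longrightarrow> d (pt u) (pt v) \<le> 1"
    and T_subset: "v \<in> V \<Longrightarrow> T v \<subseteq> X"
    and T_height: "v \<in> V \<Longrightarrow> x \<in> T v \<Longrightarrow> real (lev v) \<le> d (pt r) x"
    and T_cover: "x \<in> X \<Longrightarrow> real k \<le> d (pt r) x \<Longrightarrow> \<exists>v\<in>V. lev v = k \<and> x \<in> T v"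
    and T_disjoint: "u \<in> V \<Longrightarrow> v \<in> V \<Longrightarrow> lev u = lev v \<Longrightarrow> x \<in> T u \<Longrightarrow> x \<in> T v \<Longrightarrow> u = v"
    and T_separation:
      "v \<in> V \<Longrightarrow> a \<in> T v \<Longrightarrow> b \<in> X - T v \<Longrightarrow> d (pt r) a \<le> real (lev v) + d a b"
    and T_chain: "x \<in> X \<Longrightarrow> y \<in> X \<Longrightarrow>
      (x, y) \<in> {(a, b). d a b \<le> 1 \<and> a \<in> X \<and> b \<in> X \<and>
                  (\<forall>v\<in>V. x \<in> T v \<and> y \<in> T v \<longrightarrow> a \<in> T v \<and> b \<in> T v)}\<^sup>*"
begin

abbreviation "\<C> \<equiv> bounded_coarse X d"
abbreviation "\<xi> \<equiv> pt r"

definition branches :: "(nat \<Rightarrow> 'a) set" where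
  "branches = {f. (\<forall>i. f i \<in> V) \<and> f 0 = r \<and> (\<forall>i. chld (f i) (f (Suc i)))}"

lemma xi_in_X: "\<xi> \<in> X"
  using pt_in_T[OF root] T_subset[OF root] by blast

lemma lev_branch: "f \<in> branches \<Longrightarrow> lev (f i) = i"
  using lev_child[of "f k" "f (Suc k)" for k]
  by (induction i) (auto simp: branches_def lev_root root)

lemma height_pt:
  assumes "v \<in> V"
  shows "d \<xi> (pt v) = real (lev v)"
proof (rule antisym)
  show "real (lev v) \<le> d \<xi> (pt v)" by (rule T_height[OF assms pt_in_T[OF assms]])
  show "d \<xi> (pt v) \<le> real (lev v)"
    using assms
  proof (induction "lev v" arbitrary: v)
    case 0
    then show ?case using lev_root xi_in_X by simp
  next
    case (Suc k)
    obtain u where u: "u \<in> V" "chld u v" using parent[OF Suc.prems] Suc.hyps(2) by metis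
    have "pt u \<in> X" "pt v \<in> X" using pt_in_T T_subset u Suc.prems by blast+
    then have "d \<xi> (pt v) \<le> d \<xi> (pt u) + d (pt u) (pt v)" using triangle xi_in_X by blast
    moreover have "lev v = Suc (lev u)" using lev_child u by blast
    ultimately show ?case using Suc.hyps(1)[of u] Suc.hyps(2) u pt_child[OF u(2)] by simp
  qed
qed

text \<open>Equal points have equal heights, hence equal levels, and then \<open>T_disjoint\<close>
  applies. This later allows \<open>T v\<close> to be named by \<open>pt v\<close>.\<close>

lemma pt_inject: "u \<in> V \<Longrightarrow> v \<in> V \<Longrightarrow> pt u = pt v \<Longrightarrow> u = v"
  using T_disjoint[of u v "pt u"] height_pt[of u] height_pt[of v] pt_in_T[of u] pt_in_T[of v] by simp

text \<open>The vertices selected at successive levels fit together: the parent of the one at level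
  \<open>k + 1\<close> inherits \<open>\<Phi>\<close>, so by uniqueness it is the one selected at
  level \<open>k\<close>.\<close>

lemma branch_exists:
  assumes ex: "\<And>k. \<exists>v\<in>V. lev v = k \<and> \<Phi> v"
    and uniq: "\<And>u v. u \<in> V \<Longrightarrow> v \<in> V \<Longrightarrow> lev u = lev v \<Longrightarrow> \<Phi> u \<Longrightarrow> \<Phi> v \<Longrightarrow> u = v"
    and mono: "\<And>u v. u \<in> V \<Longrightarrow> v \<in> V \<Longrightarrow> chld u v \<Longrightarrow> \<Phi> v \<Longrightarrow> \<Phi> u"
  shows "\<exists>f\<in>branches. \<forall>k. \<Phi> (f k)"
proof -
  from ex obtain f where f: "\<And>k. f k \<in> V" "\<And>k. lev (f k) = k" "\<And>k. \<Phi> (f k)" by metis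
  have "chld (f k) (f (Suc k))" for k
  proof -
    obtain u where u: "u \<in> V" "chld u (f (Suc k))" using parent[OF f(1) f(2)[of "Suc k"]] by blast
    then have "lev u = k" using lev_child f(2)[of "Suc k"] by fastforce
    moreover have "\<Phi> u" using mono[OF u(1) f(1) u(2) f(3)] .
    ultimately show ?thesis using uniq[OF u(1) f(1)[of k]] f u by simp
  qed
  moreover have "f 0 = r" using f(2)[of 0] lev_root[OF f(1)[of 0]] by simp
  ultimately show ?thesis using f by (auto simp: branches_def)
qed

text \<open>The common skeleton of the four theorems, with \<open>\<Phi> x v\<close> read as:
  \<open>x\<close> ends up in \<open>T v\<close>. \<open>R2\<close> is asked vertex by vertex, which
  is the form in which the separation estimate delivers it.\<close>

lemma quotient_eqpoll_branches:
  assumes ex: "\<And>x k. x \<in> A \<Longrightarrow> \<exists>v\<in>V. lev v = k \<and> \<Phi> x v"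
    and uniq: "\<And>x u v. x \<in> A \<Longrightarrow> u \<in> V \<Longrightarrow> v \<in> V \<Longrightarrow> lev u = lev v \<Longrightarrow> \<Phi> x u \<Longrightarrow> \<Phi> x v \<Longrightarrow> u = v"
    and mono: "\<And>x u v. x \<in> A \<Longrightarrow> u \<in> V \<Longrightarrow> v \<in> V \<Longrightarrow> T v \<subseteq> T u \<Longrightarrow> \<Phi> x v \<Longrightarrow> \<Phi> x u"
    and surj: "\<And>f. f \<in> branches \<Longrightarrow> \<exists>x\<in>A. \<forall>k. \<Phi> x (f k)"
    and sub: "R \<subseteq> A \<times> A"
    and R1: "\<And>x y f. x \<in> A \<Longrightarrow> y \<in> A \<Longrightarrow> f \<in> branches \<Longrightarrow> (\<And>k. \<Phi> x (f k)) \<Longrightarrow> (\<And>k. \<Phi> y (f k))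
      \<Longrightarrow> (x, y) \<in> R"
    and R2: "\<And>x y v. (x, y) \<in> R \<Longrightarrow> v \<in> V \<Longrightarrow> \<Phi> x v \<Longrightarrow> \<Phi> y v"
  shows "A // R \<approx> branches"
proof (rule quotient_eqpoll[where W = "\<lambda>x f. \<forall>k. \<Phi> x (f k)"])
  show "\<exists>f\<in>branches. \<forall>k. \<Phi> x (f k)" if "x \<in> A" for x
    by (rule branch_exists[OF ex[OF that] uniq[OF that] mono[OF that]]) (auto dest: T_child)
  show "f = g" if "x \<in> A" "f \<in> branches" "g \<in> branches" "\<forall>k. \<Phi> x (f k)" "\<forall>k. \<Phi> x (g k)" for x f g
  proof
    fix k show "f k = g k"
      by (rule uniq[OF that(1)]) (use that lev_branch in \<open>auto simp: branches_def\<close>)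
  qed
  show "(x, y) \<in> R" if "x \<in> A" "y \<in> A" "f \<in> branches" "\<forall>k. \<Phi> x (f k)" "\<forall>k. \<Phi> y (f k)" for x y f
    using R1 that by blast
  show "\<forall>k. \<Phi> y (f k)" if "(x, y) \<in> R" "f \<in> branches" "\<forall>k. \<Phi> x (f k)" for x y f
    using R2[OF that(1)] that by (auto simp: branches_def)
qed (use surj sub in auto)

text \<open>A step from inside \<open>T v\<close> to outside starts at height at most
  \<open>lev v + R\<close> by \<open>T_separation\<close>, and \<open>A\<close> contains no such
  point.\<close>

lemma stays_in_T:
  assumes "(a, b) \<in> (E \<inter> A \<times> A)\<^sup>*" "\<And>x y. (x, y) \<in> E \<Longrightarrow> d x y \<le> R"
    and "A \<subseteq> X" "v \<in> V" "\<And>x. x \<in> A \<Longrightarrow> d \<xi> x > real (lev v) + R" "a \<in> T v"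
  shows "b \<in> T v"
  using assms(1,6)
proof (induction rule: rtrancl_induct)
  case (step y z)
  then have yz: "d y z \<le> R" "y \<in> A" "z \<in> A" "y \<in> T v" using assms(2) by auto
  show ?case
  proof (rule ccontr)
    assume "z \<notin> T v"
    then have "d \<xi> y \<le> real (lev v) + d y z" using T_separation[of v y z] yz assms by auto
    then show False using yz assms(5)[of y] by linarith
  qed
qed

section \<open>Coarse sequences and the invariants epsilon and sigma\<close>

lemma coarsely_bounded_iff:
  "coarsely_bounded X \<C> B \<longleftrightarrow> B \<subseteq> X \<and> (\<exists>R. \<forall>x\<in>B. d \<xi> x \<le> R)"
proof
  assume "coarsely_bounded X \<C> B"
  then obtain R where R: "B \<subseteq> X" "\<And>x y. x \<in> B \<Longrightarrow> y \<in> B \<Longrightarrow> d x y \<le> R"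
    unfolding coarsely_bounded_def bounded_coarse_def by fast
  show "B \<subseteq> X \<and> (\<exists>R. \<forall>x\<in>B. d \<xi> x \<le> R)"
  proof (cases "B = {}")
    case False
    then obtain z where z: "z \<in> B" by blast
    have "d \<xi> x \<le> d \<xi> z + R" if "x \<in> B" for x
      using triangle[OF xi_in_X, of z x] R(2)[OF z that] subsetD[OF R(1) that] subsetD[OF R(1) z] by linarith
    then show ?thesis using R by blast
  qed auto
next
  assume "B \<subseteq> X \<and> (\<exists>R. \<forall>x\<in>B. d \<xi> x \<le> R)"
  then obtain R where R: "B \<subseteq> X" "\<And>x. x \<in> B \<Longrightarrow> d \<xi> x \<le> R" by blast
  have "d x y \<le> 2 * R" if "x \<in> B" "y \<in> B" for x y
  proof -
    have "d x y \<le> d x \<xi> + d \<xi> y" using triangle xi_in_X that R(1) by blast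
    then show ?thesis using R(2)[OF that(1)] R(2)[OF that(2)] commute[of x \<xi>] by linarith
  qed
  then show "coarsely_bounded X \<C> B"
    using R by (auto simp: coarsely_bounded_def bounded_coarse_def)
qed

text \<open>On the natural numbers the pairs \<open>(i, i + 1)\<close> govern all controlled sets,
  so bornologous means bounded jumps. Bounded sets of indices are the finite ones, so proper means
  leaving every ball for good.\<close>

lemma coarse_seqs_iff:
  "s \<in> coarse_seqs X \<C> \<xi> \<longleftrightarrow> range s \<subseteq> X \<and> s 0 = \<xi> \<and> (\<exists>R. \<forall>i. d (s i) (s (Suc i)) \<le> R) \<and>
     (\<forall>R. \<exists>N. \<forall>i\<ge>N. d \<xi> (s i) > R)"
  (is "?L \<longleftrightarrow> ?R")
proof
  assume ?L
  then have s0: "s 0 = \<xi>"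
    and cm: "coarse_map UNIV (bounded_coarse UNIV (\<lambda>i j. \<bar>real i - real j\<bar>)) X \<C> s"
    by (simp_all add: coarse_seqs_def)
  have s: "range s \<subseteq> X" "s 0 = \<xi>"
    and prpr: "\<And>B. coarsely_bounded X \<C> B \<Longrightarrow>
        coarsely_bounded UNIV (bounded_coarse UNIV (\<lambda>i j. \<bar>real i - real j\<bar>)) (s -` B)"
    and born: "\<And>E. E \<in> bounded_coarse UNIV (\<lambda>i j. \<bar>real i - real j\<bar>) \<Longrightarrow> map_prod s s ` E \<in> \<C>"
    using cm s0 by (simp_all add: coarse_map_def)
  have "map_prod s s ` {(i, Suc i) | i. True} \<in> \<C>"
    by (rule born, unfold bounded_coarse_nat_iff, rule exI[of _ 1]) auto
  then obtain M where "\<forall>(x, y)\<in>map_prod s s ` {(i, Suc i) | i. True}. d x y \<le> M"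
    unfolding bounded_coarse_def by blast
  then have 1: "\<exists>R. \<forall>i. d (s i) (s (Suc i)) \<le> R" by (intro exI[of _ M]) force
  have 2: "\<exists>N. \<forall>i\<ge>N. d \<xi> (s i) > R" for R
  proof -
    \<comment> \<open>The maximum with 0 puts \<open>\<xi> = s 0\<close> into the ball. Thus index 0
      lies in the preimage, and a bound on differences of indices becomes a bound on
      indices.\<close>
    let ?B = "{x \<in> X. d \<xi> x \<le> max R 0}"
    have "coarsely_bounded UNIV (bounded_coarse UNIV (\<lambda>i j. \<bar>real i - real j\<bar>)) (s -` ?B)"
      by (rule prpr) (auto simp: coarsely_bounded_iff)
    then obtain M where M: "\<And>i j. i \<in> s -` ?B \<Longrightarrow> j \<in> s -` ?B \<Longrightarrow> \<bar>real i - real j\<bar> \<le> M"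
      by (fastforce simp: coarsely_bounded_def bounded_coarse_nat_iff)
    have "0 \<in> s -` ?B" using s xi_in_X by auto
    then have le: "real i \<le> M" if "i \<in> s -` ?B" for i using M[OF that \<open>0 \<in> s -` ?B\<close>] by simp
    have "d \<xi> (s i) > R" if "i \<ge> Suc (nat \<lceil>M\<rceil>)" for i
    proof (rule ccontr)
      assume "\<not> d \<xi> (s i) > R"
      then have "i \<in> s -` ?B" using s by auto
      from le[OF this] that show False by linarith
    qed
    then show ?thesis by blast
  qed
  from s 1 2 show ?R by blast
next
  assume ?R
  then obtain R where s: "range s \<subseteq> X" "s 0 = \<xi>" and R: "\<And>i. d (s i) (s (Suc i)) \<le> R"
    and esc: "\<And>R. \<exists>N. \<forall>i\<ge>N. d \<xi> (s i) > R" by blast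
  have sX: "s i \<in> X" for i using s by auto
  have R0: "R \<ge> 0" using R[of 0] nonneg[of "s 0" "s (Suc 0)"] by linarith
  have step: "d (s i) (s (i + k)) \<le> R * real k" for i k
  proof (induction k)
    case (Suc k)
    have "d (s i) (s (i + Suc k)) \<le> d (s i) (s (i + k)) + d (s (i + k)) (s (Suc (i + k)))"
      using triangle[OF sX sX sX] by simp
    then show ?case using Suc R[of "i + k"] by (simp add: algebra_simps)
  qed (use sX in simp)
  have dist: "d (s i) (s j) \<le> R * \<bar>real i - real j\<bar>" for i j
  proof (cases "i \<le> j")
    case True
    then show ?thesis using step[of i "j - i"] by (simp add: of_nat_diff abs_minus_commute)
  next
    case False
    then show ?thesis using step[of j "i - j"] commute[of "s i" "s j"] by (simp add: of_nat_diff)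
  qed
  have born: "map_prod s s ` E \<in> \<C>" if E: "E \<in> bounded_coarse UNIV (\<lambda>i j. \<bar>real i - real j\<bar>)" for E
  proof -
    obtain M where M: "\<And>i j. (i, j) \<in> E \<Longrightarrow> \<bar>real i - real j\<bar> \<le> M"
      using E unfolding bounded_coarse_nat_iff by fast
    have "d (s i) (s j) \<le> R * M" if "(i, j) \<in> E" for i j
      using dist[of i j] mult_left_mono[OF M[OF that] R0] by linarith
    then have "\<forall>(x, y)\<in>map_prod s s ` E. d x y \<le> R * M" by auto
    moreover have "map_prod s s ` E \<subseteq> X \<times> X" using sX by auto
    ultimately show ?thesis unfolding bounded_coarse_def by blast
  qed
  have prpr: "coarsely_bounded UNIV (bounded_coarse UNIV (\<lambda>i j. \<bar>real i - real j\<bar>)) (s -` B)"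
    if B: "coarsely_bounded X \<C> B" for B
  proof -
    obtain M where M: "\<And>x. x \<in> B \<Longrightarrow> d \<xi> x \<le> M" using B by (auto simp: coarsely_bounded_iff)
    obtain N where N: "\<And>i. i \<ge> N \<Longrightarrow> d \<xi> (s i) > M" using esc by blast
    have "i < N" if "s i \<in> B" for i using M[OF that] N[of i] by force
    then have "\<bar>real i - real j\<bar> \<le> real N" if "s i \<in> B" "s j \<in> B" for i j
      using that by (smt (verit) of_nat_0_le_iff of_nat_less_iff)
    then show ?thesis by (auto simp: coarsely_bounded_def bounded_coarse_nat_iff)
  qed
  show ?L using s born prpr by (auto simp: coarse_seqs_def coarse_map_def)
qed

definition tends_into :: "(nat \<Rightarrow> 'x) \<Rightarrow> 'a \<Rightarrow> bool" where
  "tends_into s v \<longleftrightarrow> (\<exists>N. \<forall>i\<ge>N. s i \<in> T v)"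

lemma tends_into_cover:
  assumes "s \<in> coarse_seqs X \<C> \<xi>"
  shows "\<exists>v\<in>V. lev v = k \<and> tends_into s v"
proof -
  obtain R where s: "range s \<subseteq> X" "s 0 = \<xi>" and R: "\<And>i. d (s i) (s (Suc i)) \<le> R"
    and esc: "\<And>R. \<exists>N. \<forall>i\<ge>N. d \<xi> (s i) > R" using assms by (auto simp: coarse_seqs_iff)
  have R0: "R \<ge> 0" using R[of 0] nonneg[of "s 0" "s (Suc 0)"] by linarith
  \<comment> \<open>The margin \<open>R\<close> is the size of one jump: a jump out of
    \<open>T v\<close> would have to start at height at most \<open>k + R\<close>.\<close>
  obtain N where N: "\<And>i. i \<ge> N \<Longrightarrow> d \<xi> (s i) > real k + R" using esc by blast
  obtain v where v: "v \<in> V" "lev v = k" "s N \<in> T v"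
    using T_cover[of "s N" k] N[of N] R0 s by force
  have "s i \<in> T v" if "i \<ge> N" for i
    using that
  proof (induction rule: dec_induct)
    case (step i)
    show ?case
    proof (rule ccontr)
      assume "s (Suc i) \<notin> T v"
      then have "d \<xi> (s i) \<le> real k + d (s i) (s (Suc i))"
        using T_separation[OF v(1) step(3), of "s (Suc i)"] s v by auto
      then show False using N[of i] R[of i] step by linarith
    qed
  qed (use v in simp)
  then show ?thesis using v by (auto simp: tends_into_def)
qed

lemma tends_into_unique:
  assumes "u \<in> V" "v \<in> V" "lev u = lev v" "tends_into s u" "tends_into s v"
  shows "u = v"
proof -
  obtain M N where "\<And>i. i \<ge> M \<Longrightarrow> s i \<in> T u" "\<And>i. i \<ge> N \<Longrightarrow> s i \<in> T v"
    using assms(4,5) by (auto simp: tends_into_def)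
  then show ?thesis using T_disjoint[OF assms(1-3), of "s (max M N)"] by simp
qed

lemma tends_into_mono: "T v \<subseteq> T u \<Longrightarrow> tends_into s v \<Longrightarrow> tends_into s u"
  unfolding tends_into_def by blast

lemma tends_into_escape:
  assumes "f \<in> branches" "\<And>k. tends_into s (f k)"
  shows "\<exists>N. \<forall>i\<ge>N. d \<xi> (s i) > R"
proof -
  obtain k :: nat where k: "R < real k" using reals_Archimedean2 by blast
  obtain N where "\<And>i. i \<ge> N \<Longrightarrow> s i \<in> T (f k)" using assms(2)[of k] by (auto simp: tends_into_def)
  moreover have "real k \<le> d \<xi> x" if "x \<in> T (f k)" for x
    using T_height[of "f k" x] that assms(1) lev_branch[OF assms(1)] by (auto simp: branches_def)
  ultimately show ?thesis using k by (meson less_le_trans)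
qed

lemma T_branch_antimono:
  assumes "f \<in> branches" "i \<le> j"
  shows "T (f j) \<subseteq> T (f i)"
  by (rule lift_Suc_antimono_le[of "\<lambda>i. T (f i)", OF _ assms(2)])
    (use assms T_child in \<open>auto simp: branches_def\<close>)

lemma branch_seq:
  assumes "f \<in> branches"
  shows "(\<lambda>i. pt (f i)) \<in> coarse_seqs X \<C> \<xi>" and "tends_into (\<lambda>i. pt (f i)) (f k)"
proof -
  have in_T: "pt (f i) \<in> T (f i)" for i using assms pt_in_T by (auto simp: branches_def)
  show t: "tends_into (\<lambda>i. pt (f i)) (f k)" for k
    unfolding tends_into_def using T_branch_antimono[OF assms] in_T by blast
  have "pt (f i) \<in> X" for i using in_T[of i] T_subset assms by (auto simp: branches_def)
  moreover have "d (pt (f i)) (pt (f (Suc i))) \<le> 1" for i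
    using assms pt_child by (auto simp: branches_def)
  ultimately show "(\<lambda>i. pt (f i)) \<in> coarse_seqs X \<C> \<xi>"
    using tends_into_escape[OF assms t] assms by (auto simp: coarse_seqs_iff branches_def)
qed

lemma T_connected:
  assumes "v \<in> V"
  shows "E_connected {(x, y). x \<in> X \<and> y \<in> X \<and> d x y \<le> 1} (T v)"
  unfolding E_connected_def
proof (intro ballI)
  fix x y assume xy: "x \<in> T v" "y \<in> T v"
  then have "x \<in> X" "y \<in> X" using T_subset assms by auto
  from T_chain[OF this]
  show "(x, y) \<in> ({(x, y). x \<in> X \<and> y \<in> X \<and> d x y \<le> 1} \<inter> T v \<times> T v)\<^sup>*"
    by (rule rtrancl_mono[THEN subsetD, rotated]) (use xy assms in auto)
qed

theorem coarse_epsilon_eqpoll: "coarse_epsilon X \<C> \<xi> \<approx> branches"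
  unfolding coarse_epsilon_def
proof (rule quotient_eqpoll_branches[where \<Phi> = tends_into])
  show "\<exists>s\<in>coarse_seqs X \<C> \<xi>. \<forall>k. tends_into s (f k)" if "f \<in> branches" for f
    using branch_seq[OF that] by blast
  show "(s, t) \<in> epsilon_rel X \<C> \<xi>"
    if st: "s \<in> coarse_seqs X \<C> \<xi>" "t \<in> coarse_seqs X \<C> \<xi>" and f: "f \<in> branches"
      "\<And>k. tends_into s (f k)" "\<And>k. tends_into t (f k)" for s t f
  proof -
    \<comment> \<open>One \<open>E\<close> serves for all \<open>B\<close>: for large
      \<open>k\<close> the set \<open>T (f k)\<close> avoids \<open>B\<close> and is connected by
      unit steps, so it lies in a single component.\<close>
    let ?E = "{(x, y). x \<in> X \<and> y \<in> X \<and> d x y \<le> 1}"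
    have "\<exists>N A. E_component ?E (X - B) A \<and> s ` {N..} \<subseteq> A \<and> t ` {N..} \<subseteq> A"
      if B: "coarsely_bounded X \<C> B" for B
    proof -
      obtain R where R: "\<And>x. x \<in> B \<Longrightarrow> d \<xi> x \<le> R" using B by (auto simp: coarsely_bounded_iff)
      obtain k :: nat where k: "R < real k" using reals_Archimedean2 by blast
      have fk: "f k \<in> V" "lev (f k) = k" using f(1) lev_branch by (auto simp: branches_def)
      have "T (f k) \<subseteq> X - B" using T_subset[OF fk(1)] T_height[OF fk(1)] fk R k by force
      moreover have "T (f k) \<noteq> {}" using pt_in_T[OF fk(1)] by blast
      moreover have "sym ?E" using commute by (auto simp: sym_def)
      ultimately obtain A where A: "E_component ?E (X - B) A" "T (f k) \<subseteq> A"
        using E_component_exists[OF _ _ T_connected[OF fk(1)]] by blast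
      obtain M N where "\<And>i. i \<ge> M \<Longrightarrow> s i \<in> T (f k)" "\<And>i. i \<ge> N \<Longrightarrow> t i \<in> T (f k)"
        using f(2,3)[of k] by (auto simp: tends_into_def)
      then have "s ` {max M N..} \<subseteq> A \<and> t ` {max M N..} \<subseteq> A" using A(2) by auto
      then show ?thesis using A(1) by blast
    qed
    moreover have "?E \<in> \<C>" by (auto simp: bounded_coarse_def)
    ultimately show ?thesis using st unfolding epsilon_rel_def by blast
  qed
  show "tends_into t v" if st: "(s, t) \<in> epsilon_rel X \<C> \<xi>" and v: "v \<in> V" "tends_into s v" for s t v
  proof -
    obtain E where E: "E \<in> \<C>" "\<And>B. coarsely_bounded X \<C> B \<Longrightarrow> \<xi> \<in> B \<Longrightarrow>
      \<exists>N A. E_component E (X - B) A \<and> s ` {N..} \<subseteq> A \<and> t ` {N..} \<subseteq> A"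
      using st by (auto simp: epsilon_rel_def)
    obtain R0 where R0: "\<And>x y. (x, y) \<in> E \<Longrightarrow> d x y \<le> R0"
      using E(1) unfolding bounded_coarse_def by fast
    \<comment> \<open>The radius \<open>lev v + R\<close> of \<open>?B\<close> has to be nonnegative
      for \<open>\<xi> \<in> ?B\<close>, and it exceeds \<open>lev v\<close> by a bound for
      \<open>E\<close> so that \<open>stays_in_T\<close> applies.\<close>
    define R where "R = max R0 0"
    have R: "d x y \<le> R" if "(x, y) \<in> E" for x y using R0[OF that] by (simp add: R_def)
    let ?B = "{x \<in> X. d \<xi> x \<le> real (lev v) + R}"
    have "coarsely_bounded X \<C> ?B" by (auto simp: coarsely_bounded_iff)
    moreover have "\<xi> \<in> ?B" using xi_in_X by (auto simp: R_def)
    ultimately obtain N A where A: "E_component E (X - ?B) A" "s ` {N..} \<subseteq> A" "t ` {N..} \<subseteq> A"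
      using E(2) by blast
    obtain M where M: "\<And>i. i \<ge> M \<Longrightarrow> s i \<in> T v" using v by (auto simp: tends_into_def)
    have "t j \<in> T v" if "j \<ge> N" for j
    proof (rule stays_in_T[OF _ R _ v(1)])
      show "(s (max M N), t j) \<in> (E \<inter> A \<times> A)\<^sup>*"
      proof -
        have "s (max M N) \<in> A" "t j \<in> A" using A(2,3) that by auto
        then show ?thesis using A(1) unfolding E_component_def E_connected_def by blast
      qed
      show "A \<subseteq> X" "s (max M N) \<in> T v" using A M by (auto simp: E_component_def)
      show "real (lev v) + R < d \<xi> x" if "x \<in> A" for x
        using A(1) that by (force simp: E_component_def)
    qed
    then show ?thesis by (auto simp: tends_into_def)
  qed
qed (auto simp: epsilon_rel_def intro: tends_into_cover tends_into_unique tends_into_mono)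

lemma chain_exists:
  assumes "x \<in> X" "y \<in> X"
  obtains L c where "0 < L" "c 0 = x" "c L = y"
    "\<And>i. i < L \<Longrightarrow> d (c i) (c (Suc i)) \<le> 1"
    "\<And>i. i \<le> L \<Longrightarrow> c i \<in> X"
    "\<And>i v. i \<le> L \<Longrightarrow> v \<in> V \<Longrightarrow> x \<in> T v \<Longrightarrow> y \<in> T v \<Longrightarrow> c i \<in> T v"
proof -
  let ?Q = "{(a, b). d a b \<le> 1 \<and> a \<in> X \<and> b \<in> X \<and>
                  (\<forall>v\<in>V. x \<in> T v \<and> y \<in> T v \<longrightarrow> a \<in> T v \<and> b \<in> T v)}"
  \<comment> \<open>The loop at \<open>x\<close> provides a chain of positive length even when
    \<open>x = y\<close>, so that no block is empty when chains are concatenated.\<close>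
  have "(x, x) \<in> ?Q" using assms by auto
  then have "(x, y) \<in> ?Q\<^sup>+" using T_chain[OF assms] by (rule rtrancl_into_trancl2)
  then obtain L where L: "L > 0" "(x, y) \<in> ?Q ^^ L" by (auto simp: trancl_power)
  then obtain c where c: "c 0 = x" "c L = y" "\<And>i. i < L \<Longrightarrow> (c i, c (Suc i)) \<in> ?Q"
    unfolding relpow_fun_conv by blast
  have "c i \<in> X \<and> (\<forall>v\<in>V. x \<in> T v \<and> y \<in> T v \<longrightarrow> c i \<in> T v)" if "i \<le> L" for i
  proof (cases "i < L")
    case True
    with c(3)[of i] show ?thesis by auto
  next
    case False
    then show ?thesis using that c(2) assms by auto
  qed
  then show ?thesis using that[OF L(1) c(1,2)] c(3) by auto
qed

text \<open>The chains between successive members escape to infinity because each stays in every \<open>T v\<close>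
  containing both of its endpoints.\<close>

lemma interpolate:
  assumes z: "range z \<subseteq> X" "z 0 = \<xi>" and f: "f \<in> branches" "\<And>k. tends_into z (f k)"
  obtains u where "u \<in> coarse_seqs X \<C> \<xi>" "subsequence z u"
proof -
  have zX: "z i \<in> X" for i using z by auto
  have "\<exists>L c. 0 < L \<and> c 0 = z i \<and> c L = z (Suc i) \<and> (\<forall>j<L. d (c j) (c (Suc j)) \<le> 1) \<and>
    (\<forall>j\<le>L. c j \<in> X) \<and> (\<forall>j\<le>L. \<forall>v\<in>V. z i \<in> T v \<longrightarrow> z (Suc i) \<in> T v \<longrightarrow> c j \<in> T v)" for i
    using chain_exists[OF zX[of i] zX[of "Suc i"]] by metis
  then obtain L c where L: "\<And>i. 0 < L i" and c0: "\<And>i. c i 0 = z i"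
    and cL: "\<And>i. c i (L i) = z (Suc i)"
    and step: "\<And>i j. j < L i \<Longrightarrow> d (c i j) (c i (Suc j)) \<le> 1"
    and cX: "\<And>i j. j \<le> L i \<Longrightarrow> c i j \<in> X"
    and cT: "\<And>i j v. j \<le> L i \<Longrightarrow> v \<in> V \<Longrightarrow> z i \<in> T v \<Longrightarrow> z (Suc i) \<in> T v \<Longrightarrow> c i j \<in> T v"
    by metis
  define p where "p i = (\<Sum>j<i. L j)" for i
  have pSuc: "p (Suc i) = p i + L i" for i by (simp add: p_def)
  have p0: "p 0 = 0" by (simp add: p_def)
  have mono: "strict_mono p" by (rule strict_monoI_Suc) (simp add: pSuc L)
  \<comment> \<open>Concatenation of the chains \<open>c i\<close>: block \<open>i\<close> occupies
    the indices from \<open>p i\<close> to \<open>p (Suc i) - 1\<close>, and the least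
    \<open>i\<close> locates the block of \<open>t\<close>.\<close>
  define u where "u t = (let i = LEAST i. t < p (Suc i) in c i (t - p i))" for t
  have idx: "(LEAST i'. p i + j < p (Suc i')) = i" if "j < L i" for i j
  proof (rule Least_equality)
    fix i' assume "p i + j < p (Suc i')"
    then show "i \<le> i'" using strict_mono_less[OF mono, of i "Suc i'"] by simp
  qed (simp add: pSuc that)
  \<comment> \<open>At \<open>j = L i\<close> the index already belongs to the next block; the
    formula still holds because both chains pass through \<open>z (Suc i)\<close> there.\<close>
  have u: "u (p i + j) = c i j" if "j \<le> L i" for i j
  proof (cases "j < L i")
    case True
    then show ?thesis by (simp add: u_def idx)
  next
    case False
    then have "j = L i" using that by simp
    moreover have "u (p (Suc i) + 0) = c (Suc i) 0"
      unfolding u_def by (subst idx[OF L]) simp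
    ultimately show ?thesis by (simp add: pSuc c0 cL)
  qed
  have ex: "\<exists>i j. t = p i + j \<and> j < L i" for t
  proof (induction t)
    case 0
    then show ?case using L[of 0] p0 by (intro exI[of _ 0]) auto
  next
    case (Suc t)
    then obtain i j where ij: "t = p i + j" "j < L i" by blast
    show ?case
    proof (cases "Suc j < L i")
      case True
      then show ?thesis using ij by (intro exI[of _ i] exI[of _ "Suc j"]) auto
    next
      case False
      then have "Suc t = p (Suc i) + 0" using ij by (simp add: pSuc)
      then show ?thesis using L by blast
    qed
  qed
  have uX: "u t \<in> X" for t using ex[of t] u cX by fastforce
  have ustep: "d (u t) (u (Suc t)) \<le> 1" for t
  proof -
    obtain i j where ij: "t = p i + j" "j < L i" using ex by blast
    then show ?thesis using u[of j i] u[of "Suc j" i] step[of j i] by simp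
  qed
  have uT: "tends_into u (f k)" for k
  proof -
    have fk: "f k \<in> V" using f by (auto simp: branches_def)
    obtain N where N: "\<And>i. i \<ge> N \<Longrightarrow> z i \<in> T (f k)" using f(2)[of k] by (auto simp: tends_into_def)
    have "u t \<in> T (f k)" if "t \<ge> p N" for t
    proof -
      obtain i j where ij: "t = p i + j" "j < L i" using ex by blast
      then have "p N < p (Suc i)" using that by (simp add: pSuc)
      then have "N \<le> i" using strict_mono_less[OF mono] by simp
      then show ?thesis using u[of j i] ij cT[of j i, OF _ fk] N by simp
    qed
    then show ?thesis by (auto simp: tends_into_def)
  qed
  have "u 0 = \<xi>" using u[of 0 0] c0 z p0 by simp
  then have "u \<in> coarse_seqs X \<C> \<xi>"
    using uX ustep tends_into_escape[OF f(1) uT] by (auto simp: coarse_seqs_iff)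
  moreover have "u (p i) = z i" for i using u[of 0 i] c0 by simp
  then have "subsequence z u" unfolding subsequence_def using mono by (intro exI[of _ p]) auto
  ultimately show ?thesis using that by blast
qed

theorem coarse_sigma_eqpoll: "coarse_sigma X \<C> \<xi> \<approx> branches"
  unfolding coarse_sigma_def
proof (rule quotient_eqpoll_branches[where \<Phi> = tends_into])
  let ?Q = "{(u, v). u \<in> coarse_seqs X \<C> \<xi> \<and> v \<in> coarse_seqs X \<C> \<xi> \<and>
                          (subsequence u v \<or> subsequence v u)}"
  show "\<exists>s\<in>coarse_seqs X \<C> \<xi>. \<forall>k. tends_into s (f k)" if "f \<in> branches" for f
    using branch_seq[OF that] by blast
  show "(s, t) \<in> sigma_rel X \<C> \<xi>"
    if st: "s \<in> coarse_seqs X \<C> \<xi>" "t \<in> coarse_seqs X \<C> \<xi>" and f: "f \<in> branches"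
      "\<And>k. tends_into s (f k)" "\<And>k. tends_into t (f k)" for s t f
  proof -
    \<comment> \<open>The jumps of \<open>z\<close> between \<open>s\<close> and \<open>t\<close>
      may be unbounded. Filling \<open>z\<close> by chains gives a coarse sequence \<open>u\<close>
      that has both \<open>s\<close> and \<open>t\<close> as subsequences.\<close>
    define z where "z i = (if even i then s (i div 2) else t (i div 2))" for i
    have z: "range z \<subseteq> X" "z 0 = \<xi>" using st by (auto simp: z_def coarse_seqs_iff)
    have "tends_into z (f k)" for k
    proof -
      obtain M N where MN: "\<And>i. i \<ge> M \<Longrightarrow> s i \<in> T (f k)" "\<And>i. i \<ge> N \<Longrightarrow> t i \<in> T (f k)"
        using f(2,3)[of k] by (auto simp: tends_into_def)
      have "z i \<in> T (f k)" if "i \<ge> 2 * (M + N)" for i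
        using that MN(1)[of "i div 2"] MN(2)[of "i div 2"] by (auto simp: z_def)
      then show ?thesis unfolding tends_into_def by blast
    qed
    from interpolate[OF z f(1) this] obtain u where u: "u \<in> coarse_seqs X \<C> \<xi>" "subsequence z u" .
    have "subsequence s z" unfolding subsequence_def
      by (intro exI[of _ "\<lambda>i. 2 * i"]) (auto simp: z_def strict_mono_def)
    moreover have "subsequence t z" unfolding subsequence_def
      by (intro exI[of _ "\<lambda>i. 2 * i + 1"]) (auto simp: z_def strict_mono_def)
    ultimately have "(s, u) \<in> ?Q" "(u, t) \<in> ?Q" using st u subsequence_trans by blast+
    then have "(s, t) \<in> ?Q\<^sup>*" by (meson rtrancl.rtrancl_into_rtrancl r_into_rtrancl)
    then show ?thesis using st by (auto simp: sigma_rel_def)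
  qed
  have sub: "tends_into t v \<longleftrightarrow> tends_into s v"
    if st: "s \<in> coarse_seqs X \<C> \<xi>" "t \<in> coarse_seqs X \<C> \<xi>" "subsequence s t" and v: "v \<in> V" for s t v
  proof -
    obtain k where k: "strict_mono k" "s = t \<circ> k" using st(3) by (auto simp: subsequence_def)
    have imp: "tends_into s w" if "tends_into t w" for w
      using that strict_mono_imp_increasing[OF k(1)] le_trans unfolding tends_into_def k(2) comp_def by blast
    \<comment> \<open>Only the passage from \<open>t\<close> to its subsequence \<open>s\<close> is
      immediate. For the converse, \<open>t\<close> tends into some \<open>w\<close> of the right
      level, \<open>s\<close> must follow, and uniqueness gives \<open>w = v\<close>.\<close>
    obtain w where w: "w \<in> V" "lev w = lev v" "tends_into t w" using tends_into_cover[OF st(2)] by blast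
    then show ?thesis using imp tends_into_unique[of w v s] v by metis
  qed
  show "tends_into t v" if st: "(s, t) \<in> sigma_rel X \<C> \<xi>" and v: "v \<in> V" "tends_into s v" for s t v
  proof -
    have "(s, t) \<in> ?Q\<^sup>*" using st by (auto simp: sigma_rel_def)
    then show ?thesis
      by (induction rule: rtrancl_induct) (use v sub in blast)+
  qed
qed (auto simp: sigma_rel_def intro: tends_into_cover tends_into_unique tends_into_mono)

end

section \<open>Ends\<close>

lemma (in Metric_space) continuous_map_lipschitz:
  fixes S :: "real set"
  assumes "\<And>t. t \<in> S \<Longrightarrow> f t \<in> M" "\<And>s t. s \<in> S \<Longrightarrow> t \<in> S \<Longrightarrow> d (f s) (f t) \<le> \<bar>s - t\<bar>"
  shows "continuous_map (top_of_set S) mtopology f"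
  unfolding continuous_map_to_metric
proof (intro ballI allI impI)
  fix t \<epsilon> :: real assume t: "t \<in> topspace (top_of_set S)" "0 < \<epsilon>"
  have "openin (top_of_set S) (S \<inter> ball t \<epsilon>)" by (simp add: openin_open_Int)
  moreover have "t \<in> S \<inter> ball t \<epsilon>" using t by simp
  moreover have "f y \<in> mball (f t) \<epsilon>" if "y \<in> S \<inter> ball t \<epsilon>" for y
    using that t assms(1) assms(2)[of t y] by (auto simp: dist_real_def)
  ultimately show "\<exists>U. openin (top_of_set S) U \<and> t \<in> U \<and> (\<forall>y\<in>U. f y \<in> mball (f t) \<epsilon>)" by blast
qed

text \<open>The topological supplement for ends: balls lie in compact sets, the sets
  \<open>T v\<close> are joined by genuine paths instead of chains, and each branch is followed by a
  continuous ray.\<close>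

locale branching_length_space = branching_space +
  assumes T_path_connected: "v \<in> V \<Longrightarrow> path_connectedin mtopology (T v)"
    and compact_exhaustion: "\<exists>K. compactin mtopology K \<and> {x \<in> X. d (pt r) x \<le> real k} \<subseteq> K"
    and branch_ray: "f 0 = r \<Longrightarrow> (\<And>i. chld (f i) (f (Suc i))) \<Longrightarrow>
      \<exists>\<rho>. (\<forall>s\<ge>0. \<forall>t\<ge>0. d (\<rho> s) (\<rho> t) \<le> \<bar>s - t\<bar>) \<and> (\<forall>k. \<forall>t\<ge>real k. \<rho> t \<in> T (f k))"
begin

text \<open>Outside the ball of radius \<open>lev v\<close>, the sets \<open>T v\<close> and its complement are both open.\<close>

lemma connected_subset_T:
  assumes v: "v \<in> V" and A: "connectedin mtopology A" "\<And>x. x \<in> A \<Longrightarrow> d \<xi> x > real (lev v)"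
    and meet: "A \<inter> T v \<noteq> {}"
  shows "A \<subseteq> T v"
proof -
  let ?O = "{x \<in> X. d \<xi> x > real (lev v)}"
  \<comment> \<open>Half the excess of height is what the case \<open>b \<in> T v\<close>,
    \<open>a \<notin> T v\<close> requires: there \<open>b\<close> has height at most
    \<open>lev v + d a b\<close>, and \<open>a\<close> at most \<open>d a b\<close> more.\<close>
  have close: "b \<in> ?O \<and> (b \<in> T v \<longleftrightarrow> a \<in> T v)"
    if a: "a \<in> ?O" and b: "b \<in> X" "d a b < (d \<xi> a - real (lev v)) / 2" for a b
  proof -
    have 1: "d \<xi> a \<le> d \<xi> b + d a b" using triangle[OF xi_in_X b(1), of a] commute[of a b] a by auto
    have 2: "d \<xi> a \<le> real (lev v) + d a b" if "a \<in> T v" "b \<notin> T v"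
      using T_separation[OF v, of a b] that b by auto
    have 3: "d \<xi> b \<le> real (lev v) + d a b" if "b \<in> T v" "a \<notin> T v"
      using T_separation[OF v, of b a] that a commute[of a b] by auto
    have 4: "0 \<le> d a b" "2 * d a b < d \<xi> a - real (lev v)" using b(2) by simp_all
    have "real (lev v) < d \<xi> b" using 1 4 by linarith
    moreover have "\<not> (a \<in> T v \<and> b \<notin> T v)" using 2 4 by force
    moreover have "\<not> (b \<in> T v \<and> a \<notin> T v)" using 1 3 4 by force
    ultimately have "real (lev v) < d \<xi> b" "b \<in> T v \<longleftrightarrow> a \<in> T v" by blast+
    then show ?thesis using b by auto
  qed
  have op: "openin mtopology (?O \<inter> {x. x \<in> T v \<longleftrightarrow> P})" for P
    unfolding openin_mtopology
  proof (intro conjI allI impI)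
    fix a assume a: "a \<in> ?O \<inter> {x. x \<in> T v \<longleftrightarrow> P}"
    have "mball a ((d \<xi> a - real (lev v)) / 2) \<subseteq> ?O \<inter> {x. x \<in> T v \<longleftrightarrow> P}"
    proof
      fix b assume "b \<in> mball a ((d \<xi> a - real (lev v)) / 2)"
      then have "b \<in> ?O \<and> (b \<in> T v \<longleftrightarrow> a \<in> T v)" by (intro close) (use a in auto)
      then show "b \<in> ?O \<inter> {x. x \<in> T v \<longleftrightarrow> P}" using a by blast
    qed
    moreover have "0 < (d \<xi> a - real (lev v)) / 2" using a by simp
    ultimately show "\<exists>r>0. mball a r \<subseteq> ?O \<inter> {x. x \<in> T v \<longleftrightarrow> P}" by blast
  qed auto
  have AX: "A \<subseteq> X" using A(1) connectedin_subset_topspace by force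
  show ?thesis
  proof (rule ccontr)
    assume "\<not> A \<subseteq> T v"
    then have "A \<subseteq> (?O \<inter> {x. x \<in> T v \<longleftrightarrow> True}) \<union> (?O \<inter> {x. x \<in> T v \<longleftrightarrow> False})"
      "(?O \<inter> {x. x \<in> T v \<longleftrightarrow> True}) \<inter> (?O \<inter> {x. x \<in> T v \<longleftrightarrow> False}) \<inter> A = {}"
      "(?O \<inter> {x. x \<in> T v \<longleftrightarrow> True}) \<inter> A \<noteq> {}" "(?O \<inter> {x. x \<in> T v \<longleftrightarrow> False}) \<inter> A \<noteq> {}"
      using A(2) AX meet by auto
    then show False using A(1) op[of True] op[of False] unfolding connectedin by blast
  qed
qed

definition ray_into :: "(real \<Rightarrow> 'a) \<Rightarrow> 'b \<Rightarrow> bool" where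
  "ray_into \<rho> v \<longleftrightarrow> (\<exists>N. \<forall>t\<ge>N. \<rho> t \<in> T v)"

lemma ray_into_cover:
  assumes "\<rho> \<in> proper_rays mtopology"
  shows "\<exists>v\<in>V. lev v = k \<and> ray_into \<rho> v"
proof -
  have cont: "continuous_map (top_of_set {0..}) mtopology \<rho>"
    and prpr: "\<And>K. compactin mtopology K \<Longrightarrow> compact {t\<in>{0..}. \<rho> t \<in> K}"
    using assms by (auto simp: proper_rays_def)
  obtain K where K: "compactin mtopology K" "{x \<in> X. d \<xi> x \<le> real k} \<subseteq> K"
    using compact_exhaustion by blast
  obtain M where M: "\<And>t. 0 \<le> t \<Longrightarrow> \<rho> t \<in> K \<Longrightarrow> t \<le> M"
    using compact_imp_bounded[OF prpr[OF K(1)]] by (fastforce simp: bounded_real)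
  \<comment> \<open>Adding 1 places all times from \<open>N\<close> on strictly after the last visit
    to \<open>K\<close>; the maximum keeps \<open>N\<close> in the domain of the ray.\<close>
  define N where "N = max 0 (M + 1)"
  have \<rho>X: "\<rho> t \<in> X" if "0 \<le> t" for t using continuous_map_image_subset_topspace[OF cont] that by auto
  have far: "d \<xi> (\<rho> t) > real k" if "N \<le> t" for t
    using that M[of t] K(2) \<rho>X[of t] by (force simp: N_def)
  obtain v where v: "v \<in> V" "lev v = k" "\<rho> N \<in> T v"
    using T_cover[OF \<rho>X, of N k] far[of N] by (force simp: N_def)
  have "connectedin (top_of_set {0..}) {N..}"
    by (simp add: connectedin_subtopology N_def)
  from connectedin_continuous_map_image[OF cont this]
  have "\<rho> ` {N..} \<subseteq> T v"
    by (rule connected_subset_T[OF v(1)]) (use far v in auto)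
  then show ?thesis using v unfolding ray_into_def by blast
qed

lemma ray_into_unique:
  assumes "u \<in> V" "v \<in> V" "lev u = lev v" "ray_into \<rho> u" "ray_into \<rho> v"
  shows "u = v"
proof -
  obtain M N where "\<And>t. t \<ge> M \<Longrightarrow> \<rho> t \<in> T u" "\<And>t. t \<ge> N \<Longrightarrow> \<rho> t \<in> T v"
    using assms(4,5) by (auto simp: ray_into_def)
  then show ?thesis using T_disjoint[OF assms(1-3), of "\<rho> (max M N)"] by simp
qed

lemma ray_into_surj:
  assumes f: "f \<in> branches"
  shows "\<exists>\<rho>\<in>proper_rays mtopology. \<forall>k. ray_into \<rho> (f k)"
proof -
  have fV: "f k \<in> V" for k using f by (auto simp: branches_def)
  obtain \<sigma> where lip: "\<And>s t. 0 \<le> s \<Longrightarrow> 0 \<le> t \<Longrightarrow> d (\<sigma> s) (\<sigma> t) \<le> \<bar>s - t\<bar>"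
    and in_T: "\<And>k t. real k \<le> t \<Longrightarrow> \<sigma> t \<in> T (f k)"
    using branch_ray[of f] f by (auto simp: branches_def)
  define \<rho> where "\<rho> = restrict \<sigma> {0..}"
  have \<rho>X: "\<rho> t \<in> X" if "0 \<le> t" for t
    using in_T[of 0 t] T_subset[OF fV] that by (auto simp: \<rho>_def)
  have cont: "continuous_map (top_of_set {0..}) mtopology \<rho>"
    by (rule continuous_map_lipschitz) (use \<rho>X lip in \<open>auto simp: \<rho>_def\<close>)
  have "compact {t\<in>{0..}. \<rho> t \<in> K}" if K: "compactin mtopology K" for K
  proof -
    have "mbounded K" by (rule compactin_imp_mbounded[OF K])
    then obtain c B where "K \<subseteq> mcball c B" by (auto simp: mbounded_def)
    then have B: "x \<in> X \<and> c \<in> X \<and> d c x \<le> B" if "x \<in> K" for x using that by (auto simp: in_mcball)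
    \<comment> \<open>From time \<open>k\<close> on the ray has height at least \<open>k\<close>,
      which exceeds the height of every point of \<open>K\<close>.\<close>
    obtain k :: nat where k: "d \<xi> c + B < real k" using reals_Archimedean2 by blast
    have "t \<le> real k" if t: "0 \<le> t" "\<rho> t \<in> K" for t
    proof (rule ccontr)
      assume "\<not> t \<le> real k"
      then have "\<rho> t \<in> T (f k)" using in_T[of k t] t by (simp add: \<rho>_def)
      then have "real k \<le> d \<xi> (\<rho> t)" using T_height[OF fV] lev_branch[OF f] by metis
      moreover have "d \<xi> (\<rho> t) \<le> d \<xi> c + d c (\<rho> t)" using triangle[OF xi_in_X] B[OF t(2)] by blast
      ultimately show False using k B[OF t(2)] by linarith
    qed
    then have "bounded {t\<in>{0..}. \<rho> t \<in> K}" unfolding bounded_real by (intro exI[of _ "real k"]) auto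
    moreover have "closedin (top_of_set {0..}) {t \<in> topspace (top_of_set {0..}). \<rho> t \<in> K}"
      by (rule closedin_continuous_map_preimage[OF cont])
        (rule compactin_imp_closedin[OF Hausdorff_space_mtopology K])
    then have "closed {t\<in>{0..}. \<rho> t \<in> K}" by (simp add: closedin_closed_eq)
    ultimately show ?thesis by (simp add: compact_eq_bounded_closed)
  qed
  then have "\<rho> \<in> proper_rays mtopology" using cont by (auto simp: proper_rays_def \<rho>_def)
  moreover have "\<rho> t \<in> T (f k)" if "real k \<le> t" for k t
  proof -
    have "0 \<le> t" using that of_nat_0_le_iff[of k] by linarith
    then show ?thesis using in_T[OF that] by (simp add: \<rho>_def)
  qed
  then have "\<forall>k. ray_into \<rho> (f k)" unfolding ray_into_def by blast
  ultimately show ?thesis by blast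
qed

lemma ray_into_ends_rel:
  assumes rays: "\<rho> \<in> proper_rays mtopology" "\<tau> \<in> proper_rays mtopology"
    and f: "f \<in> branches" "\<And>k. ray_into \<rho> (f k)" "\<And>k. ray_into \<tau> (f k)"
  shows "(\<rho>, \<tau>) \<in> ends_rel mtopology"
proof -
  have fV: "f k \<in> V" for k using f by (auto simp: branches_def)
  have "\<exists>N::nat. \<exists>A\<in>path_components_of (subtopology mtopology (topspace mtopology - K)).
      \<rho> ` {real N..} \<subseteq> A \<and> \<tau> ` {real N..} \<subseteq> A" if K: "compactin mtopology K" for K
  proof -
    have "mbounded K" by (rule compactin_imp_mbounded[OF K])
    then obtain c B where "K \<subseteq> mcball c B" by (auto simp: mbounded_def)
    then have B: "x \<in> X \<and> c \<in> X \<and> d c x \<le> B" if "x \<in> K" for x using that by (auto simp: in_mcball)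
    obtain k :: nat where k: "d \<xi> c + B < real k" using reals_Archimedean2 by blast
    have "T (f k) \<subseteq> X - K"
    proof
      fix x assume x: "x \<in> T (f k)"
      have "real k \<le> d \<xi> x" using T_height[OF fV x] lev_branch[OF f(1)] by metis
      moreover have "d \<xi> x \<le> d \<xi> c + d c x" if "x \<in> K" using triangle[OF xi_in_X] B[OF that] by blast
      ultimately have "x \<notin> K" using B[of x] k by fastforce
      then show "x \<in> X - K" using x T_subset[OF fV] by blast
    qed
    then have pc: "path_connectedin (subtopology mtopology (X - K)) (T (f k))"
      using T_path_connected[OF fV] by (simp add: path_connectedin_subtopology)
    let ?A = "path_component_of_set (subtopology mtopology (X - K)) (pt (f k))"
    have sub: "T (f k) \<subseteq> ?A" by (rule path_component_of_maximal[OF pc pt_in_T[OF fV]])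
    have "pt (f k) \<in> topspace (subtopology mtopology (X - K))"
      using pc pt_in_T[OF fV] path_connectedin_subset_topspace by blast
    then have "?A \<in> path_components_of (subtopology mtopology (X - K))"
      by (simp add: path_components_of_def)
    moreover obtain M N where MN: "\<And>t. t \<ge> M \<Longrightarrow> \<rho> t \<in> T (f k)" "\<And>t. t \<ge> N \<Longrightarrow> \<tau> t \<in> T (f k)"
      using f(2,3)[of k] by (auto simp: ray_into_def)
    moreover obtain L :: nat where "max M N < real L" using reals_Archimedean2 by blast
    then have "\<rho> ` {real L..} \<subseteq> T (f k) \<and> \<tau> ` {real L..} \<subseteq> T (f k)" using MN by auto
    ultimately show ?thesis using sub by (metis topspace_mtopology subset_trans)
  qed
  then show ?thesis using rays by (simp add: ends_rel_def)
qed

text \<open>For \<open>K\<close> covering the ball of radius \<open>lev v\<close>, the common path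
  component is a connected set outside the ball that meets \<open>T v\<close>, so it is contained in
  \<open>T v\<close> and takes the second ray with it.\<close>

lemma ends_rel_ray_into:
  assumes ends: "(\<rho>, \<tau>) \<in> ends_rel mtopology" and v: "v \<in> V" "ray_into \<rho> v"
  shows "ray_into \<tau> v"
proof -
  obtain K where K: "compactin mtopology K" "{x \<in> X. d \<xi> x \<le> real (lev v)} \<subseteq> K"
    using compact_exhaustion by blast
  have "\<exists>N::nat. \<exists>A\<in>path_components_of (subtopology mtopology (X - K)).
      \<rho> ` {real N..} \<subseteq> A \<and> \<tau> ` {real N..} \<subseteq> A"
    using ends K(1) by (simp add: ends_rel_def)
  then obtain N :: nat and A where A: "A \<in> path_components_of (subtopology mtopology (X - K))"
    "\<rho> ` {real N..} \<subseteq> A" "\<tau> ` {real N..} \<subseteq> A"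
    by blast
  have pc: "path_connectedin mtopology A" "A \<subseteq> X - K"
    using path_connectedin_path_components_of[OF A(1)] by (auto simp: path_connectedin_subtopology)
  obtain M where M: "\<And>t. t \<ge> M \<Longrightarrow> \<rho> t \<in> T v" using v by (auto simp: ray_into_def)
  have "\<rho> (max M (real N)) \<in> A \<inter> T v" using A(2) M by auto
  then have "A \<subseteq> T v"
    using connected_subset_T[OF v(1) path_connectedin_imp_connectedin[OF pc(1)]] pc(2) K(2) by force
  then show ?thesis using A(3) unfolding ray_into_def by (metis atLeast_iff image_subset_iff subsetD)
qed

theorem Ends_eqpoll: "Ends mtopology \<approx> branches"
  unfolding Ends_def
proof (rule quotient_eqpoll_branches[where \<Phi> = ray_into])
  show "ends_rel mtopology \<subseteq> proper_rays mtopology \<times> proper_rays mtopology"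
    by (auto simp: ends_rel_def)
  show "ray_into \<rho> u" if "T v \<subseteq> T u" "ray_into \<rho> v" for \<rho> u v
    using that unfolding ray_into_def by blast
qed (rule ray_into_cover ray_into_unique ray_into_surj ray_into_ends_rel ends_rel_ray_into; assumption)+

end

section \<open>Points at infinity\<close>

definition "FOr \<phi> \<psi> = FNeg (FAnd (FNeg \<phi>) (FNeg \<psi>))"
definition "FImp \<phi> \<psi> = FNeg (FAnd \<phi> (FNeg \<psi>))"
definition "FIff \<phi> \<psi> = FAnd (FImp \<phi> \<psi>) (FImp \<psi> \<phi>)"
definition "FAll i \<phi> = FNeg (FEx i (FNeg \<phi>))"

lemma sat_connectives [simp]:
  "sat m e (FOr \<phi> \<psi>) \<longleftrightarrow> sat m e \<phi> \<or> sat m e \<psi>"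
  "sat m e (FImp \<phi> \<psi>) \<longleftrightarrow> (sat m e \<phi> \<longrightarrow> sat m e \<psi>)"
  "sat m e (FIff \<phi> \<psi>) \<longleftrightarrow> (sat m e \<phi> \<longleftrightarrow> sat m e \<psi>)"
  "sat m e (FAll i \<phi>) \<longleftrightarrow> (\<forall>x. sat m (e(i := x)) \<phi>)"
  by (auto simp: FOr_def FImp_def FIff_def FAll_def)

text \<open>Variables are named by numbers. Bound ones are chosen larger than all arguments, here
  and in the definitions below, so that nesting causes no capture.\<close>

definition FUpair :: "nat \<Rightarrow> nat \<Rightarrow> nat \<Rightarrow> fm" where
  "FUpair z a b = (let w = Suc (z + a + b) in
     FAll w (FIff (FMem w z) (FOr (FEq w a) (FEq w b))))"

definition FPair :: "nat \<Rightarrow> nat \<Rightarrow> nat \<Rightarrow> fm" where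
  "FPair z a b = (let p = Suc (z + a + b); q = Suc p in
     FEx p (FEx q (FAnd (FUpair p a a) (FAnd (FUpair q a b) (FUpair z p q)))))"

definition FRel :: "nat \<Rightarrow> nat \<Rightarrow> nat \<Rightarrow> fm" where
  "FRel a b f = (let z = Suc (f + a + b) in FEx z (FAnd (FMem z f) (FPair z a b)))"

definition FZero :: "nat \<Rightarrow> fm" where
  "FZero z = FAll (Suc z) (FNeg (FMem (Suc z) z))"

definition FSucc :: "nat \<Rightarrow> nat \<Rightarrow> fm" where
  "FSucc i j = (let w = Suc (i + j) in FAll w (FIff (FMem w j) (FOr (FEq w i) (FMem w i))))"

text \<open>The bound variables change roles: \<open>z\<close> is a pair with components
  \<open>i\<close> and \<open>a\<close> in the first conjunct; in the second, \<open>i\<close> and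
  \<open>a\<close> are two values at the argument \<open>z\<close>; in the third, \<open>i\<close>
  is a value at \<open>z\<close>.\<close>

definition FSeq :: "nat \<Rightarrow> nat \<Rightarrow> fm" where
  "FSeq k f = (let z = Suc (k + f); i = Suc z; a = Suc i in
     FAnd (FAll z (FImp (FMem z f) (FEx i (FEx a (FPair z i a)))))
    (FAnd (FAll z (FAll i (FAll a (FImp (FAnd (FRel z i f) (FRel z a f)) (FEq i a)))))
          (FAll z (FIff (FEx i (FRel z i f)) (FOr (FEq z k) (FMem z k))))))"

lemma sat_FUpair [simp]: "sat m e (FUpair z a b) \<longleftrightarrow> elts m (e z) = {e a, e b}"
  by (auto simp: FUpair_def Let_def elts_def)

lemma sat_FPair [simp]: "sat m e (FPair z a b) \<longleftrightarrow> is_pair m (e z) (e a) (e b)"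
  by (simp add: FPair_def Let_def is_pair_def)

lemma sat_FRel [simp]: "sat m e (FRel a b f) \<longleftrightarrow> (e a, e b) \<in> coded_rel m (e f)"
  by (simp add: FRel_def Let_def coded_rel_def)

lemma sat_FZero [simp]: "sat m e (FZero z) \<longleftrightarrow> is_zero m (e z)"
  by (simp add: FZero_def is_zero_def elts_def)

lemma sat_FSucc [simp]: "sat m e (FSucc i j) \<longleftrightarrow> is_succ m (e i) (e j)"
  by (auto simp: FSucc_def Let_def is_succ_def elts_def)

lemma sat_FSeq [simp]: "sat m e (FSeq k f) \<longleftrightarrow> internal_seq m (e k) (e f)"
proof -
  have "sat m e (FSeq k f) \<longleftrightarrow> (\<forall>z. m z (e f) \<longrightarrow> (\<exists>i a. is_pair m z i a)) \<and>
      (\<forall>i a b. (i, a) \<in> coded_rel m (e f) \<and> (i, b) \<in> coded_rel m (e f) \<longrightarrow> a = b) \<and>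
      (\<forall>i. (\<exists>a. (i, a) \<in> coded_rel m (e f)) \<longleftrightarrow> i = e k \<or> m i (e k))"
    by (simp add: FSeq_def Let_def)
  also have "\<dots> \<longleftrightarrow> internal_seq m (e k) (e f)"
    unfolding internal_seq_def by (intro conj_cong) (auto simp: elts_def single_valued_def)
  finally show ?thesis .
qed

section \<open>Transfer of inclusions, sections and exits\<close>

locale elementary_extension =
  fixes m :: "'u \<Rightarrow> 'u \<Rightarrow> bool" and n :: "'v \<Rightarrow> 'v \<Rightarrow> bool" and star :: "'u \<Rightarrow> 'v"
  assumes elem: "elementary_embedding m n star"
begin

lemma transfer: "sat n (star \<circ> e) \<phi> \<longleftrightarrow> sat m e \<phi>"
  using elem by (simp add: elementary_embedding_def)

lemma star_mem: "n (star a) (star b) \<longleftrightarrow> m a b"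
  using transfer[of "(\<lambda>_. b)(0 := a)" "FMem 0 1"] by simp

lemma star_subset_Un:
  assumes "elts m S \<subseteq> elts m A \<union> elts m B" "n x (star S)"
  shows "n x (star A) \<or> n x (star B)"
  using assms transfer[of "(\<lambda>_. S)(1 := A, 2 := B)"
      "FAll 3 (FImp (FMem 3 0) (FOr (FMem 3 1) (FMem 3 2)))"]
  by (auto simp: fun_upd_comp elts_def)

lemma star_subset: "elts m S \<subseteq> elts m A \<Longrightarrow> n x (star S) \<Longrightarrow> n x (star A)"
  using star_subset_Un[of S A A] by auto

lemma star_disjoint:
  assumes "elts m A \<inter> elts m B = {}" "n x (star A)" "n x (star B)"
  shows False
  using assms transfer[of "(\<lambda>_. A)(1 := B)" "FAll 2 (FNeg (FAnd (FMem 2 0) (FMem 2 1)))"]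
  by (auto simp: fun_upd_comp elts_def)

lemma star_rel_iff:
  assumes "\<And>x. m x A \<longleftrightarrow> (x, a) \<in> coded_rel m e"
  shows "n x (star A) \<longleftrightarrow> (x, star a) \<in> coded_rel n (star e)"
  using assms transfer[of "(\<lambda>_. A)(1 := a, 2 := e)" "FAll 3 (FIff (FMem 3 0) (FRel 3 1 2))"]
  by (auto simp: fun_upd_comp)

lemma star_rel_iff':
  assumes "\<And>x. m x A \<longleftrightarrow> (a, x) \<in> coded_rel m e"
  shows "n x (star A) \<longleftrightarrow> (star a, x) \<in> coded_rel n (star e)"
  using assms transfer[of "(\<lambda>_. A)(1 := a, 2 := e)" "FAll 3 (FIff (FMem 3 0) (FRel 1 3 2))"]
  by (auto simp: fun_upd_comp)

text \<open>To be used with \<open>S\<close> a subtree and \<open>B\<close> a ball: the extension of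
  a ball contains no point at infinity, so no controlled set carries such a point out of the
  extension of the subtree.\<close>

lemma star_rel_exit:
  assumes "\<And>a b. (a, b) \<in> coded_rel m e \<Longrightarrow> m a S \<Longrightarrow> \<not> m b S \<Longrightarrow> m a B"
    and "(a, b) \<in> coded_rel n (star e)" "n a (star S)" "\<not> n b (star S)"
  shows "n a (star B)"
  using assms transfer[of "(\<lambda>_. e)(1 := S, 2 := B)"
    "FAll 3 (FAll 4 (FImp (FAnd (FRel 3 4 0) (FAnd (FMem 3 1) (FNeg (FMem 4 1)))) (FMem 3 2)))"]
  by (auto simp: fun_upd_comp)

end

section \<open>Pairs, relations and numerals in the standard universe\<close>

locale universe =
  fixes m :: "'u \<Rightarrow> 'u \<Rightarrow> bool"
  assumes univ: "standard_universe m"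
begin

lemma ext: "elts m a = elts m b \<Longrightarrow> a = b"
  using univ by (auto simp: standard_universe_def)

lemma upair: "\<exists>c. elts m c = {a, b}"
  using univ by (auto simp: standard_universe_def)

lemma separation: "S \<subseteq> elts m a \<Longrightarrow> \<exists>b. elts m b = S"
  using univ by (auto simp: standard_universe_def)

lemma product_exists: "\<exists>c. elts m c = {z. \<exists>x\<in>elts m a. \<exists>y\<in>elts m b. is_pair m z x y}"
proof -
  have "\<forall>a b. \<exists>c. elts m c = {z. \<exists>x\<in>elts m a. \<exists>y\<in>elts m b. is_pair m z x y}"
    using univ unfolding standard_universe_def by (elim conjE)
  then show ?thesis by blast
qed

lemma irrefl_mem: "\<not> m a a"
  using univ unfolding standard_universe_def by (metis wfp_imp_irreflp irreflp_def irreflp_onD UNIV_I)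

lemma elts_omega: "elts m (omega m) = {i. von_neumann_nat m i}"
proof -
  obtain w where w: "elts m w = {i. von_neumann_nat m i}"
    using univ by (auto simp: standard_universe_def)
  then have "omega m = w" unfolding omega_def by (intro the_equality ext) auto
  with w show ?thesis by simp
qed

lemma is_pair_exists: "\<exists>z. is_pair m z a b"
  using upair unfolding is_pair_def by (metis insert_absorb2)

lemma is_pair_inject:
  assumes "is_pair m z a b" "is_pair m z a' b'"
  shows "a = a' \<and> b = b'"
proof -
  obtain p q where pq: "elts m p = {a}" "elts m q = {a, b}" "elts m z = {p, q}"
    using assms(1) by (auto simp: is_pair_def)
  obtain p' q' where pq': "elts m p' = {a'}" "elts m q' = {a', b'}" "elts m z = {p', q'}"
    using assms(2) by (auto simp: is_pair_def)
  have "{{a}, {a, b}} = elts m ` {p, q}" using pq by simp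
  also have "\<dots> = elts m ` {p', q'}" using pq(3) pq'(3) by simp
  also have "\<dots> = {{a'}, {a', b'}}" using pq' by simp
  finally show ?thesis by (auto simp: doubleton_eq_iff)
qed

text \<open>Since every subset of a product is an element, relations built outside the universe,
  such as chains of points or families of sets, become parameters and witnesses for
  formulae.\<close>

lemma code_rel:
  assumes "R \<subseteq> elts m A \<times> elts m B"
  shows "\<exists>g. coded_rel m g = R \<and> (\<forall>z\<in>elts m g. \<exists>a b. is_pair m z a b)"
proof -
  obtain P where P: "elts m P = {z. \<exists>x\<in>elts m A. \<exists>y\<in>elts m B. is_pair m z x y}"
    using product_exists by blast
  have "{z. \<exists>(a, b)\<in>R. is_pair m z a b} \<subseteq> elts m P" unfolding P using assms by blast
  then obtain g where g: "elts m g = {z. \<exists>(a, b)\<in>R. is_pair m z a b}" using separation by blast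
  have mg: "m z g \<longleftrightarrow> (\<exists>(a, b)\<in>R. is_pair m z a b)" for z using g by (auto simp: elts_def)
  have "coded_rel m g = R"
    using is_pair_exists is_pair_inject unfolding coded_rel_def mg by fast
  then show ?thesis using g by blast
qed

lemma zero_exists: "\<exists>z. is_zero m z"
  using separation[of "{}"] by (auto simp: is_zero_def)

lemma succ_exists: "\<exists>j. is_succ m i j"
proof -
  obtain a where a: "elts m a = {i, i}" using upair by blast
  obtain b where b: "elts m b = {a, i}" using upair by blast
  have "\<forall>a. \<exists>b. elts m b = (\<Union>x\<in>elts m a. elts m x)"
    using univ unfolding standard_universe_def by (elim conjE)
  then obtain u where "elts m u = (\<Union>x\<in>elts m b. elts m x)" by blast
  then show ?thesis using a b by (auto simp: is_succ_def)
qed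

primrec num :: "nat \<Rightarrow> 'u" where
  "num 0 = (SOME z. is_zero m z)"
| "num (Suc k) = (SOME j. is_succ m (num k) j)"

lemma num_0: "is_zero m (num 0)" and num_Suc: "is_succ m (num k) (num (Suc k))"
  using someI_ex[OF zero_exists] someI_ex[OF succ_exists] by auto

declare num.simps [simp del]

lemma elts_num: "elts m (num k) = num ` {..<k}"
  by (induction k) (use num_0 num_Suc in \<open>auto simp: is_zero_def is_succ_def lessThan_Suc\<close>)

lemma inj_num: "inj num"
proof (rule linorder_injI)
  fix i j :: nat assume "i < j"
  then have "m (num i) (num j)" using elts_num[of j] by (auto simp: elts_def)
  then show "num i \<noteq> num j" using irrefl_mem by metis
qed

lemma num_in_omega: "num k \<in> elts m (omega m)"
  unfolding elts_omega mem_Collect_eq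
  by (induction k) (use num_0 num_Suc in \<open>blast intro: von_neumann_nat.intros\<close>)+

text \<open>Induction on \<open>w\<close>: if the value at the predecessor is in \<open>S\<close>,
  the last step is the jump; otherwise \<open>S\<close> was left earlier. The domain is merely
  required to contain the indices up to \<open>w\<close>, so that the same \<open>g\<close> serves
  for the shorter sequence.\<close>

lemma jump_exists:
  assumes "von_neumann_nat m w" "single_valued (coded_rel m g)"
    and "insert w (elts m w) \<subseteq> Domain (coded_rel m g)"
    and "is_zero m z" "(z, x) \<in> coded_rel m g" "m x S" "(w, y) \<in> coded_rel m g" "\<not> m y S"
  shows "\<exists>i j a b. m i w \<and> is_succ m i j \<and> (i, a) \<in> coded_rel m g \<and> (j, b) \<in> coded_rel m g \<and> m a S \<and> \<not> m b S"
  using assms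
proof (induction arbitrary: y rule: von_neumann_nat.induct)
  case (1 w)
  then have "w = z" by (intro ext) (simp add: is_zero_def)
  then show ?case using 1 by (auto dest: single_valuedD)
next
  case (2 i j)
  have ij: "elts m j = insert i (elts m i)" using 2 by (simp add: is_succ_def)
  then have mij: "m i j" and mono: "\<And>k. m k i \<Longrightarrow> m k j" by (auto simp: elts_def)
  obtain a where a: "(i, a) \<in> coded_rel m g" using 2 ij by auto
  show ?case
  proof (cases "m a S")
    case True
    then show ?thesis using a mij 2 by blast
  next
    case False
    then show ?thesis using "2.IH"[OF _ _ _ _ _ a] 2 ij mono by blast
  qed
qed

end

section \<open>Nonstandard points over branches\<close>

locale nonstandard_branching_space = universe m + elementary_extension m n star +
    branching_space "elts m X" d V chld lev r pt T
  for m :: "'u \<Rightarrow> 'u \<Rightarrow> bool" and n :: "'v \<Rightarrow> 'v \<Rightarrow> bool" and star :: "'u \<Rightarrow> 'v"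
    and X :: 'u and c :: 'u and d and V :: "'a set" and chld and lev and r and pt :: "'a \<Rightarrow> 'u" and T +
  assumes saturation: "saturated m n"
    and coarse: "coded_rel m ` elts m c = bounded_coarse (elts m X) d"
begin

abbreviation "Infpts \<equiv> INF_pts m n star X c (pt r)"

definition code :: "'u set \<Rightarrow> 'u" where "code S = (SOME b. elts m b = S)"

lemma elts_code: "S \<subseteq> elts m X \<Longrightarrow> elts m (code S) = S"
  unfolding code_def using someI_ex[OF separation] .

lemma mem_code: "S \<subseteq> elts m X \<Longrightarrow> m x (code S) \<longleftrightarrow> x \<in> S"
  using elts_code by (auto simp: elts_def)

definition cball :: "real \<Rightarrow> 'u set" where "cball R = {x \<in> elts m X. d (pt r) x \<le> R}"

lemma cball_subset: "cball R \<subseteq> elts m X"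
  by (auto simp: cball_def)

lemma coarse_code:
  assumes "E \<in> bounded_coarse (elts m X) d"
  shows "\<exists>e\<in>elts m c. coded_rel m e = E"
  using assms unfolding coarse[symmetric] by blast

lemma coarse_bound:
  assumes "e \<in> elts m c"
  shows "coded_rel m e \<subseteq> elts m X \<times> elts m X \<and> (\<exists>R. \<forall>a b. (a, b) \<in> coded_rel m e \<longrightarrow> d a b \<le> R)"
proof -
  have "coded_rel m e \<in> bounded_coarse (elts m X) d" using assms coarse by blast
  then show ?thesis unfolding bounded_coarse_def by blast
qed

text \<open>The points that a controlled set relates to the root form a subset of a ball, and a ball
  times the root is controlled. Both facts transfer.\<close>

lemma Infpts_iff: "x \<in> Infpts \<longleftrightarrow> n x (star X) \<and> (\<forall>R. \<not> n x (star (code (cball R))))"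
proof -
  have "fin_close m n star c x (star (pt r)) \<longleftrightarrow> (\<exists>R. n x (star (code (cball R))))" if x: "n x (star X)"
  proof
    assume "fin_close m n star c x (star (pt r))"
    then obtain e where e: "e \<in> elts m c" "(x, star (pt r)) \<in> coded_rel n (star e)"
      by (auto simp: fin_close_def)
    then obtain R where sub: "coded_rel m e \<subseteq> elts m X \<times> elts m X"
      and R: "\<And>a b. (a, b) \<in> coded_rel m e \<Longrightarrow> d a b \<le> R"
      using coarse_bound by metis
    let ?S = "{a. (a, pt r) \<in> coded_rel m e}"
    have S: "?S \<subseteq> cball R" using R sub commute by (force simp: cball_def)
    then have S': "?S \<subseteq> elts m X" using cball_subset by blast
    have "n x (star (code ?S))"
      using star_rel_iff[of "code ?S" "pt r" e x] e mem_code[OF S'] by auto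
    then have "n x (star (code (cball R)))"
      using star_subset[of "code ?S" "code (cball R)"] S by (simp add: elts_code S' cball_subset)
    then show "\<exists>R. n x (star (code (cball R)))" by blast
  next
    assume "\<exists>R. n x (star (code (cball R)))"
    then obtain R where R: "n x (star (code (cball R)))" by blast
    have "cball R \<times> {pt r} \<in> bounded_coarse (elts m X) d"
      using commute xi_in_X by (force simp: bounded_coarse_def cball_def)
    then obtain e where e: "e \<in> elts m c" "coded_rel m e = cball R \<times> {pt r}"
      using coarse_code by blast
    then have "(x, star (pt r)) \<in> coded_rel n (star e)"
      using star_rel_iff[of "code (cball R)" "pt r" e x] R by (auto simp: mem_code cball_subset)
    then show "fin_close m n star c x (star (pt r))" using e by (auto simp: fin_close_def)
  qed
  then show ?thesis by (auto simp: INF_pts_def elts_def)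
qed

definition over :: "'v \<Rightarrow> 'a \<Rightarrow> bool" where "over x v \<longleftrightarrow> n x (star (code (T v)))"

text \<open>Extension commutes with finite unions, as seen by splitting off one \<open>T v\<close>
  at a time. For infinite covers this can fail, which is why levels have to be finite.\<close>

lemma star_finite_cover:
  assumes "finite F" "\<And>v. v \<in> F \<Longrightarrow> v \<in> V" "S \<subseteq> elts m X" "S \<subseteq> (\<Union>v\<in>F. T v)" "n x (star (code S))"
  shows "\<exists>v\<in>F. over x v"
  using assms
proof (induction arbitrary: S rule: finite_induct)
  case empty
  then show ?case using star_disjoint[of "code S" "code S" x] by (auto simp: elts_code)
next
  case (insert v F)
  have sub: "S - T v \<subseteq> elts m X" "T v \<subseteq> elts m X" using insert T_subset by auto
  then have "n x (star (code (T v))) \<or> n x (star (code (S - T v)))"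
    using star_subset_Un[of "code S" "code (T v)" "code (S - T v)"] insert.prems elts_code by auto
  then show ?case
    using insert.IH[of "S - T v"] insert.prems sub by (auto simp: over_def)
qed

lemma over_cover:
  assumes "x \<in> Infpts"
  shows "\<exists>v\<in>V. lev v = k \<and> over x v"
proof -
  let ?S = "elts m X - cball (real k)"
  have "n x (star X)" "\<not> n x (star (code (cball (real k))))" using assms Infpts_iff by auto
  moreover have "elts m X \<subseteq> elts m (code (cball (real k))) \<union> elts m (code ?S)"
    by (auto simp: elts_code cball_subset)
  ultimately have "n x (star (code ?S))"
    using star_subset_Un[of X "code (cball (real k))" "code ?S" x] by blast
  moreover have "?S \<subseteq> (\<Union>v\<in>{v \<in> V. lev v = k}. T v)"
  proof
    fix y assume "y \<in> ?S"
    then have "y \<in> elts m X" "real k \<le> d (pt r) y" by (auto simp: cball_def)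
    from T_cover[OF this] show "y \<in> (\<Union>v\<in>{v \<in> V. lev v = k}. T v)" by blast
  qed
  ultimately show ?thesis
    using star_finite_cover[OF finite_level, of k ?S x] by auto
qed

lemma over_unique: "u \<in> V \<Longrightarrow> v \<in> V \<Longrightarrow> lev u = lev v \<Longrightarrow> over x u \<Longrightarrow> over x v \<Longrightarrow> u = v"
  using star_disjoint[of "code (T u)" "code (T v)" x] T_disjoint[of u v]
  by (auto simp: over_def elts_code T_subset)

lemma over_mono: "u \<in> V \<Longrightarrow> v \<in> V \<Longrightarrow> T v \<subseteq> T u \<Longrightarrow> over x v \<Longrightarrow> over x u"
  using star_subset[of "code (T v)" "code (T u)" x] by (auto simp: over_def elts_code T_subset)

lemma over_branch_Infpts:
  assumes "f \<in> branches" "\<And>k. over x (f k)"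
  shows "x \<in> Infpts"
proof -
  have fV: "f k \<in> V" for k using assms by (auto simp: branches_def)
  have "n x (star X)"
    using star_subset[of "code (T (f 0))" X x] assms(2)[of 0] T_subset[OF fV]
    by (auto simp: over_def elts_code)
  moreover have "\<not> n x (star (code (cball R)))" for R
  proof
    obtain k :: nat where k: "R < real k" using reals_Archimedean2 by blast
    assume "n x (star (code (cball R)))"
    moreover have "T (f k) \<inter> cball R = {}"
      using T_height[OF fV, of _ k] lev_branch[OF assms(1)] k by (force simp: cball_def)
    ultimately show False
      using star_disjoint[of "code (T (f k))" "code (cball R)" x] assms(2)[of k] T_subset[OF fV]
      by (auto simp: over_def elts_code cball_subset)
  qed
  ultimately show ?thesis by (simp add: Infpts_iff)
qed

lemma over_surj:
  assumes f: "f \<in> branches"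
  shows "\<exists>x\<in>Infpts. \<forall>k. over x (f k)"
proof -
  have fV: "f k \<in> V" for k using f by (auto simp: branches_def)
  \<comment> \<open>Saturation concerns families indexed by an element of the universe, so level
    \<open>k\<close> is represented by the numeral \<open>num k\<close>.\<close>
  obtain I where I: "elts m I = range num" using separation[of "range num"] num_in_omega by blast
  let ?A = "\<lambda>i. star (code (T (f (inv num i))))"
  have "(\<Inter>i\<in>elts m I. elts n (?A i)) \<noteq> {}"
  proof (rule saturation[unfolded saturated_def, rule_format])
    fix F assume F: "finite F \<and> F \<subseteq> elts m I"
    then obtain N where N: "finite N" "F = num ` N" unfolding I by (meson finite_subset_image)
    then obtain K where K: "\<And>k. k \<in> N \<Longrightarrow> k \<le> K" by (meson finite_nat_set_iff_bounded_le)
    \<comment> \<open>The standard vertex at the largest level involved lies in all of the finitely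
      many subtrees, because these decrease along the branch.\<close>
    have "star (pt (f K)) \<in> elts n (?A i)" if i: "i \<in> F" for i
    proof -
      obtain k where k: "i = num k" "k \<le> K" using i N K by blast
      have "pt (f K) \<in> T (f k)" using pt_in_T[OF fV] T_branch_antimono[OF f k(2)] by blast
      then show ?thesis
        using k inj_num T_subset[OF fV] by (simp add: elts_def star_mem mem_code)
    qed
    then show "(\<Inter>i\<in>F. elts n (?A i)) \<noteq> {}" by blast
  qed
  then obtain x where x: "\<And>i. i \<in> range num \<Longrightarrow> n x (?A i)" unfolding I by (auto simp: elts_def)
  have "over x (f k)" for k using x[of "num k"] inj_num by (simp add: over_def)
  then show ?thesis using over_branch_Infpts[OF f] by blast
qed

lemma iota_rel_over:
  assumes xy: "(x, y) \<in> iota_rel m n star X c (pt r)" and v: "v \<in> V" "over x v"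
  shows "over y v"
proof (rule ccontr)
  assume ny: "\<not> over y v"
  obtain k f where k: "n k (star (omega m))" and f: "internal_seq n k f"
    and Infpts: "Range (coded_rel n f) \<subseteq> Infpts"
    and x: "\<exists>z. is_zero n z \<and> (z, x) \<in> coded_rel n f" and y: "(k, y) \<in> coded_rel n f"
    and step: "\<And>i j a b. n i k \<Longrightarrow> is_succ n i j \<Longrightarrow> (i, a) \<in> coded_rel n f \<Longrightarrow>
      (j, b) \<in> coded_rel n f \<Longrightarrow> fin_close m n star c a b"
    using xy unfolding iota_rel_def elts_def by blast
  let ?S = "code (T v)"
  \<comment> \<open>This is \<open>jump_exists\<close> as a formula: variables 0 and 1 are the
    parameters \<open>omega m\<close> and \<open>?S\<close>, 2 and 3 the last index and the
    sequence, 4 to 7 indices and values.\<close>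
  let ?\<phi> = "FAll 2 (FAll 3 (FImp (FAnd (FAnd (FMem 2 0) (FSeq 2 3))
      (FAnd (FEx 4 (FEx 5 (FAnd (FZero 4) (FAnd (FRel 4 5 3) (FMem 5 1)))))
            (FEx 4 (FAnd (FRel 2 4 3) (FNeg (FMem 4 1))))))
      (FEx 4 (FEx 5 (FEx 6 (FEx 7 (FAnd (FMem 4 2) (FAnd (FSucc 4 5) (FAnd (FRel 4 6 3)
        (FAnd (FRel 5 7 3) (FAnd (FMem 6 1) (FNeg (FMem 7 1)))))))))))))"
  have "sat m ((\<lambda>_. omega m)(1 := ?S)) ?\<phi>"
  proof (simp, intro allI impI, elim conjE exE)
    fix w g z x y
    assume w: "m w (omega m)" "internal_seq m w g" "is_zero m z" "(z, x) \<in> coded_rel m g"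
      "m x ?S" "(w, y) \<in> coded_rel m g" "\<not> m y ?S"
    have "von_neumann_nat m w" using w(1) elts_omega by (auto simp: elts_def)
    from jump_exists[OF this _ _ w(3-7)] w(2)
    show "\<exists>i. m i w \<and> (\<exists>j. is_succ m i j \<and> (\<exists>a. (i, a) \<in> coded_rel m g \<and>
      (\<exists>b. (j, b) \<in> coded_rel m g \<and> m a ?S \<and> \<not> m b ?S)))"
      by (auto simp: internal_seq_def)
  qed
  then have "sat n (star \<circ> ((\<lambda>_. omega m)(1 := ?S))) ?\<phi>" by (simp only: transfer)
  then have "\<exists>i j a b. n i k \<and> is_succ n i j \<and> (i, a) \<in> coded_rel n f \<and> (j, b) \<in> coded_rel n f \<and>
      n a (star ?S) \<and> \<not> n b (star ?S)"
    using k f x y v(2) ny unfolding over_def by (simp add: fun_upd_comp) blast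
  then obtain i j a b where ij: "n i k" "is_succ n i j" "(i, a) \<in> coded_rel n f" "(j, b) \<in> coded_rel n f"
      "n a (star ?S)" "\<not> n b (star ?S)" by blast
  \<comment> \<open>Only the single step out of the subtree matters, so the controlled sets that
    witness closeness may vary along the sequence.\<close>
  obtain e where e: "e \<in> elts m c" "(a, b) \<in> coded_rel n (star e)"
    using step[OF ij(1-4)] by (auto simp: fin_close_def)
  then obtain R where sub: "coded_rel m e \<subseteq> elts m X \<times> elts m X"
      and R: "\<And>a b. (a, b) \<in> coded_rel m e \<Longrightarrow> d a b \<le> R"
    using coarse_bound by metis
  have "n a (star (code (cball (real (lev v) + R))))"
  proof (rule star_rel_exit[OF _ e(2) ij(5,6)])
    fix a b assume ab: "(a, b) \<in> coded_rel m e" "m a ?S" "\<not> m b ?S"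
    then have "d (pt r) a \<le> real (lev v) + d a b"
      using T_separation[OF v(1), of a b] sub T_subset[OF v(1)] by (auto simp: mem_code)
    then show "m a (code (cball (real (lev v) + R)))"
      using R[OF ab(1)] ab sub by (auto simp: mem_code cball_subset cball_def)
  qed
  moreover have "a \<in> Infpts" using Infpts ij(3) by auto
  ultimately show False by (simp add: Infpts_iff)
qed

lemma over_iota_rel:
  assumes f: "f \<in> branches" and x: "\<And>k. over x (f k)" and y: "\<And>k. over y (f k)"
  shows "(x, y) \<in> iota_rel m n star X c (pt r)"
proof -
  have fV: "f k \<in> V" for k using f by (auto simp: branches_def)
  have "{(a, b). a \<in> elts m X \<and> b \<in> elts m X \<and> d a b \<le> 1} \<in> bounded_coarse (elts m X) d"
    by (auto simp: bounded_coarse_def)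
  then obtain e where e: "e \<in> elts m c"
    "coded_rel m e = {(a, b). a \<in> elts m X \<and> b \<in> elts m X \<and> d a b \<le> 1}"
    using coarse_code by blast
  \<comment> \<open>All sets \<open>T v\<close> are coded by one relation \<open>D\<close> that has
    \<open>T v\<close> as its section over \<open>pt v\<close>. Staying in every \<open>T v\<close>
    then needs a single parameter and makes sense for nonstandard vertices as well.\<close>
  have "{(pt v, a) | v a. v \<in> V \<and> a \<in> T v} \<subseteq> elts m X \<times> elts m X"
  proof clarify
    fix v a assume "v \<in> V" "a \<in> T v"
    then show "pt v \<in> elts m X \<and> a \<in> elts m X" using T_subset[of v] pt_in_T[of v] by auto
  qed
  from code_rel[OF this] obtain D where D: "coded_rel m D = {(pt v, a) | v a. v \<in> V \<and> a \<in> T v}"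
    by metis
  have D_iff: "(pt v, a) \<in> coded_rel m D \<longleftrightarrow> a \<in> T v" if v: "v \<in> V" for v a
  proof
    assume "(pt v, a) \<in> coded_rel m D"
    then obtain u where u: "u \<in> V" "pt u = pt v" "a \<in> T u" using D by auto
    then have "u = v" using pt_inject v by metis
    then show "a \<in> T v" using u by simp
  qed (use v D in auto)
  \<comment> \<open>This is \<open>chain_exists\<close> as a formula: variables 0 to 3 are the
    parameters in \<open>?e\<close>, 4 and 5 the end points, 6 and 7 the last index and the
    sequence. The final clause keeps the values in each section of \<open>D\<close> that contains
    both end points.\<close>
  let ?\<phi> = "FAll 4 (FImp (FMem 4 1) (FAll 5 (FImp (FMem 5 1) (FEx 6 (FEx 7
      (FAnd (FMem 6 0) (FAnd (FSeq 6 7) (FAnd (FEx 8 (FAnd (FZero 8) (FRel 8 4 7))) (FAnd (FRel 6 5 7)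
        (FAnd (FAll 8 (FAll 9 (FAll 10 (FAll 11 (FImp
            (FAnd (FMem 8 6) (FAnd (FSucc 8 9) (FAnd (FRel 8 10 7) (FRel 9 11 7))))
            (FRel 10 11 3))))))
          (FAll 8 (FAll 9 (FImp (FRel 8 9 7)
            (FAll 10 (FImp (FAnd (FRel 10 4 2) (FRel 10 5 2)) (FRel 10 9 2))))))))))))))))"
  let ?e = "(\<lambda>_. omega m)(1 := X, 2 := D, 3 := e)"
  have "sat m ?e ?\<phi>"
  proof (simp, intro allI impI)
    fix x y assume "m x X" "m y X"
    then have xy: "x \<in> elts m X" "y \<in> elts m X" by (auto simp: elts_def)
    obtain L s where s: "s 0 = x" "s L = y" "\<And>i. i < L \<Longrightarrow> d (s i) (s (Suc i)) \<le> 1"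
      "\<And>i. i \<le> L \<Longrightarrow> s i \<in> elts m X"
      "\<And>i v. i \<le> L \<Longrightarrow> v \<in> V \<Longrightarrow> x \<in> T v \<Longrightarrow> y \<in> T v \<Longrightarrow> s i \<in> T v"
      using chain_exists[OF xy] by metis
    have "{(num i, s i) | i. i \<le> L} \<subseteq> elts m (omega m) \<times> elts m X" using num_in_omega s(4) by auto
    from code_rel[OF this] obtain g where g: "coded_rel m g = {(num i, s i) | i. i \<le> L}"
      "\<forall>z\<in>elts m g. \<exists>a b. is_pair m z a b" by metis
    have g_iff: "(a, b) \<in> coded_rel m g \<longleftrightarrow> (\<exists>i\<le>L. a = num i \<and> b = s i)" for a b
      using g by auto
    have num_iff: "num i = num j \<longleftrightarrow> i = j" for i j using inj_num by (auto dest: injD)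
    have "internal_seq m (num L) g"
      unfolding internal_seq_def
    proof (intro conjI)
      show "single_valued (coded_rel m g)" by (auto simp: single_valued_def g_iff num_iff)
      have "insert (num L) (elts m (num L)) = num ` {..L}"
        by (simp add: elts_num lessThan_Suc flip: lessThan_Suc_atMost)
      then show "Domain (coded_rel m g) = insert (num L) (elts m (num L))" using g(1) by auto
    qed (use g in blast)
    moreover have "m (num L) (omega m)" using num_in_omega by (auto simp: elts_def)
    moreover have "\<exists>z. is_zero m z \<and> (z, x) \<in> coded_rel m g" using num_0 s(1) g_iff by blast
    moreover have "(num L, y) \<in> coded_rel m g" using s(2) g_iff by blast
    moreover have "(a, b) \<in> coded_rel m e" if iL: "m i (num L)" and ij: "is_succ m i j" and ab: "(i, a) \<in> coded_rel m g"
      "(j, b) \<in> coded_rel m g" for i j a b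
    proof -
      obtain k where k: "i = num k" "k < L" using iL elts_num[of L] by (auto simp: elts_def)
      have "j = num (Suc k)" using ij num_Suc[of k] k by (intro ext) (simp add: is_succ_def)
      then have "a = s k" "b = s (Suc k)" using ab k by (auto simp: g_iff num_iff)
      then show ?thesis using s(3,4) k by (simp add: e(2))
    qed
    moreover have "(p, b) \<in> coded_rel m D" if ab: "(a, b) \<in> coded_rel m g" and px: "(p, x) \<in> coded_rel m D"
      and py: "(p, y) \<in> coded_rel m D" for a b p
    proof -
      obtain v where v: "v \<in> V" "p = pt v" using px D by auto
      then show ?thesis using ab px py s(5)[OF _ v(1)] D_iff by (auto simp: g_iff)
    qed
    ultimately show "\<exists>w. m w (omega m) \<and> (\<exists>g. internal_seq m w g \<and>
      (\<exists>z. is_zero m z \<and> (z, x) \<in> coded_rel m g) \<and> (w, y) \<in> coded_rel m g \<and>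
      (\<forall>i j a b. m i w \<and> is_succ m i j \<and> (i, a) \<in> coded_rel m g \<and> (j, b) \<in> coded_rel m g \<longrightarrow>
        (a, b) \<in> coded_rel m e) \<and>
      (\<forall>a b. (a, b) \<in> coded_rel m g \<longrightarrow> (\<forall>p. (p, x) \<in> coded_rel m D \<and> (p, y) \<in> coded_rel m D \<longrightarrow>
        (p, b) \<in> coded_rel m D)))"
      by blast
  qed
  then have "sat n (star \<circ> ?e) ?\<phi>" by (simp only: transfer)
  then have *: "\<exists>w. n w (star (omega m)) \<and> (\<exists>g. internal_seq n w g \<and>
      (\<exists>z. is_zero n z \<and> (z, x) \<in> coded_rel n g) \<and> (w, y) \<in> coded_rel n g \<and>
      (\<forall>i j a b. n i w \<and> is_succ n i j \<and> (i, a) \<in> coded_rel n g \<and> (j, b) \<in> coded_rel n g \<longrightarrow>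
        (a, b) \<in> coded_rel n (star e)) \<and>
      (\<forall>a b. (a, b) \<in> coded_rel n g \<longrightarrow> (\<forall>p. (p, x) \<in> coded_rel n (star D) \<and>
        (p, y) \<in> coded_rel n (star D) \<longrightarrow> (p, b) \<in> coded_rel n (star D))))"
    if "n x (star X)" "n y (star X)" for x y
    using that by (simp add: fun_upd_comp)
  have xy: "x \<in> Infpts" "y \<in> Infpts" using over_branch_Infpts[OF f] x y by auto
  then have nX: "n x (star X)" "n y (star X)" by (auto simp: Infpts_iff)
  from *[OF nX] obtain w g where w: "n w (star (omega m))" "internal_seq n w g"
      "\<exists>z. is_zero n z \<and> (z, x) \<in> coded_rel n g" "(w, y) \<in> coded_rel n g"
    and step: "\<forall>i j a b. n i w \<and> is_succ n i j \<and> (i, a) \<in> coded_rel n g \<and> (j, b) \<in> coded_rel n g \<longrightarrow>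
        (a, b) \<in> coded_rel n (star e)"
    and stay: "\<forall>a b. (a, b) \<in> coded_rel n g \<longrightarrow> (\<forall>p. (p, x) \<in> coded_rel n (star D) \<and>
        (p, y) \<in> coded_rel n (star D) \<longrightarrow> (p, b) \<in> coded_rel n (star D))"
    by (elim exE conjE, rule) (assumption | blast)+
  have over_iff: "over z (f k) \<longleftrightarrow> (star (pt (f k)), z) \<in> coded_rel n (star D)" for z k
    unfolding over_def
    by (rule star_rel_iff') (simp add: D_iff fV mem_code T_subset)
  \<comment> \<open>The sections over the standard points \<open>star (pt (f k))\<close> contain
    both ends, hence also \<open>b\<close>; and a point lying over every \<open>f k\<close> is
    automatically at infinity.\<close>
  have "b \<in> Infpts" if "(a, b) \<in> coded_rel n g" for a b
    using over_branch_Infpts[OF f, of b] stay that x y unfolding over_iff by blast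
  then have "Range (coded_rel n g) \<subseteq> Infpts" by blast
  moreover have "fin_close m n star c a b" if "n i w" "is_succ n i j" "(i, a) \<in> coded_rel n g"
      "(j, b) \<in> coded_rel n g" for i j a b
    using step that e(1) unfolding fin_close_def by blast
  ultimately show ?thesis using xy w unfolding iota_rel_def elts_def by blast
qed

theorem coarse_iota_eqpoll: "coarse_iota m n star X c (pt r) \<approx> branches"
  unfolding coarse_iota_def
proof (rule quotient_eqpoll_branches[where \<Phi> = over])
  show "iota_rel m n star X c (pt r) \<subseteq> Infpts \<times> Infpts"
    unfolding iota_rel_def by blast
qed (rule over_cover over_unique over_mono over_surj over_iota_rel iota_rel_over; assumption)+

end

section \<open>Trees and their realisations\<close>

lemma is_cycleI:
  assumes "3 \<le> length vs" "distinct vs" "successively (\<lambda>x y. (x, y) \<in> G) vs" "(last vs, hd vs) \<in> G"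
  shows "is_cycle G vs"
  using assms by (auto simp: is_cycle_def successively_conv_nth)

lemma edge_pt_flip: "edge_pt a b t = edge_pt b a (1 - t)"
  by (auto simp: edge_pt_def)

text \<open>The extension of a vertex function that is affine along edges. Points of the realisation
  have at most two nonzero coordinates, so the sum is finite there.\<close>

definition hat :: "('a \<Rightarrow> real) \<Rightarrow> ('a \<Rightarrow> real) \<Rightarrow> real" where
  "hat g p = (\<Sum>w | p w \<noteq> 0. p w * g w)"

lemma hat_vertex: "hat g (vertex_pt a) = g a"
proof -
  have "{w. vertex_pt a w \<noteq> 0} = {a}" by (auto simp: vertex_pt_def)
  then show ?thesis by (simp add: hat_def vertex_pt_def)
qed

lemma hat_edge:
  assumes "a \<noteq> b"
  shows "hat g (edge_pt a b t) = (1 - t) * g a + t * g b"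
proof -
  have "hat g (edge_pt a b t) = (\<Sum>w\<in>{a, b}. edge_pt a b t w * g w)"
    unfolding hat_def by (rule sum.mono_neutral_left) (auto simp: edge_pt_def vertex_pt_def)
  then show ?thesis using assms by (simp add: edge_pt_def vertex_pt_def)
qed

section \<open>Levels, parents and descendants\<close>

locale rooted_tree_graph =
  fixes V :: "'a set" and G :: "('a \<times> 'a) set" and r :: 'a
  assumes tree: "rooted_tree V G r"
begin

abbreviation "lev \<equiv> graph_dist G r"
abbreviation "chd \<equiv> child G r"

lemma G_conn: "connected_graph V G"
  using tree by (simp add: rooted_tree_def)

lemma r_in_V: "r \<in> V"
  using tree by (simp add: rooted_tree_def)

lemma G_sub: "(u, v) \<in> G \<Longrightarrow> u \<in> V \<and> v \<in> V"
  using G_conn by (auto simp: connected_graph_def simple_graph_def)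

lemma G_sym: "(u, v) \<in> G \<Longrightarrow> (v, u) \<in> G"
  using G_conn by (auto simp: connected_graph_def simple_graph_def dest: symD)

lemma G_irrefl: "(u, v) \<in> G \<Longrightarrow> u \<noteq> v"
  using G_conn by (auto simp: connected_graph_def simple_graph_def irrefl_def)

lemma no_cycle: "\<not> is_cycle G vs"
  using tree by (auto simp: rooted_tree_def)

lemma lev_relpow: "v \<in> V \<Longrightarrow> (r, v) \<in> G ^^ lev v"
  using G_conn r_in_V by (intro graph_dist_relpow) (auto simp: connected_graph_def)

lemma lev_root: "lev r = 0"
  using graph_dist_le[of r r 0 G] by simp

lemma lev_0_iff: "v \<in> V \<Longrightarrow> lev v = 0 \<longleftrightarrow> v = r"
  using lev_relpow[of v] lev_root by auto

lemma lev_edge: "(a, b) \<in> G \<Longrightarrow> lev b \<le> Suc (lev a)"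
  using lev_relpow[of a] G_sub by (intro graph_dist_le) auto

lemma parent_exists:
  assumes "v \<in> V" "lev v = Suc k"
  shows "\<exists>u\<in>V. chd u v \<and> lev u = k"
proof -
  have "(r, v) \<in> G ^^ Suc k" using lev_relpow assms by metis
  then obtain u where u: "(r, u) \<in> G ^^ k" "(u, v) \<in> G" by auto
  then have "lev u \<le> k" "lev v \<le> Suc (lev u)" using graph_dist_le lev_edge by auto
  then show ?thesis using u G_sub assms by (auto simp: child_def)
qed

text \<open>The two lines of parents are followed until they meet; the level bound keeps each new
  pair of ends off the path between their parents. An edge between the ends, or a common child of
  them, would close this path to a cycle.\<close>

lemma same_level_path:
  assumes "a \<in> V" "b \<in> V" "lev a = n" "lev b = n" "a \<noteq> b"
  shows "\<exists>vs. 3 \<le> length vs \<and> distinct vs \<and> hd vs = a \<and> last vs = b \<and>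
    successively (\<lambda>x y. (x, y) \<in> G) vs \<and> (\<forall>w\<in>set vs. lev w \<le> n)"
  using assms
proof (induction n arbitrary: a b)
  case 0
  then show ?case using lev_0_iff by metis
next
  case (Suc n)
  obtain p where p: "p \<in> V" "(p, a) \<in> G" "lev p = n" using parent_exists Suc.prems by (metis child_def)
  obtain q where q: "q \<in> V" "(q, b) \<in> G" "lev q = n" using parent_exists Suc.prems by (metis child_def)
  show ?case
  proof (cases "p = q")
    case True
    then show ?thesis
      using p q Suc.prems G_sym by (intro exI[of _ "[a, p, b]"]) auto
  next
    case False
    then obtain vs where vs: "3 \<le> length vs" "distinct vs" "hd vs = p" "last vs = q"
        "successively (\<lambda>x y. (x, y) \<in> G) vs" "\<forall>w\<in>set vs. lev w \<le> n"
      using Suc.IH p q by metis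
    then have "vs \<noteq> []" by auto
    have "a \<notin> set vs" "b \<notin> set vs" using vs(6) Suc.prems by auto
    moreover have "\<forall>w\<in>set vs. lev w \<le> Suc n" using vs(6) by auto
    ultimately show ?thesis
      using vs \<open>vs \<noteq> []\<close> p q Suc.prems G_sym
      by (intro exI[of _ "a # vs @ [b]"]) (auto simp: successively_append_iff successively_Cons)
  qed
qed

lemma edge_lev_neq:
  assumes "(a, b) \<in> G"
  shows "lev a \<noteq> lev b"
proof
  assume "lev a = lev b"
  then obtain vs where "3 \<le> length vs" "distinct vs" "hd vs = a" "last vs = b"
    "successively (\<lambda>x y. (x, y) \<in> G) vs"
    using same_level_path[of a b "lev b"] G_sub[OF assms] G_irrefl[OF assms] by auto
  then show False using is_cycleI[of vs] no_cycle G_sym[OF assms] by auto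
qed

lemma edge_cases: "(a, b) \<in> G \<Longrightarrow> chd a b \<or> chd b a"
  using lev_edge[of a b] lev_edge[of b a] edge_lev_neq[of a b] G_sym[of a b] by (auto simp: child_def)

lemma child_in_V: "chd u v \<Longrightarrow> u \<in> V \<and> v \<in> V"
  using G_sub by (auto simp: child_def)

lemma child_neq: "chd u v \<Longrightarrow> u \<noteq> v"
  by (auto simp: child_def)

lemma parent_unique:
  assumes "chd u v" "chd w v"
  shows "u = w"
proof (rule ccontr)
  assume "u \<noteq> w"
  then obtain vs where vs: "3 \<le> length vs" "distinct vs" "hd vs = u" "last vs = w"
    "successively (\<lambda>x y. (x, y) \<in> G) vs" "\<forall>x\<in>set vs. lev x \<le> lev w"
    using same_level_path[of u w "lev w"] assms child_in_V by (auto simp: child_def)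
  then have "vs \<noteq> []" by auto
  have "v \<notin> set vs" using vs(6) assms by (auto simp: child_def)
  moreover have "(w, v) \<in> G" "(v, u) \<in> G" using assms G_sym by (auto simp: child_def)
  ultimately have "is_cycle G (vs @ [v])"
    using vs \<open>vs \<noteq> []\<close> by (intro is_cycleI) (auto simp: successively_append_iff)
  then show False using no_cycle by blast
qed

definition desc :: "'a \<Rightarrow> 'a \<Rightarrow> bool" where
  "desc v w \<longleftrightarrow> (v, w) \<in> {(a, b). chd a b}\<^sup>*"

lemma desc_refl [simp]: "desc v v"
  by (simp add: desc_def)

text \<open>Since \<open>a\<close> is the only parent of \<open>b\<close>, a nontrivial descent to
  \<open>b\<close> passes through \<open>a\<close>.\<close>

lemma desc_child_iff: "chd a b \<Longrightarrow> desc v b \<longleftrightarrow> v = b \<or> desc v a"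
proof
  assume "chd a b" "desc v b"
  then show "v = b \<or> desc v a"
    unfolding desc_def using parent_unique by (metis (lifting) case_prodD mem_Collect_eq rtranclE)
next
  assume "chd a b" "v = b \<or> desc v a"
  then show "desc v b"
    unfolding desc_def by (auto intro: rtrancl_into_rtrancl)
qed

lemma child_desc_trans: "chd u v \<Longrightarrow> desc v w \<Longrightarrow> desc u w"
  unfolding desc_def by (auto intro: converse_rtrancl_into_rtrancl)

lemma desc_lev: "desc v w \<Longrightarrow> v = w \<or> lev v < lev w"
  unfolding desc_def by (induction rule: rtrancl_induct) (auto simp: child_def)

lemma ancestor_exists:
  assumes "w \<in> V" "k \<le> lev w"
  shows "\<exists>v\<in>V. lev v = k \<and> desc v w"
  using assms
proof (induction "lev w" arbitrary: w)
  case 0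
  then show ?case by (intro bexI[of _ w]) auto
next
  case (Suc l)
  show ?case
  proof (cases "k = lev w")
    case True
    then show ?thesis using Suc.prems by (intro bexI[of _ w]) auto
  next
    case False
    obtain u where u: "u \<in> V" "chd u w" "lev u = l" using parent_exists Suc by metis
    then obtain v where "v \<in> V" "lev v = k" "desc v u" using Suc False by force
    then show ?thesis using desc_child_iff[OF u(2)] by blast
  qed
qed

lemma ancestor_unique:
  assumes "desc u w" "desc v w" "lev u = lev v"
  shows "u = v"
  using assms(1,2) unfolding desc_def[of u]
proof (induction rule: rtrancl_induct)
  case base
  then show ?case using desc_lev assms(3) by fastforce
next
  case (step y z)
  then have "desc u y" by (simp add: desc_def)
  then have "lev u \<le> lev y" using desc_lev by fastforce
  then have "v \<noteq> z" using step(2) assms(3) by (auto simp: child_def)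
  then show ?case using step desc_child_iff[of y z v] by auto
qed

section \<open>The subtrees in the metric realisation\<close>

abbreviation "R \<equiv> realisation V G"
abbreviation "d \<equiv> path_metric V G"

sublocale Metric_space R d
  by (rule Metric_space_path_metric[OF G_conn])

lemma vertex_in_R: "v \<in> V \<Longrightarrow> vertex_pt v \<in> R"
  by (simp add: realisation_def)

lemma edge_in_R: "chd u w \<Longrightarrow> 0 \<le> t \<Longrightarrow> t \<le> 1 \<Longrightarrow> edge_pt u w t \<in> R"
  unfolding realisation_def child_def by blast

text \<open>Edges are oriented away from the root and their end points are left to the vertex case.
  For the remaining points, membership in \<open>T v\<close> and height can be read off from the
  parent \<open>u\<close> and \<open>t\<close>.\<close>

lemma R_cases [consumes 1]:
  assumes "p \<in> R"
  obtains (vertex) v where "v \<in> V" "p = vertex_pt v"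
  | (edge) u w t where "chd u w" "0 < t" "t < 1" "p = edge_pt u w t"
proof -
  have closed_edge: thesis if uwt: "chd u w" "0 \<le> t" "t \<le> 1" "p = edge_pt u w t" for u w t
  proof (cases "t = 0 \<or> t = 1")
    case True
    then have "p = vertex_pt u \<or> p = vertex_pt w" using uwt(4) edge_pt_0 edge_pt_1 by metis
    then show ?thesis using vertex child_in_V[OF uwt(1)] by blast
  next
    case False
    show ?thesis by (rule edge[OF uwt(1) _ _ uwt(4)]) (use uwt False in auto)
  qed
  from assms consider v where "v \<in> V" "p = vertex_pt v"
    | a b t where "(a, b) \<in> G" "0 \<le> t" "t \<le> 1" "p = edge_pt a b t"
    unfolding realisation_def by blast
  then show thesis
  proof cases
    case 2
    from edge_cases[OF 2(1)] show ?thesis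
    proof
      assume "chd a b"
      then show ?thesis by (rule closed_edge) (use 2 in auto)
    next
      assume "chd b a"
      then show ?thesis by (rule closed_edge[of _ _ "1 - t"]) (use 2 edge_pt_flip in auto)
    qed
  qed (use vertex in blast)
qed

text \<open>The nonzero coordinates of a point name the vertices that carry it. Hence
  \<open>T v\<close> contains the point of \<open>v\<close> itself, but no interior point of the
  edge leading to \<open>v\<close>, which the parent of \<open>v\<close> also carries.\<close>

definition T :: "'a \<Rightarrow> ('a \<Rightarrow> real) set" where
  "T v = {p \<in> R. \<forall>w. p w \<noteq> 0 \<longrightarrow> desc v w}"

lemma vertex_in_T_iff: "w \<in> V \<Longrightarrow> vertex_pt w \<in> T v \<longleftrightarrow> desc v w"
proof -
  have "vertex_pt w x \<noteq> 0 \<longleftrightarrow> x = w" for x by (simp add: vertex_pt_def)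
  then show "w \<in> V \<Longrightarrow> vertex_pt w \<in> T v \<longleftrightarrow> desc v w" by (auto simp: T_def vertex_in_R)
qed

lemma edge_in_T_iff:
  assumes "chd u w" "0 \<le> t" "t < 1"
  shows "edge_pt u w t \<in> T v \<longleftrightarrow> desc v u"
proof
  assume "edge_pt u w t \<in> T v"
  moreover have "edge_pt u w t u \<noteq> 0"
    using assms child_neq[OF assms(1)] by (auto simp: edge_pt_def vertex_pt_def)
  ultimately show "desc v u" by (auto simp: T_def)
next
  assume "desc v u"
  then show "edge_pt u w t \<in> T v"
    using assms edge_in_R[of u w t] desc_child_iff[OF assms(1), of v]
    by (auto simp: T_def edge_pt_def vertex_pt_def split: if_splits)
qed

lemma hat_lipschitz:
  assumes g: "\<And>a b. chd a b \<Longrightarrow> \<bar>g a - g b\<bar> \<le> 1" and pq: "p \<in> R" "q \<in> R"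
  shows "\<bar>hat g p - hat g q\<bar> \<le> d p q"
proof -
  obtain l0 where "pl_path V G p q l0" using realisation_connected[OF G_conn pq] by blast
  then show ?thesis
  proof (rule le_path_metric)
    fix l assume "pl_path V G p q l"
    then show "\<bar>hat g p - hat g q\<bar> \<le> l"
    proof (rule pl_path_lipschitz[rotated])
      fix a b s t assume ab: "(a, b) \<in> G"
      then have "\<bar>g a - g b\<bar> \<le> 1" using edge_cases[OF ab] g by (metis abs_minus_commute)
      moreover have "hat g (edge_pt a b s) - hat g (edge_pt a b t) = (s - t) * (g b - g a)"
        using G_irrefl[OF ab] by (simp add: hat_edge algebra_simps)
      ultimately show "\<bar>hat g (edge_pt a b s) - hat g (edge_pt a b t)\<bar> \<le> \<bar>s - t\<bar>"
        by (simp add: abs_mult abs_minus_commute mult_left_le)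
    qed
  qed
qed

lemma dist_edge:
  assumes "chd u w" "0 \<le> s" "s \<le> 1" "0 \<le> t" "t \<le> 1"
  shows "d (edge_pt u w s) (edge_pt u w t) = \<bar>s - t\<bar>"
  using assms G_conn by (intro path_metric_edge) (auto simp: connected_graph_def child_def)

lemma height_vertex: "v \<in> V \<Longrightarrow> d (vertex_pt r) (vertex_pt v) = real (lev v)"
  by (rule path_metric_vertices[OF G_conn r_in_V])

lemma height_edge:
  assumes "chd u w" "0 \<le> t" "t \<le> 1"
  shows "d (vertex_pt r) (edge_pt u w t) = real (lev u) + t"
proof (rule antisym)
  have lw: "lev w = Suc (lev u)" using assms(1) by (simp add: child_def)
  note in_R = vertex_in_R[OF r_in_V] edge_in_R[OF assms]
  have "d (vertex_pt r) (edge_pt u w t) \<le> d (vertex_pt r) (vertex_pt u) + d (vertex_pt u) (edge_pt u w t)"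
    using triangle in_R vertex_in_R child_in_V[OF assms(1)] by blast
  moreover have "d (vertex_pt u) (edge_pt u w t) = t"
    using dist_edge[OF assms(1), of 0 t] assms by (simp add: edge_pt_0)
  ultimately show "d (vertex_pt r) (edge_pt u w t) \<le> real (lev u) + t"
    using height_vertex child_in_V[OF assms(1)] by simp
  \<comment> \<open>The affine extension of \<open>lev\<close> is 1-Lipschitz and takes the claimed
    height as its value, which bounds the distance from below.\<close>
  have "\<bar>hat (\<lambda>w. real (lev w)) (vertex_pt r) - hat (\<lambda>w. real (lev w)) (edge_pt u w t)\<bar>
      \<le> d (vertex_pt r) (edge_pt u w t)"
    by (rule hat_lipschitz[OF _ in_R]) (auto simp: child_def)
  moreover have "hat (\<lambda>w. real (lev w)) (edge_pt u w t) = real (lev u) + t"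
    using child_neq[OF assms(1)] lw by (simp add: hat_edge algebra_simps)
  ultimately show "real (lev u) + t \<le> d (vertex_pt r) (edge_pt u w t)"
    by (simp add: hat_vertex lev_root)
qed

lemma T_separation:
  assumes v: "v \<in> V" and a: "a \<in> T v" and b: "b \<in> R - T v"
  shows "d (vertex_pt r) a \<le> real (lev v) + d a b"
proof -
  \<comment> \<open>The extension of \<open>g\<close> is the height above \<open>v\<close> on
    \<open>T v\<close> and 0 elsewhere. It does not jump on the edge leading to \<open>v\<close>,
    because \<open>g v = 0\<close>.\<close>
  define g where "g w = (if desc v w then real (lev w) - real (lev v) else 0)" for w
  have g: "\<bar>g x - g y\<bar> \<le> 1" if "chd x y" for x y
    using that desc_child_iff[OF that, of v] desc_lev[of v x] by (auto simp: g_def child_def)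
  have aR: "a \<in> R" using a by (simp add: T_def)
  from aR have ha: "hat g a = d (vertex_pt r) a - real (lev v)"
  proof (cases rule: R_cases)
    case (vertex w)
    then show ?thesis using a by (simp add: hat_vertex vertex_in_T_iff height_vertex g_def)
  next
    case (edge u w t)
    then have "desc v u" "desc v w" using a edge_in_T_iff[of u w t v] desc_child_iff[of u w v] by auto
    then show ?thesis using edge child_neq[OF edge(1)]
      by (simp add: hat_edge height_edge g_def child_def algebra_simps)
  qed
  have bR: "b \<in> R" using b by simp
  then have hb: "hat g b = 0"
  proof (cases rule: R_cases)
    case (vertex w)
    then show ?thesis using b by (simp add: hat_vertex vertex_in_T_iff g_def)
  next
    case (edge u w t)
    then have "\<not> desc v u" "desc v w \<longleftrightarrow> v = w"
      using b edge_in_T_iff[of u w t v] desc_child_iff[of u w v] by auto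
    then show ?thesis using edge child_neq[OF edge(1)] by (auto simp: hat_edge g_def)
  qed
  have "\<bar>hat g a - hat g b\<bar> \<le> d a b" by (rule hat_lipschitz[OF g aR bR])
  then show ?thesis using ha hb by linarith
qed

section \<open>Linking points inside their common subtrees\<close>

definition Seg :: "(('a \<Rightarrow> real) \<times> ('a \<Rightarrow> real)) set" where
  "Seg = {(edge_pt u w s, edge_pt u w t) | u w s t.
     chd u w \<and> 0 \<le> s \<and> s \<le> 1 \<and> 0 \<le> t \<and> t \<le> 1}"

lemma Seg_sym: "(x, y) \<in> Seg \<Longrightarrow> (y, x) \<in> Seg"
  unfolding Seg_def by blast

lemma Seg_child: "chd u w \<Longrightarrow> (vertex_pt u, vertex_pt w) \<in> Seg"
  unfolding Seg_def by (force simp flip: edge_pt_0[of u w] edge_pt_1[of u w])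

definition span_T :: "('a \<Rightarrow> real) \<Rightarrow> ('a \<Rightarrow> real) \<Rightarrow> ('a \<Rightarrow> real) set" where
  "span_T x y = {z \<in> R. \<forall>v. x \<in> T v \<and> y \<in> T v \<longrightarrow> z \<in> T v}"

text \<open>One notion for two uses: a segment within one edge is a step of length at most 1 for the
  coarse chains, and it is traced by an arc for path connectedness.\<close>

definition linked :: "('a \<Rightarrow> real) \<Rightarrow> ('a \<Rightarrow> real) \<Rightarrow> bool" where
  "linked x y \<longleftrightarrow> (x, y) \<in> (Seg \<inter> span_T x y \<times> span_T x y)\<^sup>*"

lemma linked_sym: "linked x y \<Longrightarrow> linked y x"
proof -
  have "sym ((Seg \<inter> span_T x y \<times> span_T x y)\<^sup>*)"
    by (intro sym_rtrancl) (auto simp: sym_def dest: Seg_sym)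
  moreover have "span_T x y = span_T y x" by (auto simp: span_T_def)
  ultimately show "linked x y \<Longrightarrow> linked y x" unfolding linked_def by (metis symD)
qed

text \<open>Passing from \<open>x\<close> to \<open>x'\<close> can only shrink the span, so a link
  from \<open>x'\<close> to \<open>y\<close> stays admissible for \<open>x\<close> and
  \<open>y\<close>.\<close>

lemma linked_step:
  assumes "(x, x') \<in> Seg \<or> x = x'" "x \<in> R" "x' \<in> R" "linked x' y" "\<And>v. x \<in> T v \<Longrightarrow> y \<in> T v \<Longrightarrow> x' \<in> T v"
  shows "linked x y"
proof -
  have "span_T x' y \<subseteq> span_T x y" using assms(5) by (auto simp: span_T_def)
  then have "(x', y) \<in> (Seg \<inter> span_T x y \<times> span_T x y)\<^sup>*"
    using assms(4) rtrancl_mono[of "Seg \<inter> span_T x' y \<times> span_T x' y" "Seg \<inter> span_T x y \<times> span_T x y"]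
    unfolding linked_def by blast
  moreover have "x \<in> span_T x y" "x' \<in> span_T x y" using assms by (auto simp: span_T_def)
  ultimately show ?thesis
    using assms(1) unfolding linked_def by (auto intro: converse_rtrancl_into_rtrancl)
qed

text \<open>Descend from whichever of the two vertices is higher; it can leave \<open>T v\<close> only if it
  equals \<open>v\<close>, and then the other vertex is not above \<open>v\<close>.\<close>

lemma linked_vertices: "a \<in> V \<Longrightarrow> b \<in> V \<Longrightarrow> linked (vertex_pt a) (vertex_pt b)"
proof (induction "lev a + lev b" arbitrary: a b rule: less_induct)
  case less
  have step: "linked (vertex_pt a) (vertex_pt b)"
    if ab: "a \<in> V" "b \<in> V" "a \<noteq> b" "lev b \<le> lev a" and
      IH: "\<And>a' b'. lev a' + lev b' < lev a + lev b \<Longrightarrow> a' \<in> V \<Longrightarrow> b' \<in> V \<Longrightarrow>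
        linked (vertex_pt a') (vertex_pt b')" for a b
  proof -
    have "lev a \<noteq> 0" using ab lev_0_iff[of a] lev_0_iff[of b] by auto
    then obtain p where p: "p \<in> V" "chd p a" "lev a = Suc (lev p)"
      using parent_exists[OF ab(1)] not0_implies_Suc by metis
    show ?thesis
    proof (rule linked_step)
      show "linked (vertex_pt p) (vertex_pt b)" using IH[of p b] p ab by simp
      show "(vertex_pt a, vertex_pt p) \<in> Seg \<or> vertex_pt a = vertex_pt p"
        using Seg_sym[OF Seg_child[OF p(2)]] by blast
      show "vertex_pt p \<in> T v" if "vertex_pt a \<in> T v" "vertex_pt b \<in> T v" for v
      proof -
        have "desc v a" "desc v b" using that ab by (simp_all add: vertex_in_T_iff)
        moreover have "v \<noteq> a" using \<open>desc v b\<close> desc_lev[of v b] ab by auto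
        ultimately show ?thesis using desc_child_iff[OF p(2)] p by (simp add: vertex_in_T_iff)
      qed
    qed (use ab p vertex_in_R in auto)
  qed
  consider "a = b" | "a \<noteq> b" "lev b \<le> lev a" | "a \<noteq> b" "lev a \<le> lev b" by linarith
  then show ?case
  proof cases
    case 1
    then show ?thesis by (simp add: linked_def)
  next
    case 2
    then show ?thesis using step[of a b] less by blast
  next
    case 3
    then have "linked (vertex_pt b) (vertex_pt a)"
      using step[of b a] less by (metis add.commute)
    then show ?thesis by (rule linked_sym)
  qed
qed

text \<open>An interior point of an edge lies in the same sets \<open>T v\<close> as the end nearer
  to the root, so the first step of a link can lead there.\<close>

lemma base_vertex:
  assumes "x \<in> R"
  obtains b where "b \<in> V" "(x, vertex_pt b) \<in> Seg \<or> x = vertex_pt b"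
    "\<And>v. x \<in> T v \<longleftrightarrow> vertex_pt b \<in> T v"
  using assms
proof (cases rule: R_cases)
  case (edge u w t)
  have "(edge_pt u w t, edge_pt u w 0) \<in> Seg" using edge unfolding Seg_def by force
  then show ?thesis
    using that[of u] edge edge_in_T_iff[of u w t] vertex_in_T_iff child_in_V[OF edge(1)]
    by (simp add: edge_pt_0)
qed (use that in blast)

lemma linked_points:
  assumes "x \<in> R" "y \<in> R"
  shows "linked x y"
proof -
  obtain a where a: "a \<in> V" "(x, vertex_pt a) \<in> Seg \<or> x = vertex_pt a"
    "\<And>v. x \<in> T v \<longleftrightarrow> vertex_pt a \<in> T v" using base_vertex[OF assms(1)] by metis
  obtain b where b: "b \<in> V" "(y, vertex_pt b) \<in> Seg \<or> y = vertex_pt b"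
    "\<And>v. y \<in> T v \<longleftrightarrow> vertex_pt b \<in> T v" using base_vertex[OF assms(2)] by metis
  have "linked x (vertex_pt b)"
    by (rule linked_step[OF a(2) assms(1) vertex_in_R[OF a(1)] linked_vertices[OF a(1) b(1)]])
      (simp add: a(3))
  then have "linked (vertex_pt b) x" by (rule linked_sym)
  then have "linked y x"
    by (rule linked_step[OF b(2) assms(2) vertex_in_R[OF b(1)]]) (simp add: b(3))
  then show ?thesis by (rule linked_sym)
qed

lemma T_cover:
  assumes "x \<in> R" "real k \<le> d (vertex_pt r) x"
  shows "\<exists>v\<in>V. lev v = k \<and> x \<in> T v"
  using assms(1)
proof (cases rule: R_cases)
  case (vertex w)
  then show ?thesis
    using ancestor_exists[of w k] assms by (auto simp: height_vertex vertex_in_T_iff)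
next
  case (edge u w t)
  \<comment> \<open>The strict bound \<open>t < 1\<close> matters: as levels are integers, height at
    least \<open>k\<close> already gives \<open>lev u\<close> at least \<open>k\<close>.\<close>
  then have "real k < real (lev u) + 1" using assms height_edge[of u w t] by simp
  then have "k \<le> lev u" by linarith
  then show ?thesis
    using ancestor_exists[of u k] edge child_in_V[OF edge(1)] by (auto simp: edge_in_T_iff)
qed

lemma T_height:
  assumes "v \<in> V" "x \<in> T v"
  shows "real (lev v) \<le> d (vertex_pt r) x"
proof -
  have "x \<in> R" using assms by (simp add: T_def)
  then show ?thesis
  proof (cases rule: R_cases)
    case (vertex w)
    then show ?thesis using assms desc_lev[of v w] by (auto simp: height_vertex vertex_in_T_iff)
  next
    case (edge u w t)
    then show ?thesis using assms desc_lev[of v u] by (auto simp: height_edge edge_in_T_iff)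
  qed
qed

lemma T_disjoint:
  assumes "lev u = lev v" "x \<in> T u" "x \<in> T v"
  shows "u = v"
proof -
  have "x \<in> R" using assms by (simp add: T_def)
  then show ?thesis
  proof (cases rule: R_cases)
    case (vertex w)
    then show ?thesis using assms ancestor_unique[of u w v] by (auto simp: vertex_in_T_iff)
  next
    case (edge a w t)
    then show ?thesis using assms ancestor_unique[of u a v] by (auto simp: edge_in_T_iff)
  qed
qed

end

section \<open>Compactness, paths and rays in a finitely branching tree\<close>

locale finitely_branching_tree = rooted_tree_graph +
  assumes fin_br: "finitely_branching V G r"
begin

lemma finite_level: "finite {v \<in> V. lev v = k}"
proof (induction k)
  case 0
  have "{v \<in> V. lev v = 0} \<subseteq> {r}" using lev_0_iff by auto
  then show ?case by (rule finite_subset) simp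
next
  case (Suc k)
  have "{v \<in> V. lev v = Suc k} \<subseteq> (\<Union>u\<in>{v \<in> V. lev v = k}. {v. chd u v})"
    using parent_exists by blast
  moreover have "finite {v. chd u v}" if "u \<in> V" for u
    using fin_br that by (auto simp: finitely_branching_def)
  ultimately show ?case using Suc by (elim finite_subset) auto
qed

sublocale branching_space R d V chd lev r vertex_pt T
proof
  show "\<exists>u\<in>V. chd u v" if "v \<in> V" "lev v = Suc k" for v k
    using parent_exists[OF that] by blast
  show "u \<in> V \<and> v \<in> V" if "chd u v" for u v
    by (rule child_in_V[OF that])
  show "T v \<subseteq> T u" if "chd u v" for u v
    using child_desc_trans[OF that] by (auto simp: T_def)
  show "d (vertex_pt u) (vertex_pt v) \<le> 1" if "chd u v" for u v
    using dist_edge[OF that, of 0 1] by (simp add: edge_pt_0 edge_pt_1)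
  fix x y assume xy: "x \<in> R" "y \<in> R"
  have "Seg \<inter> span_T x y \<times> span_T x y \<subseteq> {(a, b). d a b \<le> 1 \<and> a \<in> R \<and> b \<in> R \<and>
                  (\<forall>v\<in>V. x \<in> T v \<and> y \<in> T v \<longrightarrow> a \<in> T v \<and> b \<in> T v)}"
    by (auto simp: span_T_def Seg_def dist_edge)
  from rtrancl_mono[OF this] show "(x, y) \<in> {(a, b). d a b \<le> 1 \<and> a \<in> R \<and> b \<in> R \<and>
                  (\<forall>v\<in>V. x \<in> T v \<and> y \<in> T v \<longrightarrow> a \<in> T v \<and> b \<in> T v)}\<^sup>*"
    using linked_points[OF xy] unfolding linked_def by blast
qed (use finite_level r_in_V lev_0_iff vertex_in_T_iff T_cover T_height T_disjoint T_separation
    in \<open>auto simp: child_def T_def\<close>)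

lemma edge_continuous:
  assumes "chd u w"
  shows "continuous_map (top_of_set {0..1}) mtopology (edge_pt u w)"
  by (rule continuous_map_lipschitz) (use edge_in_R[OF assms] dist_edge[OF assms] in auto)

lemma edge_in_T_closed_iff:
  assumes "chd u w" "0 \<le> t" "t \<le> 1"
  shows "edge_pt u w t \<in> T v \<longleftrightarrow> (if t = 1 then desc v w else desc v u)"
  using assms edge_in_T_iff[of u w t v] vertex_in_T_iff[of w v] child_in_V[OF assms(1)]
  by (auto simp: edge_pt_1)

lemma Seg_in_T:
  assumes "(x, y) \<in> Seg" "x \<in> T v" "y \<in> T v"
  shows "\<exists>A. path_connectedin mtopology A \<and> x \<in> A \<and> y \<in> A \<and> A \<subseteq> T v"
proof -
  obtain u w s t where st: "chd u w" "0 \<le> s" "s \<le> 1" "0 \<le> t" "t \<le> 1"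
    "x = edge_pt u w s" "y = edge_pt u w t" using assms(1) unfolding Seg_def by blast
  let ?A = "edge_pt u w ` {min s t..max s t}"
  have "path_connectedin (top_of_set {0..1}) {min s t..max s t}"
    using st by (auto simp: path_connectedin_subtopology intro!: convex_imp_path_connected)
  then have "path_connectedin mtopology ?A"
    by (rule path_connectedin_continuous_map_image[OF edge_continuous[OF st(1)]])
  moreover have "edge_pt u w p \<in> T v" if "p \<in> {min s t..max s t}" for p
  proof -
    have p: "0 \<le> p" "p \<le> 1" using that st by auto
    \<comment> \<open>If \<open>u\<close> is not a descendant of \<open>v\<close>, then both points
      are the end \<open>w\<close>, and the arc between them is a single point.\<close>
    have "desc v u \<or> s = 1" "desc v u \<or> t = 1" "desc v w"
      using assms(2,3) st edge_in_T_closed_iff[OF st(1)] desc_child_iff[OF st(1), of v]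
      by (auto split: if_splits)
    then show ?thesis using edge_in_T_closed_iff[OF st(1) p, of v] that p by auto
  qed
  ultimately show ?thesis using st by (intro exI[of _ ?A]) auto
qed

lemma T_path_connected: "path_connectedin mtopology (T v)"
  unfolding path_connectedin_def path_connected_space_iff_path_component
proof (intro conjI ballI)
  show TR: "T v \<subseteq> topspace mtopology" by (auto simp: T_def)
  fix x y assume "x \<in> topspace (subtopology mtopology (T v))" "y \<in> topspace (subtopology mtopology (T v))"
  then have xy: "x \<in> T v" "y \<in> T v" "x \<in> R" "y \<in> R" by auto
  have span: "span_T x y \<subseteq> T v" using xy by (auto simp: span_T_def)
  have "(x, y) \<in> (Seg \<inter> span_T x y \<times> span_T x y)\<^sup>*" using linked_points[OF xy(3,4)] by (simp add: linked_def)
  then show "path_component_of (subtopology mtopology (T v)) x y"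
  proof (induction rule: rtrancl_induct)
    case base
    then show ?case using xy by (simp add: path_component_of_refl)
  next
    case (step y z)
    then obtain A where "path_connectedin mtopology A" "y \<in> A" "z \<in> A" "A \<subseteq> T v"
      using Seg_in_T[of y z v] span by blast
    then have "path_component_of (subtopology mtopology (T v)) y z"
      unfolding path_component_of by (auto simp: path_connectedin_subtopology)
    then show ?case using step.IH path_component_of_trans by metis
  qed
qed

lemma compact_exhaustion: "\<exists>K. compactin mtopology K \<and> {x \<in> R. d (vertex_pt r) x \<le> real k} \<subseteq> K"
proof -
  let ?E = "{(u, w). chd u w \<and> lev u \<le> k}"
  \<comment> \<open>A vertex other than the root is the far end of the edge from its parent; the
    root has no parent and is added separately.\<close>
  let ?K = "\<Union>(insert {vertex_pt r} ((\<lambda>(u, w). edge_pt u w ` {0..1}) ` ?E))"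
  have "finite {u \<in> V. lev u \<le> k}"
  proof (rule finite_subset)
    show "{u \<in> V. lev u \<le> k} \<subseteq> (\<Union>i\<le>k. {u \<in> V. lev u = i})" by auto
  qed (use finite_level in auto)
  moreover have "finite {v. chd u v}" if "u \<in> V" for u
    using fin_br that by (auto simp: finitely_branching_def)
  ultimately have "finite (SIGMA u:{u \<in> V. lev u \<le> k}. {w. chd u w})" by (intro finite_SigmaI) auto
  then have "finite ?E" by (rule rev_finite_subset) (auto dest: child_in_V)
  moreover have "compactin mtopology (edge_pt u w ` {0..1})" if "chd u w" for u w
    by (rule image_compactin[OF _ edge_continuous[OF that]]) (simp add: compactin_subtopology)
  ultimately have "compactin mtopology ?K"
    using vertex_in_R[OF r_in_V] by (intro compactin_Union) auto
  moreover have "x \<in> ?K" if x: "x \<in> R" "d (vertex_pt r) x \<le> real k" for x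
    using x(1)
  proof (cases rule: R_cases)
    case (vertex v)
    show ?thesis
    proof (cases "lev v")
      case 0
      then show ?thesis using vertex lev_0_iff by auto
    next
      case (Suc l)
      then obtain u where u: "chd u v" "lev u = l" using parent_exists vertex by metis
      have "(u, v) \<in> ?E" using u Suc x(2) vertex by (simp add: height_vertex)
      moreover have "x \<in> edge_pt u v ` {0..1}" using vertex by (auto simp flip: edge_pt_1[of u v])
      ultimately show ?thesis by blast
    qed
  next
    case (edge u w t)
    then have "(u, w) \<in> ?E" using x(2) by (simp add: height_edge)
    moreover have "x \<in> edge_pt u w ` {0..1}" using edge by auto
    ultimately show ?thesis by blast
  qed
  ultimately show ?thesis by blast
qed

lemma branch_ray:
  assumes f: "\<And>i. chd (f i) (f (Suc i))"
  shows "\<exists>\<rho>. (\<forall>s\<ge>0. \<forall>t\<ge>0. d (\<rho> s) (\<rho> t) \<le> \<bar>s - t\<bar>) \<and> (\<forall>k. \<forall>t\<ge>real k. \<rho> t \<in> T (f k))"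
proof -
  define \<rho> where "\<rho> t = edge_pt (f (nat \<lfloor>t\<rfloor>)) (f (Suc (nat \<lfloor>t\<rfloor>))) (t - real (nat \<lfloor>t\<rfloor>))" for t
  have fl: "real (nat \<lfloor>t\<rfloor>) \<le> t \<and> t < real (nat \<lfloor>t\<rfloor>) + 1" if "0 \<le> t" for t
    using that by linarith
  have \<rho>R: "\<rho> t \<in> R" if "0 \<le> t" for t
    unfolding \<rho>_def by (rule edge_in_R[OF f]) (use fl[OF that] in linarith)+
  have fV: "vertex_pt (f i) \<in> R" for i using f child_in_V vertex_in_R by blast
  \<comment> \<open>The Lipschitz condition needs upper bounds only, so lengths are summed along the
    branch: from \<open>\<rho> s\<close> to the last vertex before \<open>\<rho> t\<close>, then
    within one edge.\<close>
  have to_vertex: "d (\<rho> s) (vertex_pt (f (Suc (nat \<lfloor>s\<rfloor>) + k))) \<le> real (Suc (nat \<lfloor>s\<rfloor>) + k) - s"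
    if s: "0 \<le> s" for s k
  proof (induction k)
    case 0
    have "d (\<rho> s) (edge_pt (f (nat \<lfloor>s\<rfloor>)) (f (Suc (nat \<lfloor>s\<rfloor>))) 1) = \<bar>(s - real (nat \<lfloor>s\<rfloor>)) - 1\<bar>"
      unfolding \<rho>_def by (rule dist_edge[OF f]) (use fl[OF s] in linarith)+
    then show ?case using fl[OF s] unfolding edge_pt_1 add_0_right of_nat_Suc by linarith
  next
    case (Suc k)
    let ?i = "Suc (nat \<lfloor>s\<rfloor>) + k"
    have "d (\<rho> s) (vertex_pt (f (Suc ?i))) \<le> d (\<rho> s) (vertex_pt (f ?i)) + d (vertex_pt (f ?i)) (vertex_pt (f (Suc ?i)))"
      by (rule triangle[OF \<rho>R[OF s] fV fV])
    moreover have "d (vertex_pt (f ?i)) (vertex_pt (f (Suc ?i))) = 1"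
      using dist_edge[OF f, of 0 1 ?i] by (simp add: edge_pt_0 edge_pt_1)
    ultimately show ?case using Suc by simp
  qed
  have le: "d (\<rho> s) (\<rho> t) \<le> t - s" if st: "0 \<le> s" "s \<le> t" for s t
  proof (cases "nat \<lfloor>s\<rfloor> = nat \<lfloor>t\<rfloor>")
    case True
    have "d (\<rho> s) (\<rho> t) = \<bar>(s - real (nat \<lfloor>s\<rfloor>)) - (t - real (nat \<lfloor>s\<rfloor>))\<bar>"
      unfolding \<rho>_def True[symmetric] by (rule dist_edge[OF f]) (use fl[of s] fl[of t] True st in linarith)+
    then show ?thesis using st by simp
  next
    case False
    moreover have "nat \<lfloor>s\<rfloor> \<le> nat \<lfloor>t\<rfloor>" using st by (intro nat_mono floor_mono)
    ultimately have "nat \<lfloor>t\<rfloor> = Suc (nat \<lfloor>s\<rfloor>) + (nat \<lfloor>t\<rfloor> - Suc (nat \<lfloor>s\<rfloor>))" by simp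
    then obtain k where k: "nat \<lfloor>t\<rfloor> = Suc (nat \<lfloor>s\<rfloor>) + k" by blast
    have t0: "0 \<le> t" using st by simp
    have "d (\<rho> s) (\<rho> t) \<le> d (\<rho> s) (vertex_pt (f (nat \<lfloor>t\<rfloor>))) + d (vertex_pt (f (nat \<lfloor>t\<rfloor>))) (\<rho> t)"
      by (rule triangle[OF \<rho>R[OF st(1)] fV \<rho>R[OF t0]])
    moreover have "d (edge_pt (f (nat \<lfloor>t\<rfloor>)) (f (Suc (nat \<lfloor>t\<rfloor>))) 0) (\<rho> t) = \<bar>0 - (t - real (nat \<lfloor>t\<rfloor>))\<bar>"
      unfolding \<rho>_def by (rule dist_edge[OF f]) (use fl[OF t0] in linarith)+
    ultimately show ?thesis using to_vertex[OF st(1), of k] fl[OF t0] unfolding k[symmetric] by (simp add: edge_pt_0)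
  qed
  have "d (\<rho> s) (\<rho> t) \<le> \<bar>s - t\<bar>" if "0 \<le> s" "0 \<le> t" for s t
    using le[of s t] le[of t s] that commute[of "\<rho> s" "\<rho> t"] by (cases "s \<le> t") auto
  moreover have desc: "desc (f k) (f (k + i))" for k i
    by (induction i) (use f desc_child_iff in auto)
  have "\<rho> t \<in> T (f k)" if "real k \<le> t" for k t
  proof -
    have t0: "0 \<le> t" using that of_nat_0_le_iff[of k] by linarith
    have "k \<le> nat \<lfloor>t\<rfloor>" using that by linarith
    then have "desc (f k) (f (nat \<lfloor>t\<rfloor>))" using desc[of k "nat \<lfloor>t\<rfloor> - k"] by simp
    moreover have "0 \<le> t - real (nat \<lfloor>t\<rfloor>)" "t - real (nat \<lfloor>t\<rfloor>) < 1" using fl[OF t0] by linarith+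
    ultimately show ?thesis unfolding \<rho>_def using edge_in_T_iff[OF f] by blast
  qed
  ultimately show ?thesis by blast
qed

sublocale branching_length_space R d V chd lev r vertex_pt T
  by unfold_locales (use T_path_connected compact_exhaustion branch_ray in auto)

end

section \<open>Invariance under asymorphism\<close>

lemma rtrancl_map:
  assumes "(x, y) \<in> Q\<^sup>*" "\<And>a b. (a, b) \<in> Q \<Longrightarrow> (f a, f b) \<in> Q'"
  shows "(f x, f y) \<in> Q'\<^sup>*"
  using assms(1) by (induction rule: rtrancl_induct) (auto intro: rtrancl_into_rtrancl assms(2))

text \<open>The metric on \<open>Y\<close> is pulled back along the inverse of
  \<open>\<kappa>\<close>, which makes \<open>\<kappa>\<close> an isometry, and the subtrees are
  replaced by their images.\<close>

lemma (in branching_space) transport: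
  assumes bij: "bij_betw \<kappa> X Y"
  shows "branching_space Y (\<lambda>a b. d (inv_into X \<kappa> a) (inv_into X \<kappa> b)) V chld lev r (\<kappa> \<circ> pt) (\<lambda>v. \<kappa> ` T v)"
proof -
  let ?g = "inv_into X \<kappa>"
  have g: "?g (\<kappa> x) = x" if "x \<in> X" for x using bij that by (simp add: bij_betw_inv_into_left)
  have gY: "?g y \<in> X" "\<kappa> (?g y) = y" if "y \<in> Y" for y
    using that bij by (auto simp: bij_betw_inv_into_right bij_betwE[OF bij_betw_inv_into[OF bij]])
  have \<kappa>Y: "\<kappa> x \<in> Y" if "x \<in> X" for x using that bij by (auto simp: bij_betw_def)
  have ptX: "pt v \<in> X" if "v \<in> V" for v using that T_subset pt_in_T by blast
  have mem: "y \<in> \<kappa> ` T v \<longleftrightarrow> ?g y \<in> T v" if "v \<in> V" "y \<in> Y" for v y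
  proof
    assume "y \<in> \<kappa> ` T v"
    then show "?g y \<in> T v" using T_subset[OF that(1)] g by auto
  next
    assume "?g y \<in> T v"
    then show "y \<in> \<kappa> ` T v" using gY(2)[OF that(2)] by force
  qed
  have TY: "\<kappa> ` T v \<subseteq> Y" if "v \<in> V" for v using T_subset[OF that] \<kappa>Y by auto
  have gr: "?g ((\<kappa> \<circ> pt) r) = pt r" using g ptX root by simp
  show ?thesis
  proof
    show "0 \<le> d (?g x) (?g y)" "d (?g x) (?g y) = d (?g y) (?g x)" for x y
      by (simp_all add: commute)
    show "d (?g x) (?g y) = 0 \<longleftrightarrow> x = y" if "x \<in> Y" "y \<in> Y" for x y
      using that gY by (metis zero)
    show "d (?g x) (?g z) \<le> d (?g x) (?g y) + d (?g y) (?g z)" if "x \<in> Y" "y \<in> Y" "z \<in> Y" for x y z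
      using that gY triangle by blast
    show "finite {v \<in> V. lev v = k}" for k by (rule finite_level)
    show "r \<in> V" by (rule root)
    show "lev v = 0 \<longleftrightarrow> v = r" if "v \<in> V" for v using lev_root that .
    show "u \<in> V \<and> v \<in> V" if "chld u v" for u v using chld_in_V that .
    show "lev v = Suc (lev u)" if "chld u v" for u v using lev_child that .
    show "\<exists>u\<in>V. chld u v" if "v \<in> V" "lev v = Suc k" for v k using parent that .
    show "\<kappa> ` T v \<subseteq> \<kappa> ` T u" if "chld u v" for u v using T_child[OF that] by blast
    show "(\<kappa> \<circ> pt) v \<in> \<kappa> ` T v" if "v \<in> V" for v using pt_in_T[OF that] by simp
    show "\<kappa> ` T v \<subseteq> Y" if "v \<in> V" for v using TY that .
    show "d (?g ((\<kappa> \<circ> pt) u)) (?g ((\<kappa> \<circ> pt) v)) \<le> 1" if "chld u v" for u v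
      using pt_child[OF that] chld_in_V[OF that] g ptX by simp
    show "real (lev v) \<le> d (?g ((\<kappa> \<circ> pt) r)) (?g x)" if "v \<in> V" "x \<in> \<kappa> ` T v" for v x
    proof -
      have "x \<in> Y" using TY that by blast
      then show ?thesis using T_height[OF that(1)] mem that gr by simp
    qed
    show "\<exists>v\<in>V. lev v = k \<and> x \<in> \<kappa> ` T v" if "x \<in> Y" "real k \<le> d (?g ((\<kappa> \<circ> pt) r)) (?g x)" for x k
      using T_cover[of "?g x" k] that gY mem gr by auto
    show "u = v" if "u \<in> V" "v \<in> V" "lev u = lev v" "x \<in> \<kappa> ` T u" "x \<in> \<kappa> ` T v" for u v x
    proof -
      have "x \<in> Y" using TY that by blast
      then show ?thesis using T_disjoint[OF that(1-3), of "?g x"] mem that by simp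
    qed
    show "d (?g ((\<kappa> \<circ> pt) r)) (?g a) \<le> real (lev v) + d (?g a) (?g b)"
      if "v \<in> V" "a \<in> \<kappa> ` T v" "b \<in> Y - \<kappa> ` T v" for v a b
    proof -
      have "a \<in> Y" using TY that by blast
      then have "?g a \<in> T v" "?g b \<in> X - T v" using mem that gY by auto
      then show ?thesis using T_separation[OF that(1)] gr by simp
    qed
    fix x y assume xy: "x \<in> Y" "y \<in> Y"
    let ?Q = "{(a, b). d a b \<le> 1 \<and> a \<in> X \<and> b \<in> X \<and>
                  (\<forall>v\<in>V. ?g x \<in> T v \<and> ?g y \<in> T v \<longrightarrow> a \<in> T v \<and> b \<in> T v)}"
    let ?Q' = "{(a, b). d (?g a) (?g b) \<le> 1 \<and> a \<in> Y \<and> b \<in> Y \<and>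
                  (\<forall>v\<in>V. x \<in> \<kappa> ` T v \<and> y \<in> \<kappa> ` T v \<longrightarrow> a \<in> \<kappa> ` T v \<and> b \<in> \<kappa> ` T v)}"
    have Q: "(\<kappa> a, \<kappa> b) \<in> ?Q'" if "(a, b) \<in> ?Q" for a b
      using that xy g mem \<kappa>Y by auto
    have "(?g x, ?g y) \<in> ?Q\<^sup>*" using T_chain gY xy by simp
    then have "(\<kappa> (?g x), \<kappa> (?g y)) \<in> ?Q'\<^sup>*"
      by (rule rtrancl_map) (rule Q)
    then show "(x, y) \<in> ?Q'\<^sup>*" using gY xy by simp
  qed
qed

text \<open>Bornologous maps in both directions match the controlled sets exactly. Thus the
  abstractly given structure of the copy comes from a metric, as the nonstandard argument
  requires.\<close>

lemma pointed_asymorphism_bounded_coarse: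
  assumes asym: "pointed_asymorphism X (bounded_coarse X d) \<xi> Y \<D> \<eta> \<kappa>"
    and \<D>: "coarse_structure Y \<D>"
  shows "\<D> = bounded_coarse Y (\<lambda>a b. d (inv_into X \<kappa> a) (inv_into X \<kappa> b))"
proof -
  let ?g = "inv_into X \<kappa>"
  have bij: "bij_betw \<kappa> X Y"
    and 1: "\<And>E. E \<in> bounded_coarse X d \<Longrightarrow> map_prod \<kappa> \<kappa> ` E \<in> \<D>"
    and 2: "\<And>F. F \<in> \<D> \<Longrightarrow> map_prod ?g ?g ` F \<in> bounded_coarse X d"
    using asym by (simp_all add: pointed_asymorphism_def coarse_map_def)
  have gY: "?g y \<in> X" "\<kappa> (?g y) = y" if "y \<in> Y" for y
    using that bij by (auto simp: bij_betw_inv_into_right bij_betwE[OF bij_betw_inv_into[OF bij]])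
  have iff: "F \<in> bounded_coarse Y (\<lambda>a b. d (?g a) (?g b)) \<longleftrightarrow> map_prod ?g ?g ` F \<in> bounded_coarse X d"
    if "F \<subseteq> Y \<times> Y" for F
  proof -
    have "map_prod ?g ?g ` F \<subseteq> X \<times> X" using that gY by auto
    moreover have "(\<forall>(x, y)\<in>map_prod ?g ?g ` F. d x y \<le> R) \<longleftrightarrow> (\<forall>(a, b)\<in>F. d (?g a) (?g b) \<le> R)" for R
      by auto
    ultimately show ?thesis using that by (simp add: bounded_coarse_def)
  qed
  show ?thesis
  proof (intro subset_antisym subsetI)
    fix F assume F: "F \<in> \<D>"
    then have "F \<subseteq> Y \<times> Y" using \<D> by (simp add: coarse_structure_def)
    then show "F \<in> bounded_coarse Y (\<lambda>a b. d (?g a) (?g b))" using iff 2[OF F] by blast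
  next
    fix F assume F: "F \<in> bounded_coarse Y (\<lambda>a b. d (?g a) (?g b))"
    then have sub: "F \<subseteq> Y \<times> Y" by (simp add: bounded_coarse_def)
    then have "map_prod \<kappa> \<kappa> ` map_prod ?g ?g ` F \<in> \<D>" using iff F 1 by blast
    moreover have "map_prod \<kappa> \<kappa> ` map_prod ?g ?g ` F = (\<lambda>z. z) ` F"
      unfolding image_image by (rule image_cong) (use sub gY in auto)
    ultimately show "F \<in> \<D>" by simp
  qed
qed

theorem theorem3p1:
  fixes V :: "'a set" and G :: "('a \<times> 'a) set" and r :: 'a
    and m :: "'u \<Rightarrow> 'u \<Rightarrow> bool" and n :: "'v \<Rightarrow> 'v \<Rightarrow> bool" and star :: "'u \<Rightarrow> 'v"
    and \<K> ob X c \<xi> :: 'u and \<kappa> :: "('a \<Rightarrow> real) \<Rightarrow> 'u"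
  assumes tree: "rooted_tree V G r" and fin_br: "finitely_branching V G r"
    and univ: "standard_universe m"
    and elem: "elementary_embedding m n star"
    and saturation: "saturated m n"
    and cat: "small_full_subcategory m \<K>"
    and ob: "ob \<in> elts m \<K>" "codes_pointed_coarse_space m ob X c \<xi>"
    and copy: "pointed_asymorphism (realisation V G) (graph_coarse V G) (vertex_pt r)
                 (elts m X) (coded_rel m ` elts m c) \<xi> \<kappa>"
  shows "coarse_iota m n star X c \<xi> \<approx> infinite_branches V G r
       \<and> coarse_sigma (realisation V G) (graph_coarse V G) (vertex_pt r) \<approx> infinite_branches V G r
       \<and> coarse_epsilon (realisation V G) (graph_coarse V G) (vertex_pt r) \<approx> infinite_branches V G r
       \<and> Ends (graph_topology V G) \<approx> infinite_branches V G r"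
proof -
  interpret finitely_branching_tree V G r
    by unfold_locales (fact tree fin_br)+
  have branches: "branches = infinite_branches V G r"
    by (simp add: branches_def infinite_branches_def)
  let ?d = "\<lambda>a b. path_metric V G (inv_into (realisation V G) \<kappa> a) (inv_into (realisation V G) \<kappa> b)"
  have bij: "bij_betw \<kappa> (realisation V G) (elts m X)" and \<xi>: "\<kappa> (vertex_pt r) = \<xi>"
    using copy by (simp_all add: pointed_asymorphism_def)
  have "coarse_structure (elts m X) (coded_rel m ` elts m c)"
    using ob(2) by (simp add: codes_pointed_coarse_space_def pointed_coarse_space_def)
  then have coarse: "coded_rel m ` elts m c = bounded_coarse (elts m X) ?d"
    by (rule pointed_asymorphism_bounded_coarse[OF copy])
  \<comment> \<open>The realisation serves for \<open>\<sigma>\<close>, \<open>\<epsilon>\<close>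
    and ends, this second instance for \<open>\<iota>\<close>. Both have the same branches, since
    these involve only the vertices, the root and the child relation.\<close>
  interpret copy: nonstandard_branching_space m n star X c ?d V "child G r" "graph_dist G r" r
      "\<kappa> \<circ> vertex_pt" "\<lambda>v. \<kappa> ` T v"
    by (intro nonstandard_branching_space.intro universe.intro elementary_extension.intro
        nonstandard_branching_space_axioms.intro transport univ elem saturation coarse bij)
  have "copy.branches = infinite_branches V G r"
    by (simp add: copy.branches_def infinite_branches_def)
  then show ?thesis
    using copy.coarse_iota_eqpoll coarse_sigma_eqpoll coarse_epsilon_eqpoll Ends_eqpoll \<xi>
    by (simp add: branches)
qed

end
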